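(* Let $A=T/\langle r_1,\ldots,r_m\rangle$ be a graded $K$-algebra of finite complexity $c(A)$ and let $U=T/\langle P\rangle$, $P=\{r_1+l_1,\ldots,r_m+l_m\}$, be a deformation of $A$. Let $P_k\subset T$ $(k\ge 1)$ be the subspaces defined inductively from $P$ by $P_1=\mathrm{span}_K(P\cap F^1T)$ and $P_k=VP_{k-1}+P_{k-1}V+\mathrm{span}_K(P\cap F^kT)$ for $k>1$. Then $U$ is a PBW-deformation of $A$ if and only if $P_1=0$ and the following Jacobi condition is satisfied: $$P_{k+1}\cap F^kT\subset P_k\quad\text{for all } 1\le k\le c(A).$$
   Context: $K$ is a field and $T=K\langle x_1,\ldots,x_n\rangle$ is the free algebra with its standard grading ($\deg x_i=1$) and standard filtration $F^kT=\bigoplus_{i\le k}T_i$; $V$ is the $K$-span of $x_1,\ldots,x_n$. A graded $K$-algebra is $A=T/\langle r_1,\ldots,r_m\rangle$, where $r_1,\ldots,r_m$ are homogeneous elements of $T$ of degree at least $2$ (no linear relations) forming a minimal set of relations for $A$; $A$ inherits the grading of $T$ and $K=A/A_+$ is the trivial module. A deformation of $A$ is an algebra $U=T/\langle r_1+l_1,\ldots,r_m+l_m\rangle$ where $l_1,\ldots,l_m\in T$ are (not necessarily homogeneous) elements with $\deg(l_i)<\deg(r_i)$ for all $i$. $U$ inherits a filtration $F^k(U)$ (the image of $F^kT$), and $gr(U)=\bigoplus_k F^k(U)/F^{k-1}(U)$. The deformation $U$ is a PBW-deformation of $A$ if $gr(U)$ is isomorphic to $A$ (as a graded $K$-algebra).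 The complexity of $A$ is $c(A)=\sup\{n \mid \mathrm{Ext}_A^{3,n}(K,K)\neq 0\}-1$ if the global dimension of $A$ is at least $3$ (here the second superscript is the internal degree, so that $\mathrm{Ext}_A^{3,n}(K,K)\ne 0$ exactly when the third term of the minimal graded free resolution of $K$ has a generator in degree $n$), and $c(A)=0$ if the global dimension of $A$ is less than $3$. *)

theory Defs
  imports
    "HOL-Library.Poly_Mapping"
    "HOL-Library.Extended_Nat"
    "HOL-Library.FuncSet"
    "HOL-Algebra.QuotRing"
    "HOL-Algebra.Module"
begin

section \<open>The free algebra\<close>

text \<open>
  Lists under concatenation form the free monoid, written additively because \<^term>\<open>(*)\<close> on
  \<^typ>\<open>'w \<Rightarrow>\<^sub>0 'k\<close> is the convolution product of the monoid algebra of an additive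
  monoid.  The free algebra on the variables of type \<^typ>\<open>'x\<close> is thus
  \<^typ>\<open>'x list \<Rightarrow>\<^sub>0 'k\<close>; the empty word is the unit monomial.
\<close>

instantiation list :: (type) monoid_add
begin

definition zero_list :: "'a list" where "zero_list = []"
definition plus_list :: "'a list \<Rightarrow> 'a list \<Rightarrow> 'a list" where "plus_list = (@)"

instance by standard (simp_all add: zero_list_def plus_list_def)

end

type_synonym ('x, 'k) free_alg = "'x list \<Rightarrow>\<^sub>0 'k"

definition fa_const :: "'k \<Rightarrow> ('x, 'k::field) free_alg"
  where "fa_const c = Poly_Mapping.single [] c"

definition fa_var :: "'x \<Rightarrow> ('x, 'k::field) free_alg"
  where "fa_var x = Poly_Mapping.single [x] 1"

definition fa_scale :: "'k \<Rightarrow> ('x, 'k::field) free_alg \<Rightarrow> ('x, 'k) free_alg"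
  where "fa_scale c f = fa_const c * f"

global_interpretation fa: vector_space fa_scale
proof
  fix a b :: "'k::field" and f g :: "('x, 'k) free_alg"
  show "fa_scale a (f + g) = fa_scale a f + fa_scale a g"
    by (simp add: fa_scale_def distrib_left)
  show "fa_scale (a + b) f = fa_scale a f + fa_scale b f"
    by (simp add: fa_scale_def fa_const_def single_add distrib_right)
  show "fa_scale a (fa_scale b f) = fa_scale (a * b) f"
    by (simp add: fa_scale_def fa_const_def mult_single plus_list_def flip: mult.assoc)
  show "fa_scale 1 f = f"
    by (simp add: fa_scale_def fa_const_def flip: zero_list_def)
qed

text \<open>\<open>T\<^sub>k\<close>, \<open>F\<^sup>kT\<close>, and \<open>F\<^sup>k\<^sup>-\<^sup>1T\<close>; the last one is \<open>0\<close> for \<open>k = 0\<close>.\<close>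

definition fa_comp :: "nat \<Rightarrow> ('x, 'k::field) free_alg set"
  where "fa_comp k = {f. \<forall>w\<in>Poly_Mapping.keys f. length w = k}"

definition fa_filt :: "nat \<Rightarrow> ('x, 'k::field) free_alg set"
  where "fa_filt k = {f. \<forall>w\<in>Poly_Mapping.keys f. length w \<le> k}"

definition fa_filt_below :: "nat \<Rightarrow> ('x, 'k::field) free_alg set"
  where "fa_filt_below k = {f. \<forall>w\<in>Poly_Mapping.keys f. length w < k}"

text \<open>The convention for the degree of \<open>0\<close> is immaterial below: degrees of \<open>l\<^sub>i\<close> are only
  compared with degrees that are at least \<open>2\<close>.\<close>

definition fa_deg :: "('x, 'k::field) free_alg \<Rightarrow> nat"
  where "fa_deg f = (if f = 0 then 0 else Max (length ` Poly_Mapping.keys f))"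

definition fa_ring :: "('x, 'k::field) free_alg ring"
  where "fa_ring = \<lparr>carrier = UNIV, mult = (*), one = 1, zero = 0, add = (+)\<rparr>"

lemma fa_ring_ring: "ring fa_ring"
proof (rule ringI)
  show "abelian_group fa_ring"
  proof (rule abelian_groupI)
    fix f :: "('x, 'k::field) free_alg"
    show "\<exists>g\<in>carrier fa_ring. g \<oplus>\<^bsub>fa_ring\<^esub> f = \<zero>\<^bsub>fa_ring\<^esub>"
      by (rule bexI[of _ "- f"]) (simp_all add: fa_ring_def)
  qed (simp_all add: fa_ring_def ac_simps)
  show "Group.monoid fa_ring"
    by (rule monoidI) (simp_all add: fa_ring_def mult.assoc)
qed (simp_all add: fa_ring_def algebra_simps)

section \<open>Algebras given by generators and relations\<close>

definition fa_ideal :: "('x, 'k::field) free_alg set \<Rightarrow> ('x, 'k) free_alg set"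
  where "fa_ideal P = Idl\<^bsub>fa_ring\<^esub> P"

definition fa_quot :: "('x, 'k::field) free_alg set \<Rightarrow> ('x, 'k) free_alg set ring"
  where "fa_quot P = fa_ring Quot (fa_ideal P)"

definition fa_proj :: "('x, 'k::field) free_alg set \<Rightarrow> ('x, 'k) free_alg \<Rightarrow> ('x, 'k) free_alg set"
  where "fa_proj P f = fa_ideal P +>\<^bsub>fa_ring\<^esub> f"

definition quot_comp :: "('x, 'k::field) free_alg set \<Rightarrow> nat \<Rightarrow> ('x, 'k) free_alg set set"
  where "quot_comp P k = fa_proj P ` fa_comp k"

definition quot_filt :: "('x, 'k::field) free_alg set \<Rightarrow> nat \<Rightarrow> ('x, 'k) free_alg set set"
  where "quot_filt P k = fa_proj P ` fa_filt k"

definition quot_filt_below :: "('x, 'k::field) free_alg set \<Rightarrow> nat \<Rightarrow> ('x, 'k) free_alg set set"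
  where "quot_filt_below P k = fa_proj P ` fa_filt_below k"

section \<open>Graded algebras and PBW-deformations\<close>

text \<open>A graded \<open>K\<close>-algebra \<open>\<Oplus>\<^sub>k B\<^sub>k\<close> is given by its components \<open>B\<^sub>k\<close>, the vector space structure
  on each of them, the products \<open>B\<^sub>i \<times> B\<^sub>j \<rightarrow> B\<^sub>i\<^sub>+\<^sub>j\<close> and the unit in \<open>B\<^sub>0\<close>.\<close>

record ('k, 'b) graded_alg =
  gcomp :: "nat \<Rightarrow> 'b set"
  gadd :: "nat \<Rightarrow> 'b \<Rightarrow> 'b \<Rightarrow> 'b"
  gscale :: "nat \<Rightarrow> 'k \<Rightarrow> 'b \<Rightarrow> 'b"
  gmult :: "nat \<Rightarrow> nat \<Rightarrow> 'b \<Rightarrow> 'b \<Rightarrow> 'b"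
  gunit :: 'b

definition graded_alg_iso ::
    "('k, 'b) graded_alg \<Rightarrow> ('k, 'c) graded_alg \<Rightarrow> (nat \<Rightarrow> 'b \<Rightarrow> 'c) \<Rightarrow> bool"
  where "graded_alg_iso B C \<phi> \<longleftrightarrow>
    (\<forall>i. bij_betw (\<phi> i) (gcomp B i) (gcomp C i)) \<and>
    (\<forall>i. \<forall>x\<in>gcomp B i. \<forall>y\<in>gcomp B i. \<phi> i (gadd B i x y) = gadd C i (\<phi> i x) (\<phi> i y)) \<and>
    (\<forall>i c. \<forall>x\<in>gcomp B i. \<phi> i (gscale B i c x) = gscale C i c (\<phi> i x)) \<and>
    (\<forall>i j. \<forall>x\<in>gcomp B i. \<forall>y\<in>gcomp B j.
        \<phi> (i + j) (gmult B i j x y) = gmult C i j (\<phi> i x) (\<phi> j y)) \<and>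
    \<phi> 0 (gunit B) = gunit C"

text \<open>\<open>A = T/\<langle>P\<rangle>\<close> with the grading inherited from \<open>T\<close> (for homogeneous \<open>P\<close>).\<close>

definition quot_graded :: "('x, 'k::field) free_alg set \<Rightarrow> ('k, ('x, 'k) free_alg set) graded_alg"
  where "quot_graded P =
    \<lparr>gcomp = quot_comp P,
     gadd = (\<lambda>i x y. x \<oplus>\<^bsub>fa_quot P\<^esub> y),
     gscale = (\<lambda>i c x. fa_proj P (fa_const c) \<otimes>\<^bsub>fa_quot P\<^esub> x),
     gmult = (\<lambda>i j x y. x \<otimes>\<^bsub>fa_quot P\<^esub> y),
     gunit = \<one>\<^bsub>fa_quot P\<^esub>\<rparr>"

text \<open>\<open>gr(U)\<close> for \<open>U = T/\<langle>P\<rangle>\<close>: the elements of \<open>F\<^sup>kU/F\<^sup>k\<^sup>-\<^sup>1U\<close> are additive cosets of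
  \<open>F\<^sup>k\<^sup>-\<^sup>1U\<close>.  Operations are taken on all representatives; the unions are unions of
  equal cosets, as in \<^const>\<open>rcoset_mult\<close>.\<close>

definition gr_class ::
    "('x, 'k::field) free_alg set \<Rightarrow> nat \<Rightarrow> ('x, 'k) free_alg set \<Rightarrow> ('x, 'k) free_alg set set"
  where "gr_class P k u = quot_filt_below P k +>\<^bsub>fa_quot P\<^esub> u"

definition assoc_graded ::
    "('x, 'k::field) free_alg set \<Rightarrow> ('k, ('x, 'k) free_alg set set) graded_alg"
  where "assoc_graded P =
    \<lparr>gcomp = (\<lambda>i. gr_class P i ` quot_filt P i),
     gadd = (\<lambda>i X Y. \<Union>x\<in>X. \<Union>y\<in>Y. gr_class P i (x \<oplus>\<^bsub>fa_quot P\<^esub> y)),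
     gscale = (\<lambda>i c X. \<Union>x\<in>X. gr_class P i (fa_proj P (fa_const c) \<otimes>\<^bsub>fa_quot P\<^esub> x)),
     gmult = (\<lambda>i j X Y. \<Union>x\<in>X. \<Union>y\<in>Y. gr_class P (i + j) (x \<otimes>\<^bsub>fa_quot P\<^esub> y)),
     gunit = gr_class P 0 \<one>\<^bsub>fa_quot P\<^esub>\<rparr>"

definition graded_presentation :: "nat \<Rightarrow> (nat \<Rightarrow> ('x, 'k::field) free_alg) \<Rightarrow> bool"
  where "graded_presentation m r \<longleftrightarrow>
    (\<forall>i\<in>{1..m}. \<exists>d\<ge>2. r i \<in> fa_comp d) \<and>
    (\<forall>i\<in>{1..m}. r i \<notin> fa_ideal (r ` ({1..m} - {i})))"

definition deformation ::
    "nat \<Rightarrow> (nat \<Rightarrow> ('x, 'k::field) free_alg) \<Rightarrow> (nat \<Rightarrow> ('x, 'k) free_alg) \<Rightarrow> bool"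
  where "deformation m r l \<longleftrightarrow> (\<forall>i\<in>{1..m}. fa_deg (l i) < fa_deg (r i))"

text \<open>\<open>U = T/\<langle>P\<rangle>\<close> is a PBW-deformation of \<open>A = T/\<langle>R\<rangle>\<close> (given that it is a deformation).\<close>

definition is_PBW :: "('x, 'k::field) free_alg set \<Rightarrow> ('x, 'k) free_alg set \<Rightarrow> bool"
  where "is_PBW R P \<longleftrightarrow> (\<exists>\<phi>. graded_alg_iso (assoc_graded P) (quot_graded R) \<phi>)"

section \<open>The subspaces \<open>P\<^sub>k\<close>\<close>

definition fa_V :: "('x, 'k::field) free_alg set"
  where "fa_V = fa.span (range fa_var)"

definition fa_prod ::
    "('x, 'k::field) free_alg set \<Rightarrow> ('x, 'k) free_alg set \<Rightarrow> ('x, 'k) free_alg set"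
  where "fa_prod X Y = fa.span {f * g |f g. f \<in> X \<and> g \<in> Y}"

text \<open>Only \<open>k \<ge> 1\<close> is meaningful.\<close>

fun P_space :: "('x, 'k::field) free_alg set \<Rightarrow> nat \<Rightarrow> ('x, 'k) free_alg set" where
  "P_space P 0 = {0}"
| "P_space P (Suc 0) = fa.span (P \<inter> fa_filt 1)"
| "P_space P (Suc (Suc k)) =
     {f + g + h |f g h. f \<in> fa_prod fa_V (P_space P (Suc k)) \<and>
                        g \<in> fa_prod (P_space P (Suc k)) fa_V \<and>
                        h \<in> fa.span (P \<inter> fa_filt (Suc (Suc k)))}"

section \<open>Modules over a noncommutative ring\<close>

text \<open>The library locale \<^locale>\<open>module\<close> without commutativity of the ring.\<close>

locale left_module = R?: ring R + M?: abelian_group M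
    for R (structure) and M :: "('a, 'm, 'd) module_scheme" (structure) +
  assumes smult_closed:
      "a \<in> carrier R \<Longrightarrow> x \<in> carrier M \<Longrightarrow> a \<odot>\<^bsub>M\<^esub> x \<in> carrier M"
    and smult_l_distr:
      "a \<in> carrier R \<Longrightarrow> b \<in> carrier R \<Longrightarrow> x \<in> carrier M \<Longrightarrow>
       (a \<oplus>\<^bsub>R\<^esub> b) \<odot>\<^bsub>M\<^esub> x = a \<odot>\<^bsub>M\<^esub> x \<oplus>\<^bsub>M\<^esub> b \<odot>\<^bsub>M\<^esub> x"
    and smult_r_distr:
      "a \<in> carrier R \<Longrightarrow> x \<in> carrier M \<Longrightarrow> y \<in> carrier M \<Longrightarrow>
       a \<odot>\<^bsub>M\<^esub> (x \<oplus>\<^bsub>M\<^esub> y) = a \<odot>\<^bsub>M\<^esub> x \<oplus>\<^bsub>M\<^esub> a \<odot>\<^bsub>M\<^esub> y"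
    and smult_assoc:
      "a \<in> carrier R \<Longrightarrow> b \<in> carrier R \<Longrightarrow> x \<in> carrier M \<Longrightarrow>
       (a \<otimes>\<^bsub>R\<^esub> b) \<odot>\<^bsub>M\<^esub> x = a \<odot>\<^bsub>M\<^esub> (b \<odot>\<^bsub>M\<^esub> x)"
    and smult_one:
      "x \<in> carrier M \<Longrightarrow> \<one>\<^bsub>R\<^esub> \<odot>\<^bsub>M\<^esub> x = x"

text \<open>Homomorphisms are extensional functions, so that equality of functions is equality of
  homomorphisms.\<close>

definition lmod_hom :: "'a ring \<Rightarrow> ('a, 'm) module \<Rightarrow> ('a, 'n) module \<Rightarrow> ('m \<Rightarrow> 'n) set"
  where "lmod_hom R M N = {f \<in> carrier M \<rightarrow>\<^sub>E carrier N.
    (\<forall>x\<in>carrier M. \<forall>y\<in>carrier M. f (x \<oplus>\<^bsub>M\<^esub> y) = f x \<oplus>\<^bsub>N\<^esub> f y) \<and>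
    (\<forall>a\<in>carrier R. \<forall>x\<in>carrier M. f (a \<odot>\<^bsub>M\<^esub> x) = a \<odot>\<^bsub>N\<^esub> f x)}"

text \<open>The free left module on \<open>S\<close>: finitely supported functions \<open>S \<rightarrow> R\<close>, extended by \<open>0\<close>.
  The multiplicative fields of the module record play no role.\<close>

definition free_lmod :: "'a ring \<Rightarrow> 's set \<Rightarrow> ('a, 's \<Rightarrow> 'a) module"
  where "free_lmod R S =
    \<lparr>carrier = {f. (\<forall>s. f s \<in> carrier R) \<and> (\<forall>s. s \<notin> S \<longrightarrow> f s = \<zero>\<^bsub>R\<^esub>) \<and>
                   finite {s. f s \<noteq> \<zero>\<^bsub>R\<^esub>}},
     mult = undefined, one = undefined,
     zero = (\<lambda>s. \<zero>\<^bsub>R\<^esub>),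
     add = (\<lambda>f g s. f s \<oplus>\<^bsub>R\<^esub> g s),
     smult = (\<lambda>a f s. a \<otimes>\<^bsub>R\<^esub> f s)\<rparr>"

text \<open>Projective means direct summand of a free module.  A generating set can be chosen inside
  the module, so index sets in the carrier type suffice.\<close>

definition projective_lmod :: "'a ring \<Rightarrow> ('a, 'm) module \<Rightarrow> bool"
  where "projective_lmod R M \<longleftrightarrow> left_module R M \<and>
    (\<exists>(S :: 'm set) f g. f \<in> lmod_hom R M (free_lmod R S) \<and> g \<in> lmod_hom R (free_lmod R S) M \<and>
       (\<forall>x\<in>carrier M. g (f x) = x))"

text \<open>Exactness of \<open>\<dots> \<rightarrow> Q\<^sub>2 \<rightarrow> Q\<^sub>1 \<rightarrow> Q\<^sub>0 \<rightarrow> M \<rightarrow> 0\<close> with \<open>d i : Q\<^sub>i\<^sub>+\<^sub>1 \<rightarrow> Q\<^sub>i\<close> and \<open>e : Q\<^sub>0 \<rightarrow> M\<close>.\<close>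

definition resolution ::
    "'a ring \<Rightarrow> ('a, 'm) module \<Rightarrow> (nat \<Rightarrow> ('a, 'q) module) \<Rightarrow> (nat \<Rightarrow> 'q \<Rightarrow> 'q) \<Rightarrow> ('q \<Rightarrow> 'm) \<Rightarrow> bool"
  where "resolution R M Q d e \<longleftrightarrow>
    left_module R M \<and> (\<forall>i. left_module R (Q i)) \<and>
    e \<in> lmod_hom R (Q 0) M \<and> (\<forall>i. d i \<in> lmod_hom R (Q (Suc i)) (Q i)) \<and>
    e ` carrier (Q 0) = carrier M \<and>
    d 0 ` carrier (Q 1) = {x \<in> carrier (Q 0). e x = \<zero>\<^bsub>M\<^esub>} \<and>
    (\<forall>i. d (Suc i) ` carrier (Q (Suc (Suc i))) = {x \<in> carrier (Q (Suc i)). d i x = \<zero>\<^bsub>Q i\<^esub>})"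

text \<open>
  The modules of a resolution live in the carrier type of \<open>M\<close>, and the global dimension ranges
  over the modules carried by sets of sets of ring elements.  For an infinite ring type
  this loses nothing: every module of cardinality at most that of
  \<^typ>\<open>'a set\<close> (in particular every cyclic module, and by a theorem of Auslander these
  determine the global dimension) has an isomorphic copy there, and so have the terms of some
  projective resolution of it.
\<close>

definition proj_dim :: "'a ring \<Rightarrow> ('a, 'm) module \<Rightarrow> enat"
  where "proj_dim R M = Inf {enat n |n. \<exists>(Q :: nat \<Rightarrow> ('a, 'm) module) d e.
     resolution R M Q d e \<and> (\<forall>i. projective_lmod R (Q i)) \<and>
     (\<forall>i>n. carrier (Q i) = {\<zero>\<^bsub>Q i\<^esub>})}"

definition gl_dim :: "'a ring \<Rightarrow> enat"
  where "gl_dim R = Sup (proj_dim R ` {M :: ('a, 'a set) module. left_module R M})"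

section \<open>Bigraded Ext\<close>

text \<open>Below, \<open>G\<close> is the grading of the ring \<open>R\<close>, and a graded module is a module together with the
  family of its homogeneous components in degrees \<open>0, 1, 2, \<dots>\<close>.\<close>

text \<open>The grading of the free module on \<open>S\<close> whose basis element \<open>s\<close> has degree \<open>\<delta> s\<close>.\<close>

definition free_comp ::
    "'a ring \<Rightarrow> (nat \<Rightarrow> 'a set) \<Rightarrow> 's set \<Rightarrow> ('s \<Rightarrow> nat) \<Rightarrow> nat \<Rightarrow> ('s \<Rightarrow> 'a) set"
  where "free_comp R G S \<delta> n = {f \<in> carrier (free_lmod R S).
     \<forall>s\<in>S. if \<delta> s \<le> n then f s \<in> G (n - \<delta> s) else f s = \<zero>\<^bsub>R\<^esub>}"

text \<open>Homomorphisms that lower the degree by \<open>n\<close>.\<close>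

definition graded_hom ::
    "'a ring \<Rightarrow> nat \<Rightarrow> ('a, 'm) module \<Rightarrow> (nat \<Rightarrow> 'm set) \<Rightarrow> ('a, 'n) module \<Rightarrow> (nat \<Rightarrow> 'n set)
      \<Rightarrow> ('m \<Rightarrow> 'n) set"
  where "graded_hom R n M MG N NG = {f \<in> lmod_hom R M N.
     \<forall>j. \<forall>x\<in>MG j. if n \<le> j then f x \<in> NG (j - n) else f x = \<zero>\<^bsub>N\<^esub>}"

definition graded_free_resolution ::
    "'a ring \<Rightarrow> (nat \<Rightarrow> 'a set) \<Rightarrow> ('a, 'm) module \<Rightarrow> (nat \<Rightarrow> 'm set) \<Rightarrow> (nat \<Rightarrow> nat set)
      \<Rightarrow> (nat \<Rightarrow> nat \<Rightarrow> nat) \<Rightarrow> (nat \<Rightarrow> (nat \<Rightarrow> 'a) \<Rightarrow> (nat \<Rightarrow> 'a)) \<Rightarrow> ((nat \<Rightarrow> 'a) \<Rightarrow> 'm) \<Rightarrow> bool"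
  where "graded_free_resolution R G M MG S \<delta> d e \<longleftrightarrow>
    resolution R M (\<lambda>i. free_lmod R (S i)) d e \<and>
    e \<in> graded_hom R 0 (free_lmod R (S 0)) (free_comp R G (S 0) (\<delta> 0)) M MG \<and>
    (\<forall>i. d i \<in> graded_hom R 0
        (free_lmod R (S (Suc i))) (free_comp R G (S (Suc i)) (\<delta> (Suc i)))
        (free_lmod R (S i)) (free_comp R G (S i) (\<delta> i)))"

text \<open>The complex \<open>Hom\<^sub>R(Q\<^sub>\<bullet>, N)\<close> in internal degree \<open>n\<close>, where \<open>Q\<^sub>i\<close> is the free module on \<open>S i\<close>.\<close>

definition ext_cochains ::
    "'a ring \<Rightarrow> (nat \<Rightarrow> 'a set) \<Rightarrow> (nat \<Rightarrow> nat set) \<Rightarrow> (nat \<Rightarrow> nat \<Rightarrow> nat)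
      \<Rightarrow> ('a, 'n) module \<Rightarrow> (nat \<Rightarrow> 'n set) \<Rightarrow> nat \<Rightarrow> nat \<Rightarrow> ((nat \<Rightarrow> 'a) \<Rightarrow> 'n) set"
  where "ext_cochains R G S \<delta> N NG i n =
    graded_hom R n (free_lmod R (S i)) (free_comp R G (S i) (\<delta> i)) N NG"

definition ext_cocycles ::
    "'a ring \<Rightarrow> (nat \<Rightarrow> 'a set) \<Rightarrow> (nat \<Rightarrow> nat set) \<Rightarrow> (nat \<Rightarrow> nat \<Rightarrow> nat)
      \<Rightarrow> (nat \<Rightarrow> (nat \<Rightarrow> 'a) \<Rightarrow> (nat \<Rightarrow> 'a))
      \<Rightarrow> ('a, 'n) module \<Rightarrow> (nat \<Rightarrow> 'n set) \<Rightarrow> nat \<Rightarrow> nat \<Rightarrow> ((nat \<Rightarrow> 'a) \<Rightarrow> 'n) set"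
  where "ext_cocycles R G S \<delta> d N NG i n = {f \<in> ext_cochains R G S \<delta> N NG i n.
     \<forall>x\<in>carrier (free_lmod R (S (Suc i))). f (d i x) = \<zero>\<^bsub>N\<^esub>}"

definition ext_coboundaries ::
    "'a ring \<Rightarrow> (nat \<Rightarrow> 'a set) \<Rightarrow> (nat \<Rightarrow> nat set) \<Rightarrow> (nat \<Rightarrow> nat \<Rightarrow> nat)
      \<Rightarrow> (nat \<Rightarrow> (nat \<Rightarrow> 'a) \<Rightarrow> (nat \<Rightarrow> 'a))
      \<Rightarrow> ('a, 'n) module \<Rightarrow> (nat \<Rightarrow> 'n set) \<Rightarrow> nat \<Rightarrow> nat \<Rightarrow> ((nat \<Rightarrow> 'a) \<Rightarrow> 'n) set"
  where "ext_coboundaries R G S \<delta> d N NG i n =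
    (case i of
       0 \<Rightarrow> {\<lambda>x\<in>carrier (free_lmod R (S 0)). \<zero>\<^bsub>N\<^esub>}
     | Suc j \<Rightarrow> (\<lambda>g. compose (carrier (free_lmod R (S i))) g (d j)) `
                  ext_cochains R G S \<delta> N NG j n)"

text \<open>
  \<open>Ext\<^sub>R\<^sup>i\<^sup>,\<^sup>n(M, N) \<noteq> 0\<close>, computed from a graded free resolution of \<open>M\<close>; up to
  isomorphism Ext does not depend on the resolution.  Countable bases in nonnegative degrees
  suffice for graded modules of countable dimension over an algebra of countable dimension,
  in particular for the trivial module.
\<close>

definition ext_nonzero ::
    "'a ring \<Rightarrow> (nat \<Rightarrow> 'a set) \<Rightarrow> ('a, 'm) module \<Rightarrow> (nat \<Rightarrow> 'm set) \<Rightarrow> ('a, 'n) module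
      \<Rightarrow> (nat \<Rightarrow> 'n set) \<Rightarrow> nat \<Rightarrow> nat \<Rightarrow> bool"
  where "ext_nonzero R G M MG N NG i n \<longleftrightarrow>
    (\<exists>S \<delta> d e. graded_free_resolution R G M MG S \<delta> d e \<and>
       ext_cocycles R G S \<delta> d N NG i n \<noteq> ext_coboundaries R G S \<delta> d N NG i n)"

section \<open>Complexity\<close>

text \<open>The left module \<open>R/J\<close> for a two-sided ideal \<open>J\<close>.\<close>

definition quot_lmod :: "'a ring \<Rightarrow> 'a set \<Rightarrow> ('a, 'a set) module"
  where "quot_lmod R J =
    \<lparr>carrier = carrier (R Quot J), mult = mult (R Quot J), one = one (R Quot J),
     zero = zero (R Quot J), add = add (R Quot J),
     smult = (\<lambda>a X. (J +>\<^bsub>R\<^esub> a) \<otimes>\<^bsub>R Quot J\<^esub> X)\<rparr>"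

text \<open>\<open>A\<^sub>+\<close> and \<open>K = A/A\<^sub>+\<close> for \<open>A = T/\<langle>R\<rangle>\<close>, the latter concentrated in degree \<open>0\<close>.\<close>

definition aug_ideal :: "('x, 'k::field) free_alg set \<Rightarrow> ('x, 'k) free_alg set set"
  where "aug_ideal R = fa_proj R ` {f. \<forall>w\<in>Poly_Mapping.keys f. 1 \<le> length w}"

definition triv_mod ::
    "('x, 'k::field) free_alg set \<Rightarrow> (('x, 'k) free_alg set, ('x, 'k) free_alg set set) module"
  where "triv_mod R = quot_lmod (fa_quot R) (aug_ideal R)"

definition triv_comp :: "('x, 'k::field) free_alg set \<Rightarrow> nat \<Rightarrow> ('x, 'k) free_alg set set set"
  where "triv_comp R n = (if n = 0 then carrier (triv_mod R) else {\<zero>\<^bsub>triv_mod R\<^esub>})"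

definition complexity :: "('x, 'k::field) free_alg set \<Rightarrow> enat"
  where "complexity R =
    (if 3 \<le> gl_dim (fa_quot R)
     then Sup {enat n |n. ext_nonzero (fa_quot R) (quot_comp R)
                 (triv_mod R) (triv_comp R) (triv_mod R) (triv_comp R) 3 n} - 1
     else 0)"

end

theory Submission
  imports Defs "HOL-Library.Function_Algebras"
begin

text \<open>
  Write \<open>p\<^sub>i = r\<^sub>i + l\<^sub>i\<close>, and \<open>I\<close> for the ideal of relations of \<open>A\<close>.  The subspace \<open>P\<^sub>k\<close> is the span of
  the products \<open>u p\<^sub>i v\<close> with words \<open>u, v\<close> whose formal degree \<open>|u| + deg r\<^sub>i + |v|\<close> is at most \<open>k\<close>
  (\<open>P_space_eq\<close>).  The algebra \<open>gr(U)\<close> is the quotient of \<open>T\<close> by the leading forms of the elements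
  of \<open>\<langle>P\<rangle>\<close>, and these include \<open>I\<close>; as the components of \<open>T\<close> are finite-dimensional, \<open>gr(U)\<close> and \<open>A\<close>
  are isomorphic only if there are no further leading forms (\<open>PBW_imp_leading\<close>,
  \<open>leading_imp_PBW\<close>).  Descending degree by degree one finds that this means
  \<open>P\<^sub>k\<^sub>+\<^sub>1 \<inter> F\<^sup>kT \<subseteq> P\<^sub>k\<close> for all \<open>k\<close> (\<open>leading_iff_jacobi\<close>).  It remains to see why the values of \<open>k\<close>
  above the complexity impose no condition of their own.

  An element of \<open>P\<^sub>k\<^sub>+\<^sub>1 \<inter> F\<^sup>kT\<close> is, modulo \<open>P\<^sub>k\<close>, a sum \<open>\<Sum> u p\<^sub>i v\<close> with all terms of degree \<open>k + 1\<close> and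
  \<open>\<Sum> u r\<^sub>i v = 0\<close>, that is, the value on a syzygy of degree \<open>k + 1\<close> among the generators of the
  two-sided ideal \<open>I\<close>.  Syzygies that are multiples of syzygies of lower degree are taken care of
  by the conditions for smaller \<open>k\<close>, and the trivial syzygies between \<open>a r\<^sub>i\<close> with \<open>a \<in> I\<close> and the
  expansion of \<open>a\<close> times \<open>r\<^sub>i\<close> give elements of \<open>P\<^sub>k\<close> outright (\<open>rel_mult_commute\<close>).  Reading a
  syzygy modulo terms that end in a letter gives an element of the kernel \<open>Z\<close> of
  \<open>A\<^sup>m \<rightarrow> A \<otimes> V\<close>, the start of the minimal resolution \<open>A\<^sup>m \<rightarrow> A \<otimes> V \<rightarrow> A \<rightarrow> K\<close>.  If \<open>Z\<close> has no new
  generators in degree \<open>k + 1\<close>, i.e. \<open>Z\<^sub>k\<^sub>+\<^sub>1 \<subseteq> A\<^sub>+ Z\<close>, the syzygy is therefore a combination of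
  those two kinds and of one in which every term ends in a letter; cancelling the last letter
  reduces the latter to degree \<open>k\<close> as well (\<open>jacobi_step\<close>).

  The generators of \<open>Z\<close> in degree \<open>n\<close> are dual to \<open>Ext\<^sup>3\<^sup>,\<^sup>n(K, K)\<close>.  If the global dimension is at
  least three, the start of the resolution is extended to a graded free resolution
  (\<open>graded_cover\<close>), and an element of \<open>Z\<^sub>n\<close> outside \<open>A\<^sub>+ Z\<close> would produce a cocycle that is not a
  coboundary (\<open>ext_no_new_syz\<close>).  If the global dimension is at most two, comparison with a
  projective resolution of length two shows that \<open>Z\<close> is a direct summand of \<open>A\<^sup>m\<close>; minimality
  gives \<open>Z \<subseteq> A\<^sub>+ A\<^sup>m\<close>, and projecting to \<open>Z\<close> yields \<open>Z = A\<^sub>+ Z\<close> (\<open>gl_dim_no_new_syz\<close>).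
\<close>

section \<open>Words, degrees and division by a letter\<close>

abbreviation fa_word :: "'x list \<Rightarrow> ('x, 'k::field) free_alg"
  where "fa_word w \<equiv> Poly_Mapping.single w 1"

lemma single_mult_single:
  "Poly_Mapping.single u a * Poly_Mapping.single v b = Poly_Mapping.single (u @ v) (a * b)"
  for a b :: "'k::field"
  by (simp add: mult_single plus_list_def)

lemma fa_scale_single: "fa_scale a (Poly_Mapping.single v b) = Poly_Mapping.single v (a * b)"
  by (simp add: fa_scale_def fa_const_def single_mult_single)

lemma single_eq_scale_word: "Poly_Mapping.single v b = fa_scale b (fa_word v)"
  by (simp add: fa_scale_single)

lemma one_eq_word: "(1 :: ('x, 'k::field) free_alg) = fa_word []"
  by (simp add: flip: zero_list_def)

lemma fa_const_one: "fa_const 1 = (1 :: ('x, 'k::field) free_alg)"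
  by (simp add: fa_const_def one_eq_word)

lemma fa_const_zero: "fa_const 0 = (0 :: ('x, 'k::field) free_alg)"
  by (simp add: fa_const_def)

lemma fa_const_add: "fa_const (a + b) = fa_const a + fa_const b"
  by (simp add: fa_const_def single_add)

lemma fa_const_mult: "fa_const (a * b) = fa_const a * fa_const b"
  by (simp add: fa_const_def single_mult_single)

lemma sum_monomials: "f = (\<Sum>w\<in>Poly_Mapping.keys f. Poly_Mapping.single w (Poly_Mapping.lookup f w))"
  for f :: "('x, 'k::field) free_alg"
  by (rule poly_mapping_eqI)
    (auto simp: lookup_sum lookup_single when_def in_keys_iff)

lemma lookup_scale: "Poly_Mapping.lookup (fa_scale c f) w = c * Poly_Mapping.lookup f w"
  by (simp add: fa_scale_def fa_const_def flip: zero_list_def mult_map_scale_conv_mult)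
     (simp add: Poly_Mapping.map.rep_eq when_def)

lemma fa_scale_mult_left: "fa_scale c f * g = fa_scale c (f * g)"
  by (simp add: fa_scale_def mult.assoc)

lemma monomials_induct [consumes 1, case_names zero add monomial]:
  fixes f :: "('x, 'k::field) free_alg"
  assumes "\<forall>w\<in>Poly_Mapping.keys f. D w"
    and "Q 0" and "\<And>g h. Q g \<Longrightarrow> Q h \<Longrightarrow> Q (g + h)"
    and "\<And>w c. D w \<Longrightarrow> Q (Poly_Mapping.single w c)"
  shows "Q f"
proof -
  have "finite A \<Longrightarrow> A \<subseteq> Poly_Mapping.keys f \<Longrightarrow>
      Q (\<Sum>w\<in>A. Poly_Mapping.single w (Poly_Mapping.lookup f w))" for A
    by (induction A rule: finite_induct) (use assms in auto)
  from this[OF finite_keys order.refl] show ?thesis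
    by (simp flip: sum_monomials)
qed

lemma fa_induct [case_names zero add monomial]:
  assumes "Q 0" and "\<And>g h. Q g \<Longrightarrow> Q h \<Longrightarrow> Q (g + h)"
    and "\<And>w c. Q (Poly_Mapping.single w c)"
  shows "Q (f :: ('x, 'k::field) free_alg)"
  by (rule monomials_induct[where D = "\<lambda>_. True"]) (use assms in auto)

lemma const_commute: "fa_const c * f = f * fa_const c"
  by (induction f rule: fa_induct)
    (simp_all add: algebra_simps fa_const_def single_mult_single)

lemma mult_scale_right: "f * fa_scale c g = fa_scale c (f * g)"
proof -
  have "f * fa_scale c g = (f * fa_const c) * g"
    by (simp add: fa_scale_def mult.assoc)
  also have "\<dots> = fa_const c * (f * g)"
    by (simp add: const_commute[symmetric] mult.assoc)
  finally show ?thesis by (simp add: fa_scale_def)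
qed

text \<open>Components and filtration pieces are all spans of words.\<close>

lemma subspace_keys:
  "fa.subspace {f :: ('x, 'k::field) free_alg. \<forall>w\<in>Poly_Mapping.keys f. D w}"
proof (rule fa.subspaceI)
  fix f g :: "('x, 'k) free_alg" and c
  assume f: "f \<in> {f. \<forall>w\<in>Poly_Mapping.keys f. D w}"
  show "fa_scale c f \<in> {f. \<forall>w\<in>Poly_Mapping.keys f. D w}"
    using f by (auto simp: in_keys_iff lookup_scale)
  assume "g \<in> {f. \<forall>w\<in>Poly_Mapping.keys f. D w}"
  then show "f + g \<in> {f. \<forall>w\<in>Poly_Mapping.keys f. D w}"
    using f by (auto dest!: set_mp[OF Poly_Mapping.keys_add])
qed auto

lemma subspace_comp: "fa.subspace (fa_comp k)"
  unfolding fa_comp_def by (rule subspace_keys)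

lemma subspace_filt: "fa.subspace (fa_filt k)"
  unfolding fa_filt_def by (rule subspace_keys)

lemma subspace_below: "fa.subspace (fa_filt_below k)"
  unfolding fa_filt_below_def by (rule subspace_keys)

lemma keys_product: 
  assumes "w \<in> Poly_Mapping.keys (f * g)"
  obtains u v where "u \<in> Poly_Mapping.keys f" "v \<in> Poly_Mapping.keys g" "w = u @ v"
  using assms set_mp[OF Poly_Mapping.keys_mult] by (force simp: plus_list_def)

lemma comp_mult: "f \<in> fa_comp i \<Longrightarrow> g \<in> fa_comp j \<Longrightarrow> f * g \<in> fa_comp (i + j)"
  by (auto simp: fa_comp_def elim!: keys_product)

lemma filt_mult: "f \<in> fa_filt i \<Longrightarrow> g \<in> fa_filt j \<Longrightarrow> f * g \<in> fa_filt (i + j)"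
  by (fastforce simp: fa_filt_def elim!: keys_product)

lemma below_mult_filt: "f \<in> fa_filt_below i \<Longrightarrow> g \<in> fa_filt j \<Longrightarrow> f * g \<in> fa_filt_below (i + j)"
  by (fastforce simp: fa_filt_def fa_filt_below_def elim!: keys_product)

lemma filt_mult_below: "f \<in> fa_filt i \<Longrightarrow> g \<in> fa_filt_below j \<Longrightarrow> f * g \<in> fa_filt_below (i + j)"
  by (fastforce simp: fa_filt_def fa_filt_below_def elim!: keys_product)

lemma comp_subset_filt: "fa_comp k \<subseteq> fa_filt k"
  by (auto simp: fa_comp_def fa_filt_def)

lemma below_subset_filt: "fa_filt_below k \<subseteq> fa_filt k"
  by (auto simp: fa_filt_below_def fa_filt_def order.strict_implies_order)

lemma below_Suc: "fa_filt_below (Suc k) = fa_filt k"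
  by (auto simp: fa_filt_below_def fa_filt_def less_Suc_eq_le)

lemma below_zero: "fa_filt_below 0 = {0}"
  by (auto simp: fa_filt_below_def in_keys_iff intro!: poly_mapping_eqI)

lemma filt_mono: "i \<le> j \<Longrightarrow> fa_filt i \<subseteq> fa_filt j"
  by (auto simp: fa_filt_def)

lemma single_in_comp: "length w = n \<Longrightarrow> Poly_Mapping.single w c \<in> fa_comp n"
  by (simp add: fa_comp_def)

lemma fa_const_comp: "fa_const c \<in> fa_comp 0"
  by (simp add: fa_const_def single_in_comp)

lemma fa_var_comp: "fa_var x \<in> fa_comp 1"
  by (simp add: fa_var_def single_in_comp)

lemma exists_filt: "\<exists>k. f \<in> fa_filt k"
proof -
  have "f \<in> fa_filt (Max (insert 0 (length ` Poly_Mapping.keys f)))"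
    by (auto simp: fa_filt_def)
  then show ?thesis ..
qed

lift_definition fa_part :: "nat \<Rightarrow> ('x, 'k::field) free_alg \<Rightarrow> ('x, 'k) free_alg"
  is "\<lambda>n f w. if length w = n then f w else 0"
  by (rule finite_subset) auto

lemma part_add: "fa_part n (f + g) = fa_part n f + fa_part n g"
  by (rule poly_mapping_eqI) (simp add: fa_part.rep_eq lookup_add)

lemma part_zero [simp]: "fa_part n 0 = 0"
  by (rule poly_mapping_eqI) (simp add: fa_part.rep_eq)

lemma part_diff: "fa_part n (f - g) = fa_part n f - fa_part n g"
  by (rule poly_mapping_eqI) (simp add: fa_part.rep_eq lookup_minus)

lemma part_scale: "fa_part n (fa_scale c f) = fa_scale c (fa_part n f)"
  by (rule poly_mapping_eqI) (simp add: fa_part.rep_eq lookup_scale)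

lemma part_sum: "fa_part n (sum f A) = (\<Sum>a\<in>A. fa_part n (f a))"
  by (induction A rule: infinite_finite_induct) (simp_all add: part_add)

lemma part_single:
  "fa_part n (Poly_Mapping.single w c) = (if length w = n then Poly_Mapping.single w c else 0)"
  by (rule poly_mapping_eqI) (simp add: fa_part.rep_eq lookup_single when_def)

lemma part_in_comp [simp]: "fa_part n f \<in> fa_comp n"
  by (auto simp: fa_comp_def in_keys_iff fa_part.rep_eq split: if_splits)

lemma part_comp: "f \<in> fa_comp k \<Longrightarrow> fa_part n f = (if k = n then f else 0)"
  by (rule poly_mapping_eqI) (auto simp: fa_comp_def in_keys_iff fa_part.rep_eq)

lemma part_below: "f \<in> fa_filt_below n \<Longrightarrow> fa_part n f = 0"
  by (rule poly_mapping_eqI) (auto simp: fa_filt_below_def in_keys_iff fa_part.rep_eq)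

lemma part_filt_above: "f \<in> fa_filt k \<Longrightarrow> k < n \<Longrightarrow> fa_part n f = 0"
  by (rule poly_mapping_eqI) (force simp: fa_filt_def in_keys_iff fa_part.rep_eq)

lemma minus_part_below: "f \<in> fa_filt n \<Longrightarrow> f - fa_part n f \<in> fa_filt_below n"
  by (auto simp: fa_filt_def fa_filt_below_def in_keys_iff fa_part.rep_eq lookup_minus
      order_le_less split: if_splits)

lemma sum_parts: "f \<in> fa_filt k \<Longrightarrow> f = (\<Sum>n\<le>k. fa_part n f)"
  by (rule poly_mapping_eqI)
    (auto simp: fa_filt_def in_keys_iff lookup_sum fa_part.rep_eq sum.delta)

lemma part_mult_comp_left: 
  assumes "a \<in> fa_comp j"
  shows "fa_part n (a * f) = (if j \<le> n then a * fa_part (n - j) f else 0)"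
  using assms[unfolded fa_comp_def mem_Collect_eq]
proof (induction a rule: monomials_induct)
  case (add g h)
  then show ?case by (simp add: distrib_right part_add)
next
  case (monomial w c)
  show ?case
    by (induction f rule: fa_induct)
      (use monomial in \<open>auto simp: distrib_left part_add single_mult_single part_single\<close>)
qed simp

lemma part_mult_comp_right: 
  assumes "a \<in> fa_comp j"
  shows "fa_part n (f * a) = (if j \<le> n then fa_part (n - j) f * a else 0)"
  using assms[unfolded fa_comp_def mem_Collect_eq]
proof (induction a rule: monomials_induct)
  case (add g h)
  then show ?case by (simp add: distrib_left part_add)
next
  case (monomial w c)
  show ?case
    by (induction f rule: fa_induct)
      (use monomial in \<open>auto simp: distrib_right part_add single_mult_single part_single\<close>)
qed simp

lemma part_mult_top:
  assumes "f \<in> fa_filt i" "g \<in> fa_filt j"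
  shows "fa_part (i + j) (f * g) = fa_part i f * fa_part j g"
proof -
  have "f * g = fa_part i f * fa_part j g + fa_part i f * (g - fa_part j g)
      + (f - fa_part i f) * g"
    by (simp add: algebra_simps)
  moreover have "fa_part i f * (g - fa_part j g) \<in> fa_filt_below (i + j)"
    using assms by (auto intro!: filt_mult_below minus_part_below set_mp[OF comp_subset_filt])
  moreover have "(f - fa_part i f) * g \<in> fa_filt_below (i + j)"
    using assms by (auto intro!: below_mult_filt minus_part_below)
  moreover have "fa_part i f * fa_part j g \<in> fa_comp (i + j)"
    by (auto intro!: comp_mult)
  ultimately show ?thesis
    by (simp add: part_add part_below part_comp)
qed

text \<open>The free algebra is \<open>K \<oplus> \<Oplus>\<^sub>x T x\<close>; \<open>fa_rdiv x f\<close> is the coefficient of \<open>x\<close>.\<close>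

definition fa_rdiv :: "'x \<Rightarrow> ('x, 'k::field) free_alg \<Rightarrow> ('x, 'k) free_alg"
  where "fa_rdiv x f = Poly_Mapping.map_key (\<lambda>w. w @ [x]) f"

lemma lookup_rdiv: "Poly_Mapping.lookup (fa_rdiv x f) w = Poly_Mapping.lookup f (w @ [x])"
  by (simp add: fa_rdiv_def Poly_Mapping.map_key.rep_eq inj_on_def)

lemma rdiv_add: "fa_rdiv x (f + g) = fa_rdiv x f + fa_rdiv x g"
  by (rule poly_mapping_eqI) (simp add: lookup_rdiv lookup_add)

lemma rdiv_zero [simp]: "fa_rdiv x 0 = 0"
  by (rule poly_mapping_eqI) (simp add: lookup_rdiv)

lemma rdiv_sum: "fa_rdiv x (sum f A) = (\<Sum>a\<in>A. fa_rdiv x (f a))"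
  by (induction A rule: infinite_finite_induct) (simp_all add: rdiv_add)

lemma rdiv_single: "fa_rdiv x (Poly_Mapping.single w c) =
    (if w \<noteq> [] \<and> last w = x then Poly_Mapping.single (butlast w) c else 0)"
  by (rule poly_mapping_eqI)
    (cases w rule: rev_cases; auto simp: lookup_rdiv lookup_single when_def)

lemma rdiv_mult_var: "fa_rdiv x (f * fa_var y) = (if x = y then f else 0)"
  by (induction f rule: fa_induct)
    (auto simp: distrib_right rdiv_add fa_var_def single_mult_single rdiv_single)

lemma rdiv_expansion:
  "f = fa_const (Poly_Mapping.lookup f []) + (\<Sum>x\<in>UNIV. fa_rdiv x f * fa_var x)"
  for f :: "('x::finite, 'k::field) free_alg"
proof (induction f rule: fa_induct)
  case zero
  show ?case by (simp add: fa_const_zero)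
next
  case (add g h)
  have "g + h = (fa_const (Poly_Mapping.lookup g []) + (\<Sum>x\<in>UNIV. fa_rdiv x g * fa_var x))
    + (fa_const (Poly_Mapping.lookup h []) + (\<Sum>x\<in>UNIV. fa_rdiv x h * fa_var x))"
    by (simp flip: add)
  also have "\<dots> = fa_const (Poly_Mapping.lookup (g + h) [])
      + (\<Sum>x\<in>UNIV. fa_rdiv x (g + h) * fa_var x)"
    by (simp only: lookup_add rdiv_add distrib_right sum.distrib fa_const_add add_ac)
  finally show ?case .
next
  case (monomial w c)
  show ?case
  proof (cases w rule: rev_cases)
    case Nil
    then show ?thesis by (simp add: rdiv_single fa_const_def)
  next
    case (snoc u y)
    have "(\<Sum>x\<in>UNIV. fa_rdiv x (Poly_Mapping.single w c) * fa_var x)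
        = (\<Sum>x\<in>UNIV. if x = y then Poly_Mapping.single w c else 0)"
      by (rule sum.cong) (auto simp: snoc rdiv_single fa_var_def single_mult_single)
    then show ?thesis
      by (simp add: snoc lookup_single when_def fa_const_zero)
  qed
qed

lemma rdiv_comp: "f \<in> fa_comp (Suc n) \<Longrightarrow> fa_rdiv x f \<in> fa_comp n"
  unfolding fa_comp_def mem_Collect_eq in_keys_iff lookup_rdiv Ball_def
  by (metis length_append_singleton nat.inject)

lemma lookup_Nil_comp: "f \<in> fa_comp k \<Longrightarrow> 0 < k \<Longrightarrow> Poly_Mapping.lookup f [] = 0"
  by (auto simp: fa_comp_def in_keys_iff)

lemma rdiv_expansion_comp:
  "f \<in> fa_comp k \<Longrightarrow> 0 < k \<Longrightarrow> f = (\<Sum>x\<in>UNIV. fa_rdiv x f * fa_var x)"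
  for f :: "('x::finite, 'k::field) free_alg"
  using rdiv_expansion[of f] by (simp add: lookup_Nil_comp fa_const_zero)

lemma rdiv_mult:
  fixes f :: "('x::finite, 'k::field) free_alg"
  assumes "f \<in> fa_comp k" "0 < k"
  shows "fa_rdiv x (a * f) = a * fa_rdiv x f"
proof -
  have "a * f = (\<Sum>y\<in>UNIV. (a * fa_rdiv y f) * fa_var y)"
    by (subst rdiv_expansion_comp[OF assms]) (simp add: sum_distrib_left mult.assoc)
  then show ?thesis
    by (simp add: rdiv_sum rdiv_mult_var)
qed

lemma ldiv_exists:
  fixes f :: "('x::finite, 'k::field) free_alg"
  assumes "\<forall>w\<in>Poly_Mapping.keys f. w \<noteq> []"
  shows "\<exists>t. f = (\<Sum>x\<in>UNIV. fa_var x * t x)"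
  using assms
proof (induction f rule: monomials_induct)
  case zero
  show ?case by (rule exI[of _ "\<lambda>_. 0"]) simp
next
  case (add g h)
  then obtain s t where "g = (\<Sum>x\<in>UNIV. fa_var x * s x)" "h = (\<Sum>x\<in>UNIV. fa_var x * t x)"
    by blast
  then show ?case
    by (intro exI[of _ "\<lambda>x. s x + t x"]) (simp add: distrib_left sum.distrib)
next
  case (monomial w c)
  then obtain y v where w: "w = y # v" by (cases w) auto
  have "(\<Sum>x\<in>UNIV. fa_var x * (if x = y then Poly_Mapping.single v c else 0))
      = (\<Sum>x\<in>UNIV. if x = y then Poly_Mapping.single w c else 0)"
    by (rule sum.cong) (auto simp: w fa_var_def single_mult_single)
  also have "\<dots> = Poly_Mapping.single w c" by simp
  finally show ?case
    by (intro exI[of _ "\<lambda>x. if x = y then Poly_Mapping.single v c else 0"]) simp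
qed

section \<open>Two-sided ideals of the free algebra\<close>

lemma fa_ring_simps [simp]:
  "carrier fa_ring = UNIV" "mult fa_ring = (*)" "one fa_ring = 1" "zero fa_ring = 0"
  "add fa_ring = (+)"
  by (simp_all add: fa_ring_def)

interpretation far: ring fa_ring
  by (rule fa_ring_ring)

lemma fa_ideal_ideal: "ideal (fa_ideal P) fa_ring"
  unfolding fa_ideal_def by (rule far.genideal_ideal) simp

lemma fa_ideal_gen: "f \<in> P \<Longrightarrow> f \<in> fa_ideal P"
  unfolding fa_ideal_def using far.genideal_self[of P] by auto

lemma fa_ideal_zero [simp]: "0 \<in> fa_ideal P"
  using additive_subgroup.zero_closed[OF ideal.axioms(1)[OF fa_ideal_ideal]] by simp

lemma fa_ideal_add: "f \<in> fa_ideal P \<Longrightarrow> g \<in> fa_ideal P \<Longrightarrow> f + g \<in> fa_ideal P"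
  using additive_subgroup.a_closed[OF ideal.axioms(1)[OF fa_ideal_ideal]] by simp

lemma fa_ideal_lmult: "f \<in> fa_ideal P \<Longrightarrow> a * f \<in> fa_ideal P"
  using ideal.I_l_closed[OF fa_ideal_ideal] by simp

lemma fa_ideal_rmult: "f \<in> fa_ideal P \<Longrightarrow> f * a \<in> fa_ideal P"
  using ideal.I_r_closed[OF fa_ideal_ideal] by simp

lemma fa_ideal_uminus: "f \<in> fa_ideal P \<Longrightarrow> - f \<in> fa_ideal P"
  using fa_ideal_lmult[of f P "- 1"] by simp

lemma fa_ideal_diff: "f \<in> fa_ideal P \<Longrightarrow> g \<in> fa_ideal P \<Longrightarrow> f - g \<in> fa_ideal P"
  using fa_ideal_add[OF _ fa_ideal_uminus, of f P g] by simp

lemma fa_ideal_scale: "f \<in> fa_ideal P \<Longrightarrow> fa_scale c f \<in> fa_ideal P"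
  by (simp add: fa_scale_def fa_ideal_lmult)

lemma fa_ideal_sum: "(\<And>i. i \<in> A \<Longrightarrow> f i \<in> fa_ideal P) \<Longrightarrow> sum f A \<in> fa_ideal P"
  by (induction A rule: infinite_finite_induct) (auto intro: fa_ideal_add)

lemma subspace_ideal: "fa.subspace (fa_ideal P)"
  by (rule fa.subspaceI) (auto intro: fa_ideal_add fa_ideal_scale)

text \<open>The products \<open>u p v\<close> with words \<open>u, v\<close> already span a two-sided ideal, so no sums of more
  general products need to be considered.\<close>

lemma fa_ideal_induct [consumes 1, case_names zero add gen]:
  assumes f: "f \<in> fa_ideal P"
    and zero: "Q 0" and add: "\<And>g h. Q g \<Longrightarrow> Q h \<Longrightarrow> Q (g + h)"
    and gen: "\<And>u p v c. p \<in> P \<Longrightarrow> Q (Poly_Mapping.single u c * p * fa_word v)"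
  shows "Q f"
proof -
  define J where "J = fa.span {fa_word u * p * fa_word v |u p v. p \<in> P}"
  have l: "a * g \<in> J" if "g \<in> J" for a g
    using that unfolding J_def
  proof (induction g rule: fa.span_induct_alt)
    case (step c x y)
    then obtain u p v where x: "x = fa_word u * p * fa_word v" "p \<in> P" by blast
    have "a * x \<in> fa.span {fa_word u * p * fa_word v |u p v. p \<in> P}"
    proof (induction a rule: fa_induct)
      case (monomial w b)
      have "Poly_Mapping.single w b * x = fa_scale b (fa_word (w @ u) * p * fa_word v)"
        by (simp add: x(1) single_eq_scale_word[of _ b] fa_scale_mult_left single_mult_single
            flip: mult.assoc)
      moreover have "fa_word (w @ u) * p * fa_word v \<in> {fa_word u * p * fa_word v |u p v. p \<in> P}"
        using x(2) by blast
      ultimately show ?case by (simp only: fa.span_scale fa.span_base)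
    qed (auto simp: distrib_right intro: fa.span_add fa.span_zero)
    then show ?case
      using step by (simp add: distrib_left mult_scale_right fa.span_add fa.span_scale)
  qed (simp add: fa.span_zero)
  have r: "g * a \<in> J" if "g \<in> J" for a g
    using that unfolding J_def
  proof (induction g rule: fa.span_induct_alt)
    case (step c x y)
    then obtain u p v where x: "x = fa_word u * p * fa_word v" "p \<in> P" by blast
    have "x * a \<in> fa.span {fa_word u * p * fa_word v |u p v. p \<in> P}"
    proof (induction a rule: fa_induct)
      case (monomial w b)
      have "x * Poly_Mapping.single w b = fa_scale b (fa_word u * p * fa_word (v @ w))"
        by (simp add: x(1) single_eq_scale_word[of _ b] mult_scale_right single_mult_single
            mult.assoc)
      moreover have "fa_word u * p * fa_word (v @ w) \<in> {fa_word u * p * fa_word v |u p v. p \<in> P}"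
        using x(2) by blast
      ultimately show ?case by (simp only: fa.span_scale fa.span_base)
    qed (auto simp: distrib_left intro: fa.span_add fa.span_zero)
    then show ?case
      using step by (simp add: distrib_right fa_scale_mult_left fa.span_add fa.span_scale)
  qed (simp add: fa.span_zero)
  have "ideal J fa_ring"
  proof (rule idealI)
    show "ring (fa_ring :: ('a, 'b) free_alg ring)" by (rule fa_ring_ring)
    have "inv\<^bsub>add_monoid fa_ring\<^esub> x = - x" for x :: "('a, 'b) free_alg"
      unfolding a_inv_def[symmetric] by (rule far.add.inv_equality) simp_all
    then show "subgroup J (add_monoid fa_ring)"
      by (intro subgroup.intro)
        (auto simp: J_def fa.span_add fa.span_zero fa.span_neg simp del: fa_ring_simps,
          auto simp: fa.span_add fa.span_zero)
  qed (use l r in auto)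
  moreover have "P \<subseteq> J"
  proof
    fix p assume "p \<in> P"
    then have "fa_word [] * p * fa_word [] \<in> J"
      unfolding J_def by (intro fa.span_base) blast
    then show "p \<in> J" by (simp flip: one_eq_word)
  qed
  ultimately have "fa_ideal P \<subseteq> J"
    unfolding fa_ideal_def by (rule far.genideal_minimal)
  with f have "f \<in> J" by blast
  then show ?thesis
    unfolding J_def
  proof (induction f rule: fa.span_induct_alt)
    case (step c x y)
    then obtain u p v where "x = fa_word u * p * fa_word v" "p \<in> P" by blast
    then have "fa_scale c x = Poly_Mapping.single u c * p * fa_word v"
      by (simp add: single_eq_scale_word[of _ c] fa_scale_mult_left)
    then show ?case using step gen \<open>p \<in> P\<close> add by simp
  qed (rule zero)
qed

section \<open>Relations and their deformations\<close>

text \<open>Otherwise simplification would turn the index sets \<open>{1..m}\<close> into \<open>{Suc 0..m}\<close>.\<close>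

declare One_nat_def [simp del]

lemma comp_zero_const:
  assumes "v \<in> fa_comp 0"
  shows "v = fa_const (Poly_Mapping.lookup v [])"
proof (rule poly_mapping_eqI)
  fix w
  show "Poly_Mapping.lookup v w = Poly_Mapping.lookup (fa_const (Poly_Mapping.lookup v [])) w"
    using assms by (cases "w = []")
      (auto simp: fa_comp_def fa_const_def lookup_single when_def simp flip: not_in_keys_iff_lookup_eq_zero)
qed

locale graded_relations =
  fixes m :: nat and r :: "nat \<Rightarrow> ('x::finite, 'k::field) free_alg" and d :: "nat \<Rightarrow> nat"
  assumes r_comp: "i \<in> {1..m} \<Longrightarrow> r i \<in> fa_comp (d i)"
    and d_ge: "i \<in> {1..m} \<Longrightarrow> 2 \<le> d i"
    and r_min: "i \<in> {1..m} \<Longrightarrow> r i \<notin> fa_ideal (r ` ({1..m} - {i}))"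
begin

abbreviation I :: "('x, 'k) free_alg set"
  where "I \<equiv> fa_ideal (r ` {1..m})"

lemma r_nonzero: "i \<in> {1..m} \<Longrightarrow> r i \<noteq> 0"
  using r_min by fastforce

lemma rdiv_r_comp: "i \<in> {1..m} \<Longrightarrow> fa_rdiv x (r i) \<in> fa_comp (d i - 1)"
  using rdiv_comp[of "r i" "d i - 1" x] r_comp[of i] d_ge[of i] by (simp add: Suc_diff_le)

lemma r_expansion: "i \<in> {1..m} \<Longrightarrow> r i = (\<Sum>x\<in>UNIV. fa_rdiv x (r i) * fa_var x)"
  using d_ge[of i] by (intro rdiv_expansion_comp[OF r_comp]) auto

lemma rdiv_mult_r: "i \<in> {1..m} \<Longrightarrow> fa_rdiv x (a * r i) = a * fa_rdiv x (r i)"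
  using d_ge[of i] by (intro rdiv_mult[OF r_comp]) auto

lemma I_part: "f \<in> I \<Longrightarrow> fa_part n f \<in> I"
proof (induction f rule: fa_ideal_induct)
  case (gen u p v c)
  then obtain i where i: "i \<in> {1..m}" "p = r i" by blast
  have "Poly_Mapping.single u c * p * fa_word v \<in> fa_comp (length u + d i + length v)"
    by (auto intro!: comp_mult r_comp i single_in_comp simp: i(2))
  moreover have "Poly_Mapping.single u c * p * fa_word v \<in> I"
    using gen by (intro fa_ideal_rmult fa_ideal_lmult fa_ideal_gen)
  ultimately show ?case
    by (simp add: part_comp)
qed (auto simp: part_add intro: fa_ideal_add)

lemma I_lookup_Nil: "f \<in> I \<Longrightarrow> Poly_Mapping.lookup f [] = 0"
proof (induction f rule: fa_ideal_induct)
  case (gen u p v c)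
  then obtain i where i: "i \<in> {1..m}" "p = r i" by blast
  have "Poly_Mapping.single u c * p * fa_word v \<in> fa_comp (length u + d i + length v)"
    by (auto intro!: comp_mult r_comp i single_in_comp simp: i(2))
  then show ?case
    using d_ge[OF i(1)] by (intro lookup_Nil_comp) auto
qed (auto simp: lookup_add)

text \<open>The left module \<open>T\<^sup>m\<close>, graded so that the \<open>i\<close>-th basis vector has degree \<open>d i\<close>, covers the
  second term of the minimal resolution of \<open>K\<close>.  The tuples in \<open>syz\<close> are the preimages of the
  kernel of the next map of the resolution, and those in \<open>dec\<close> the preimages of its submodule
  generated by \<open>A\<^sub>+\<close> times that kernel.  So \<open>Ext\<^sup>3\<^sup>,\<^sup>n(K, K) = 0\<close> means that the homogeneous
  tuples of degree \<open>n\<close> in \<open>syz\<close> lie in \<open>dec\<close>.\<close>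

definition syz :: "(nat \<Rightarrow> ('x, 'k) free_alg) set"
  where "syz = {a. \<forall>x. (\<Sum>i=1..m. a i * fa_rdiv x (r i)) \<in> I}"

definition dec :: "(nat \<Rightarrow> ('x, 'k) free_alg) set"
  where "dec = {a. \<exists>b. (\<forall>x. b x \<in> syz) \<and> (\<forall>i\<in>{1..m}. a i - (\<Sum>x\<in>UNIV. fa_var x * b x i) \<in> I)}"

definition vhom :: "nat \<Rightarrow> (nat \<Rightarrow> ('x, 'k) free_alg) \<Rightarrow> bool"
  where "vhom n a \<longleftrightarrow> (\<forall>i. if d i \<le> n then a i \<in> fa_comp (n - d i) else a i = 0)"

definition vpart :: "nat \<Rightarrow> (nat \<Rightarrow> ('x, 'k) free_alg) \<Rightarrow> nat \<Rightarrow> ('x, 'k) free_alg"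
  where "vpart n a i = (if d i \<le> n then fa_part (n - d i) (a i) else 0)"

definition no_new_syz :: "nat \<Rightarrow> bool"
  where "no_new_syz n \<longleftrightarrow> (\<forall>a\<in>syz. vpart n a \<in> dec)"

lemma vhom_vpart: "vhom n (vpart n a)"
  by (simp add: vhom_def vpart_def)

lemma vpart_vhom: "vhom n a \<Longrightarrow> vpart n a = a"
  by (force simp: vhom_def vpart_def part_comp split: if_splits)

lemma vpart_other: "vhom j a \<Longrightarrow> j \<noteq> n \<Longrightarrow> vpart n a = (\<lambda>_. 0)"
proof (rule ext)
  fix i assume "vhom j a" "j \<noteq> n"
  then have "if d i \<le> j then a i \<in> fa_comp (j - d i) else a i = 0" by (simp add: vhom_def)
  then show "vpart n a i = 0"
    using \<open>j \<noteq> n\<close> by (cases "d i \<le> j") (auto simp: vpart_def part_comp)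
qed

lemma vhom_add: "vhom n a \<Longrightarrow> vhom n b \<Longrightarrow> vhom n (\<lambda>i. a i + b i)"
  unfolding vhom_def using fa.subspace_add[OF subspace_comp] by (metis add.right_neutral)

lemma vhom_zero: "vhom n (\<lambda>_. 0)"
  by (simp add: vhom_def fa.subspace_0[OF subspace_comp])

lemma vpart_sum_rdiv:
  "(\<Sum>i=1..m. vpart (Suc n) a i * fa_rdiv x (r i)) = fa_part n (\<Sum>i=1..m. a i * fa_rdiv x (r i))"
  unfolding part_sum
proof (rule sum.cong)
  fix i assume i: "i \<in> {1..m}"
  have "fa_part n (a i * fa_rdiv x (r i))
      = (if d i - 1 \<le> n then fa_part (n - (d i - 1)) (a i) * fa_rdiv x (r i) else 0)"
    by (rule part_mult_comp_right[OF rdiv_r_comp[OF i]])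
  then show "vpart (Suc n) a i * fa_rdiv x (r i) = fa_part n (a i * fa_rdiv x (r i))"
    using d_ge[OF i] by (cases "d i") (auto simp: vpart_def)
qed simp

lemma vpart_zero_degree: "i \<in> {1..m} \<Longrightarrow> vpart 0 a i = 0"
  using d_ge[of i] by (simp add: vpart_def)

lemma syz_vpart:
  assumes "a \<in> syz" shows "vpart n a \<in> syz"
proof (cases n)
  case 0
  then show ?thesis by (simp add: syz_def vpart_zero_degree)
next
  case (Suc k)
  then show ?thesis
    using assms I_part by (simp add: syz_def vpart_sum_rdiv)
qed

lemma dec_vpart:
  assumes "a \<in> dec"
  obtains b where "\<And>x. b x \<in> syz" "\<And>x. vhom (n - 1) (b x)"
    "\<And>i. i \<in> {1..m} \<Longrightarrow> vpart n a i - (\<Sum>x\<in>UNIV. fa_var x * b x i) \<in> I"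
proof (cases n)
  case 0
  have "(\<lambda>_. 0) \<in> syz" by (simp add: syz_def)
  then show ?thesis
    using 0 by (intro that[of "\<lambda>_ _. 0"]) (auto simp: vhom_zero vpart_zero_degree)
next
  case (Suc k)
  from assms obtain b where b: "\<And>x. b x \<in> syz"
    "\<And>i. i \<in> {1..m} \<Longrightarrow> a i - (\<Sum>x\<in>UNIV. fa_var x * b x i) \<in> I"
    unfolding dec_def by blast
  show ?thesis
  proof (rule that[of "\<lambda>x. vpart k (b x)"])
    fix i assume i: "i \<in> {1..m}"
    have v: "fa_var x * vpart k (b x) i =
        (if d i \<le> n then fa_part (n - d i) (fa_var x * b x i) else 0)" for x
      using Suc part_mult_comp_left[OF fa_var_comp, of "n - d i" x "b x i"]
      by (auto simp: vpart_def not_le le_Suc_eq Suc_diff_le)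
    have "vpart n a i - (\<Sum>x\<in>UNIV. fa_var x * vpart k (b x) i)
        = (if d i \<le> n then fa_part (n - d i) (a i - (\<Sum>x\<in>UNIV. fa_var x * b x i)) else 0)"
      unfolding v by (simp add: vpart_def part_diff part_sum)
    then show "vpart n a i - (\<Sum>x\<in>UNIV. fa_var x * vpart k (b x) i) \<in> I"
      using I_part[OF b(2)[OF i]] by simp
  qed (use b Suc in \<open>auto simp: syz_vpart vhom_vpart\<close>)
qed

end

locale deformation_data = graded_relations m r d
  for m :: nat and r :: "nat \<Rightarrow> ('x::finite, 'k::field) free_alg" and d +
  fixes l :: "nat \<Rightarrow> ('x, 'k) free_alg"
  assumes l_below: "i \<in> {1..m} \<Longrightarrow> l i \<in> fa_filt_below (d i)"
begin

definition p :: "nat \<Rightarrow> ('x, 'k) free_alg"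
  where "p i = r i + l i"

abbreviation P :: "('x, 'k) free_alg set"
  where "P \<equiv> p ` {1..m}"

lemma p_filt: "i \<in> {1..m} \<Longrightarrow> p i \<in> fa_filt (d i)"
  unfolding p_def using r_comp[of i] l_below[of i]
  by (intro fa.subspace_add[OF subspace_filt])
    (auto dest: set_mp[OF comp_subset_filt] set_mp[OF below_subset_filt])

lemma part_p: "i \<in> {1..m} \<Longrightarrow> fa_part (d i) (p i) = r i"
  unfolding p_def using r_comp[of i] l_below[of i] by (simp add: part_add part_comp part_below)

lemma P_filt: "P \<inter> fa_filt k = p ` {i\<in>{1..m}. d i \<le> k}"
proof -
  have "d i \<le> k" if "i \<in> {1..m}" "p i \<in> fa_filt k" for i
    using that part_p[of i] part_filt_above[of "p i" k "d i"] r_nonzero[of i]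
    by (cases "k < d i") auto
  then show ?thesis
    using p_filt filt_mono by fast
qed

subsection \<open>The subspaces \<open>P\<^sub>k\<close>\<close>

definition P_words :: "nat \<Rightarrow> ('x, 'k) free_alg set"
  where "P_words k = {fa_word u * p i * fa_word v |u i v. i \<in> {1..m} \<and> length u + d i + length v \<le> k}"

lemma P_words_mult_left:
  assumes "f \<in> fa_filt j" "g \<in> fa.span (P_words k)"
  shows "f * g \<in> fa.span (P_words (j + k))"
  using assms(2)
proof (induction g rule: fa.span_induct_alt)
  case (step c x y)
  then obtain u i v where x: "x = fa_word u * p i * fa_word v" "i \<in> {1..m}"
    "length u + d i + length v \<le> k"
    unfolding P_words_def by blast
  have "f * x \<in> fa.span (P_words (j + k))"
    using assms(1)[unfolded fa_filt_def mem_Collect_eq]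
  proof (induction f rule: monomials_induct)
    case (monomial w b)
    have "Poly_Mapping.single w b * x = fa_scale b (fa_word (w @ u) * p i * fa_word v)"
      by (simp add: x(1) single_eq_scale_word[of _ b] fa_scale_mult_left single_mult_single
          flip: mult.assoc)
    moreover have "fa_word (w @ u) * p i * fa_word v \<in> P_words (j + k)"
      unfolding P_words_def using x(2,3) monomial
      by (intro CollectI exI[of _ "w @ u"] exI[of _ i] exI[of _ v]) auto
    ultimately show ?case by (simp add: fa.span_scale fa.span_base)
  qed (auto simp: distrib_right intro: fa.span_add fa.span_zero)
  then show ?case
    using step by (simp add: distrib_left mult_scale_right fa.span_add fa.span_scale)
qed (simp add: fa.span_zero)

lemma P_words_mult_right:
  assumes "f \<in> fa_filt j" "g \<in> fa.span (P_words k)"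
  shows "g * f \<in> fa.span (P_words (k + j))"
  using assms(2)
proof (induction g rule: fa.span_induct_alt)
  case (step c x y)
  then obtain u i v where x: "x = fa_word u * p i * fa_word v" "i \<in> {1..m}"
    "length u + d i + length v \<le> k"
    unfolding P_words_def by blast
  have "x * f \<in> fa.span (P_words (k + j))"
    using assms(1)[unfolded fa_filt_def mem_Collect_eq]
  proof (induction f rule: monomials_induct)
    case (monomial w b)
    have "x * Poly_Mapping.single w b = fa_scale b (fa_word u * p i * fa_word (v @ w))"
      by (simp add: x(1) single_eq_scale_word[of _ b] mult_scale_right single_mult_single
          mult.assoc)
    moreover have "fa_word u * p i * fa_word (v @ w) \<in> P_words (k + j)"
      unfolding P_words_def using x(2,3) monomial
      by (intro CollectI exI[of _ u] exI[of _ i] exI[of _ "v @ w"]) auto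
    ultimately show ?case by (simp add: fa.span_scale fa.span_base)
  qed (auto simp: distrib_left intro: fa.span_add fa.span_zero)
  then show ?case
    using step by (simp add: distrib_right fa_scale_mult_left fa.span_add fa.span_scale)
qed (simp add: fa.span_zero)

lemma fa_V_filt: "fa_V \<subseteq> fa_filt 1"
  unfolding fa_V_def
  by (rule fa.span_minimal[OF _ subspace_filt]) (rule image_subsetI, rule set_mp[OF comp_subset_filt fa_var_comp])

lemma P_words_gen: "i \<in> {1..m} \<Longrightarrow> d i \<le> k \<Longrightarrow> p i \<in> P_words k"
  unfolding P_words_def
  by (intro CollectI exI[of _ "[]"] exI[of _ i] exI[of _ "[]"]) (simp flip: one_eq_word)

text \<open>Since \<open>P \<inter> F\<^sup>kT\<close> also contains the relations of lower degree, the recursion for \<open>P\<^sub>k\<close> yields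
  all products \<open>u p\<^sub>i v\<close> of formal degree at most \<open>k\<close>.\<close>

lemma P_space_eq: "P_space P k = fa.span (P_words k)"
proof (induction k rule: induct_nat_012)
  case 0
  have "P_words 0 = {}" using d_ge by (force simp: P_words_def)
  then show ?case by simp
next
  case 1
  have "P_words (Suc 0) = {}" using d_ge by (force simp: P_words_def)
  moreover have "P \<inter> fa_filt 1 = {}" using d_ge by (force simp: P_filt)
  ultimately show ?case by simp
next
  case (ge2 k)
  define n where "n = Suc k"
  define A where "A = fa_prod fa_V (P_space P n)"
  define B where "B = fa_prod (P_space P n) fa_V"
  define C where "C = fa.span (P \<inter> fa_filt (Suc n))"
  have IH: "P_space P n = fa.span (P_words n)" using ge2 by (simp add: n_def)
  have A: "A \<subseteq> fa.span (P_words (Suc n))"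
    unfolding A_def fa_prod_def IH
  proof (rule fa.span_minimal[OF _ fa.subspace_span], clarify)
    fix f g :: "('x, 'k) free_alg"
    assume "f \<in> fa_V" "g \<in> fa.span (P_words n)"
    then show "f * g \<in> fa.span (P_words (Suc n))"
      using P_words_mult_left[of f 1 g n] fa_V_filt by (auto simp: plus_1_eq_Suc Suc_eq_plus1[symmetric])
  qed
  have B: "B \<subseteq> fa.span (P_words (Suc n))"
    unfolding B_def fa_prod_def IH
  proof (rule fa.span_minimal[OF _ fa.subspace_span], clarify)
    fix f g :: "('x, 'k) free_alg"
    assume "g \<in> fa_V" "f \<in> fa.span (P_words n)"
    then show "f * g \<in> fa.span (P_words (Suc n))"
      using P_words_mult_right[of g 1 f n] fa_V_filt by (auto simp: plus_1_eq_Suc Suc_eq_plus1[symmetric])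
  qed
  have C: "C \<subseteq> fa.span (P_words (Suc n))"
    unfolding C_def P_filt
    by (rule fa.span_minimal)
      (use P_words_gen fa.subspace_span fa.span_base in auto)
  have sub: "fa.subspace A" "fa.subspace B" "fa.subspace C"
    by (simp_all add: A_def B_def C_def fa_prod_def fa.subspace_span)
  have gen: "x \<in> A \<union> B \<union> C" if "x \<in> P_words (Suc n)" for x
  proof -
    from that obtain u i v where x: "x = fa_word u * p i * fa_word v" "i \<in> {1..m}"
      "length u + d i + length v \<le> Suc n"
      unfolding P_words_def by blast
    have V: "fa_var y \<in> fa_V" for y :: 'x
      by (simp add: fa_V_def fa.span_base)
    show ?thesis
    proof (cases u)
      case (Cons y u')
      then have "x = fa_var y * (fa_word u' * p i * fa_word v)"
        by (simp add: x(1) fa_var_def single_mult_single flip: mult.assoc)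
      moreover have "fa_word u' * p i * fa_word v \<in> P_words n"
        unfolding P_words_def using x Cons by auto
      ultimately have "x \<in> A"
        unfolding A_def fa_prod_def IH using V
        by (intro fa.span_base) (blast intro: fa.span_base)
      then show ?thesis by simp
    next
      case Nil
      show ?thesis
      proof (cases v rule: rev_cases)
        case (snoc v' y)
        then have "x = (fa_word u * p i * fa_word v') * fa_var y"
          by (simp add: x(1) fa_var_def single_mult_single mult.assoc)
        moreover have "fa_word u * p i * fa_word v' \<in> P_words n"
          unfolding P_words_def using x snoc by auto
        ultimately have "x \<in> B"
          unfolding B_def fa_prod_def IH using V
          by (intro fa.span_base) (blast intro: fa.span_base)
        then show ?thesis by simp
      next
        case v: Nil
        then have "x = p i" using Nil by (simp add: x(1) flip: one_eq_word)
        then show ?thesis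
          using x Nil v by (auto simp: C_def P_filt intro!: fa.span_base)
      qed
    qed
  qed
  have "P_space P (Suc n) = {f + g + h |f g h. f \<in> A \<and> g \<in> B \<and> h \<in> C}"
    by (simp add: n_def A_def B_def C_def)
  also have "\<dots> = fa.span (P_words (Suc n))"
  proof
    show "{f + g + h |f g h. f \<in> A \<and> g \<in> B \<and> h \<in> C} \<subseteq> fa.span (P_words (Suc n))"
      using A B C by (auto intro!: fa.span_add)
    show "fa.span (P_words (Suc n)) \<subseteq> {f + g + h |f g h. f \<in> A \<and> g \<in> B \<and> h \<in> C}"
    proof
      fix x assume "x \<in> fa.span (P_words (Suc n))"
      then show "x \<in> {f + g + h |f g h. f \<in> A \<and> g \<in> B \<and> h \<in> C}"
      proof (induction x rule: fa.span_induct_alt)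
        case base
        show ?case using sub[THEN fa.subspace_0] by force
      next
        case (step c x y)
        then obtain f g h where y: "y = f + g + h" "f \<in> A" "g \<in> B" "h \<in> C" by blast
        consider "fa_scale c x \<in> A" | "fa_scale c x \<in> B" | "fa_scale c x \<in> C"
          using gen[OF step(1)] sub[THEN fa.subspace_scale] by blast
        then show ?case
        proof cases
          case 1
          with y sub(1) have "fa_scale c x + f \<in> A" by (simp add: fa.subspace_add)
          moreover have "fa_scale c x + y = (fa_scale c x + f) + g + h"
            by (simp add: y add_ac)
          ultimately show ?thesis using y by blast
        next
          case 2
          with y sub(2) have "fa_scale c x + g \<in> B" by (simp add: fa.subspace_add)
          moreover have "fa_scale c x + y = f + (fa_scale c x + g) + h"
            by (simp add: y add_ac)
          ultimately show ?thesis using y by blast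
        next
          case 3
          with y sub(3) have "fa_scale c x + h \<in> C" by (simp add: fa.subspace_add)
          moreover have "fa_scale c x + y = f + g + (fa_scale c x + h)"
            by (simp add: y add_ac)
          ultimately show ?thesis using y by blast
        qed
      qed
    qed
  qed
  finally show ?case by (simp add: n_def)
qed

lemma subspace_P: "fa.subspace (P_space P k)"
  by (simp add: P_space_eq fa.subspace_span)

lemma P_mono: "j \<le> k \<Longrightarrow> P_space P j \<subseteq> P_space P k"
  unfolding P_space_eq by (rule fa.span_mono) (force simp: P_words_def)

lemma P_mult_left: "f \<in> fa_filt j \<Longrightarrow> g \<in> P_space P k \<Longrightarrow> f * g \<in> P_space P (j + k)"
  unfolding P_space_eq by (rule P_words_mult_left)

lemma P_mult_right: "f \<in> fa_filt j \<Longrightarrow> g \<in> P_space P k \<Longrightarrow> g * f \<in> P_space P (k + j)"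
  unfolding P_space_eq by (rule P_words_mult_right)

lemma P_gen: "i \<in> {1..m} \<Longrightarrow> d i \<le> k \<Longrightarrow> p i \<in> P_space P k"
  unfolding P_space_eq by (rule fa.span_base[OF P_words_gen])

lemma P_subset_filt: "P_space P k \<subseteq> fa_filt k"
  unfolding P_space_eq
proof (rule fa.span_minimal[OF _ subspace_filt], rule subsetI)
  fix x assume "x \<in> P_words k"
  then obtain u i v where x: "x = fa_word u * p i * fa_word v" "i \<in> {1..m}"
    "length u + d i + length v \<le> k"
    unfolding P_words_def by blast
  have "x \<in> fa_filt (length u + d i + length v)"
    unfolding x(1) by (intro filt_mult p_filt x(2)) (simp_all add: fa_filt_def)
  then show "x \<in> fa_filt k" using filt_mono x(3) by blast
qed

lemma P_subset_ideal: "P_space P k \<subseteq> fa_ideal P"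
  unfolding P_space_eq
proof (rule fa.span_minimal[OF _ subspace_ideal], rule subsetI)
  fix x assume "x \<in> P_words k"
  then obtain u i v where "x = fa_word u * p i * fa_word v" "i \<in> {1..m}"
    unfolding P_words_def by blast
  then show "x \<in> fa_ideal P"
    by (simp only:) (intro fa_ideal_rmult fa_ideal_lmult fa_ideal_gen imageI)
qed

lemma ideal_P: "f \<in> fa_ideal P \<Longrightarrow> \<exists>k. f \<in> P_space P k"
proof (induction f rule: fa_ideal_induct)
  case zero
  show ?case by (rule exI[of _ 0]) simp
next
  case (add g h)
  then obtain j k where "g \<in> P_space P j" "h \<in> P_space P k" by blast
  then have "g \<in> P_space P (max j k)" "h \<in> P_space P (max j k)"
    using P_mono[of j "max j k"] P_mono[of k "max j k"] by auto
  then show ?case using fa.subspace_add[OF subspace_P] by blast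
next
  case (gen u q v c)
  then obtain i where i: "i \<in> {1..m}" "q = p i" by blast
  have "Poly_Mapping.single u c \<in> fa_filt (length u)" "fa_word v \<in> fa_filt (length v)"
    by (simp_all add: fa_filt_def)
  then show ?case
    using P_mult_right P_mult_left P_gen[OF i(1) order.refl] i(2) by blast
qed

subsection \<open>Pairs of a homogeneous relation and its deformation\<close>

text \<open>The pairs \<open>(\<Sum> u r\<^sub>i v, \<Sum> u p\<^sub>i v)\<close> with all summands of degree \<open>n\<close>.  The second component depends
  on the chosen expression of the first, and the Jacobi condition says that for a first
  component \<open>0\<close> the second one is a consequence of relations of lower degree.\<close>

inductive rel :: "nat \<Rightarrow> ('x, 'k) free_alg \<Rightarrow> ('x, 'k) free_alg \<Rightarrow> bool" where
  rel_zero: "rel n 0 0"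
| rel_add: "rel n a b \<Longrightarrow> rel n a' b' \<Longrightarrow> rel n (a + a') (b + b')"
| rel_gen: "i \<in> {1..m} \<Longrightarrow> u \<in> fa_comp j \<Longrightarrow> v \<in> fa_comp k \<Longrightarrow> j + d i + k = n \<Longrightarrow>
    rel n (u * r i * v) (u * p i * v)"

lemma rel_mult_left: "rel n a b \<Longrightarrow> f \<in> fa_comp j \<Longrightarrow> j + n = n' \<Longrightarrow> rel n' (f * a) (f * b)"
proof (induction arbitrary: n' rule: rel.induct)
  case (rel_gen i u j' v k n)
  have "rel n' ((f * u) * r i * v) ((f * u) * p i * v)"
    by (rule rel.rel_gen[OF rel_gen(1) comp_mult[OF rel_gen(5,2)] rel_gen(3)])
      (use rel_gen in auto)
  then show ?case by (simp add: mult.assoc)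
qed (auto simp: distrib_left intro: rel.intros)

lemma rel_mult_right: "rel n a b \<Longrightarrow> f \<in> fa_comp j \<Longrightarrow> n + j = n' \<Longrightarrow> rel n' (a * f) (b * f)"
proof (induction arbitrary: n' rule: rel.induct)
  case (rel_gen i u j' v k n)
  have "rel n' (u * r i * (v * f)) (u * p i * (v * f))"
    by (rule rel.rel_gen[OF rel_gen(1,2) comp_mult[OF rel_gen(3,5)]])
      (use rel_gen in auto)
  then show ?case by (simp add: mult.assoc)
qed (auto simp: distrib_right intro: rel.intros)

lemma rel_r: "i \<in> {1..m} \<Longrightarrow> f \<in> fa_comp (n - d i) \<Longrightarrow> d i \<le> n \<Longrightarrow> rel n (f * r i) (f * p i)"
  using rel_gen[of i f "n - d i" 1 0 n] fa_const_comp[of 1] by (simp add: fa_const_one)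

lemma rel_uminus: "rel n a b \<Longrightarrow> rel n (- a) (- b)"
  using rel_mult_left[of n a b "- 1" 0 n] fa.subspace_neg[OF subspace_comp fa_const_comp[of 1]]
  by (simp add: fa_const_one)

lemma rel_diff: "rel n a b \<Longrightarrow> rel n a' b' \<Longrightarrow> rel n (a - a') (b - b')"
  using rel_add[OF _ rel_uminus, of n a b a' b'] by simp

lemma rel_sum: "(\<And>i. i \<in> A \<Longrightarrow> rel n (f i) (g i)) \<Longrightarrow> rel n (sum f A) (sum g A)"
  by (induction A rule: infinite_finite_induct) (auto intro: rel_zero rel_add)

lemma rel_fst_comp: "rel n a b \<Longrightarrow> a \<in> fa_comp n"
  by (induction rule: rel.induct)
    (auto intro!: comp_mult r_comp fa.subspace_0 fa.subspace_add subspace_comp)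

lemma rel_fst_ideal: "rel n a b \<Longrightarrow> a \<in> I"
proof (induction rule: rel.induct)
  case (rel_gen i u j v k n)
  then show ?case by (intro fa_ideal_rmult fa_ideal_lmult fa_ideal_gen) blast
qed (auto intro: fa_ideal_add)

lemma rel_snd_P: "rel n a b \<Longrightarrow> b \<in> P_space P n"
proof (induction rule: rel.induct)
  case (rel_zero n)
  show ?case by (rule fa.subspace_0[OF subspace_P])
next
  case (rel_add n a b a' b')
  then show ?case by (intro fa.subspace_add[OF subspace_P])
next
  case (rel_gen i u j v k n)
  then show ?case
    using P_mult_right[OF _ P_mult_left[OF _ P_gen[OF rel_gen(1) order.refl]], of v k u j]
      comp_subset_filt by blast
qed

lemma rel_minus: "rel n a b \<Longrightarrow> a - b \<in> fa_filt_below n"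
proof (induction rule: rel.induct)
  case (rel_zero n)
  show ?case by (simp add: fa.subspace_0[OF subspace_below])
next
  case (rel_add n a b a' b')
  then have "(a - b) + (a' - b') \<in> fa_filt_below n"
    by (intro fa.subspace_add[OF subspace_below])
  then show ?case by (simp add: algebra_simps)
next
  case (rel_gen i u j v k n)
  have "u * l i * v \<in> fa_filt_below n"
    using below_mult_filt[OF filt_mult_below[OF _ l_below], of u j i v k] rel_gen
      comp_subset_filt by blast
  then have "- (u * l i * v) \<in> fa_filt_below n" by (rule fa.subspace_neg[OF subspace_below])
  then show ?case by (simp add: p_def algebra_simps)
qed

lemma ideal_rel: "f \<in> I \<Longrightarrow> \<exists>b. rel n (fa_part n f) b"
proof (induction f rule: fa_ideal_induct)
  case zero
  show ?case using rel_zero by auto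
next
  case (add g h)
  then show ?case unfolding part_add using rel_add by blast
next
  case (gen u q v c)
  then obtain i where i: "i \<in> {1..m}" "q = r i" by blast
  have c: "Poly_Mapping.single u c \<in> fa_comp (length u)" "fa_word v \<in> fa_comp (length v)"
    by (simp_all add: single_in_comp)
  have "Poly_Mapping.single u c * q * fa_word v \<in> fa_comp (length u + d i + length v)"
    unfolding i(2) by (intro comp_mult r_comp i c)
  then have "fa_part n (Poly_Mapping.single u c * q * fa_word v) =
      (if length u + d i + length v = n then Poly_Mapping.single u c * q * fa_word v else 0)"
    by (rule part_comp)
  then show ?case
    using rel_gen[OF i(1) c] rel_zero i(2) by metis
qed

text \<open>Among the products \<open>u p\<^sub>i v\<close> spanning \<open>P\<^sub>n\<^sub>+\<^sub>1\<close>, those of formal degree below \<open>n + 1\<close> span \<open>P\<^sub>n\<close>.\<close>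

lemma P_Suc_rel:
  assumes "f \<in> P_space P (Suc n)"
  obtains a b q where "rel (Suc n) a b" "q \<in> P_space P n" "f = b + q"
proof -
  have "\<exists>a b q. rel (Suc n) a b \<and> q \<in> P_space P n \<and> f = b + q"
    using assms unfolding P_space_eq
  proof (induction f rule: fa.span_induct_alt)
    case base
    show ?case using rel_zero fa.span_zero by force
  next
    case (step c x y)
    then obtain a b q where y: "rel (Suc n) a b" "q \<in> fa.span (P_words n)" "y = b + q" by blast
    from step(1) obtain u i v where x: "x = fa_word u * p i * fa_word v" "i \<in> {1..m}"
      "length u + d i + length v \<le> Suc n"
      unfolding P_words_def by blast
    show ?case
    proof (cases "length u + d i + length v = Suc n")
      case True
      have "rel (Suc n) (fa_word u * r i * fa_word v) x"
        unfolding x(1) by (rule rel_gen[OF x(2) _ _ True]) (simp_all add: single_in_comp)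
      then have "rel (Suc n) (fa_scale c (fa_word u * r i * fa_word v)) (fa_scale c x)"
        unfolding fa_scale_def by (rule rel_mult_left[OF _ fa_const_comp]) simp
      then show ?thesis
        using rel_add[OF _ y(1)] y(2,3) by (metis add.assoc)
    next
      case False
      then have "x \<in> P_words n" using x by (force simp: P_words_def)
      then have "fa_scale c x + q \<in> fa.span (P_words n)"
        using y(2) by (simp add: fa.span_add fa.span_scale fa.span_base)
      then show ?thesis using y(1,3) by (metis add.left_commute)
    qed
  qed
  then show ?thesis using that by blast
qed

subsection \<open>The Jacobi condition\<close>

definition jacobi :: "nat \<Rightarrow> bool"
  where "jacobi k \<longleftrightarrow> P_space P (Suc k) \<inter> fa_filt k \<subseteq> P_space P k"

lemma comp_filt_zero: "f \<in> fa_comp (Suc k) \<Longrightarrow> f \<in> fa_filt k \<Longrightarrow> f = 0"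
  using part_comp[of f "Suc k" "Suc k"] part_filt_above[of f k "Suc k"] by simp

text \<open>In \<open>b + q\<close> with \<open>rel (k + 1) a b\<close> and \<open>q \<in> P\<^sub>k\<close> the component of degree \<open>k + 1\<close> is \<open>a\<close>, so the
  element lies in \<open>F\<^sup>kT\<close> exactly if \<open>a = 0\<close>.\<close>

lemma jacobi_rel: "jacobi k \<longleftrightarrow> (\<forall>b. rel (Suc k) 0 b \<longrightarrow> b \<in> P_space P k)"
proof (intro iffI allI impI)
  fix b assume "jacobi k" "rel (Suc k) 0 b"
  moreover from this have "b \<in> fa_filt k"
    using rel_minus[of "Suc k" 0 b] fa.subspace_neg[OF subspace_filt, of "- b" k]
    by (simp add: below_Suc)
  ultimately show "b \<in> P_space P k"
    using rel_snd_P unfolding jacobi_def by blast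
next
  assume *: "\<forall>b. rel (Suc k) 0 b \<longrightarrow> b \<in> P_space P k"
  show "jacobi k"
    unfolding jacobi_def
  proof
    fix f assume f: "f \<in> P_space P (Suc k) \<inter> fa_filt k"
    then obtain a b q where abq: "rel (Suc k) a b" "q \<in> P_space P k" "f = b + q"
      using P_Suc_rel by blast
    have "a = (a - b) + (f - q)" using abq by simp
    also have "\<dots> \<in> fa_filt k"
      using f abq(2) rel_minus[OF abq(1)] P_subset_filt
      by (intro fa.subspace_add[OF subspace_filt _ fa.subspace_diff[OF subspace_filt]])
        (auto simp: below_Suc)
    finally have "a = 0" by (rule comp_filt_zero[OF rel_fst_comp[OF abq(1)]])
    then show "f \<in> P_space P k"
      using * abq fa.subspace_add[OF subspace_P] by simp
  qed
qed

lemma jacobi_zero: "jacobi 0"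
proof -
  have "P \<inter> fa_filt 1 = {}" using d_ge by (force simp: P_filt)
  then show ?thesis by (simp add: jacobi_def)
qed

text \<open>For a deformation the leading forms of the relations of \<open>U\<close> in degree \<open>k\<close> always include the
  relations of \<open>A\<close>.  Jacobi conditions in all degrees let an element of \<open>P\<^sub>k\<^sub>+\<^sub>j\<close> of degree at most
  \<open>k\<close> descend to \<open>P\<^sub>k\<close>, where its leading form is visibly a relation of \<open>A\<close>.  Conversely, if all
  leading forms are relations of \<open>A\<close>, subtracting deformed relations with the same leading form
  puts every element of \<open>\<langle>P\<rangle> \<inter> F\<^sup>kT\<close> into \<open>P\<^sub>k\<close>.\<close>

lemma leading_iff_jacobi:
  "(\<forall>k. \<forall>f \<in> fa_ideal P \<inter> fa_filt k. fa_part k f \<in> I) \<longleftrightarrow> (\<forall>k. jacobi k)"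
proof (intro iffI allI ballI)
  fix k f assume J: "\<forall>k. jacobi k" and f: "f \<in> fa_ideal P \<inter> fa_filt k"
  have down: "f \<in> P_space P (k + j) \<Longrightarrow> f \<in> P_space P k" for j
  proof (induction j)
    case (Suc j)
    then have "f \<in> P_space P (Suc (k + j)) \<inter> fa_filt (k + j)"
      using f filt_mono[of k "k + j"] by auto
    then show ?case using J Suc.IH unfolding jacobi_def by blast
  qed simp
  obtain n where "f \<in> P_space P n" using f ideal_P by blast
  then have "f \<in> P_space P (k + n)" using P_mono[of n "k + n"] by auto
  then have fk: "f \<in> P_space P k" by (rule down)
  show "fa_part k f \<in> I"
  proof (cases k)
    case 0
    then show ?thesis using fk by simp
  next
    case (Suc j)
    then obtain a b q where abq: "rel k a b" "q \<in> P_space P j" "f = b + q"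
      using fk P_Suc_rel by blast
    have "fa_part k q = 0"
      using abq(2) P_subset_filt Suc by (intro part_filt_above[of q j]) auto
    moreover have "fa_part k a = fa_part k b"
      using part_below[OF rel_minus[OF abq(1)]] by (simp add: part_diff)
    ultimately have "fa_part k f = a"
      using part_comp[OF rel_fst_comp[OF abq(1)], of k] by (simp add: abq(3) part_add)
    then show ?thesis using rel_fst_ideal[OF abq(1)] by simp
  qed
next
  fix k assume lead: "\<forall>k. \<forall>f \<in> fa_ideal P \<inter> fa_filt k. fa_part k f \<in> I"
  have "f \<in> fa_ideal P \<inter> fa_filt k \<Longrightarrow> f \<in> P_space P k" for f k
  proof (induction k arbitrary: f rule: less_induct)
    case (less k)
    then obtain b where b: "rel k (fa_part k f) b"
      using lead ideal_rel[of "fa_part k f" k] by (auto simp: part_comp[OF part_in_comp])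
    have bI: "b \<in> P_space P k" by (rule rel_snd_P[OF b])
    have "f - b = (f - fa_part k f) + (fa_part k f - b)" by simp
    also have "\<dots> \<in> fa_filt_below k"
      using less.prems rel_minus[OF b] minus_part_below
      by (intro fa.subspace_add[OF subspace_below]) auto
    finally have below: "f - b \<in> fa_filt_below k" .
    have "f - b \<in> fa_ideal P"
      using less.prems bI P_subset_ideal by (intro fa_ideal_diff) auto
    then have "f - b \<in> P_space P k"
      using below less.IH[of "k - 1" "f - b"] P_mono[of "k - 1" k]
      by (cases k) (auto simp: below_zero below_Suc)
    then show ?case
      using fa.subspace_add[OF subspace_P bI] by fastforce
  qed
  then show "jacobi k"
    using P_subset_ideal unfolding jacobi_def by blast
qed

end

context deformation_data
begin

section \<open>Jacobi conditions without new syzygies\<close>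

text \<open>The summands \<open>u r\<^sub>i v\<close> are sorted by whether \<open>v\<close> is a scalar or ends in a letter.\<close>

lemma rel_split:
  assumes "rel n a b"
  obtains A C D where "vhom n A" "\<And>x. rel (n - 1) (C x) (D x)"
    "a = (\<Sum>i=1..m. A i * r i) + (\<Sum>x\<in>UNIV. C x * fa_var x)"
    "b = (\<Sum>i=1..m. A i * p i) + (\<Sum>x\<in>UNIV. D x * fa_var x)"
proof -
  have "\<exists>A C D. vhom n A \<and> (\<forall>x. rel (n - 1) (C x) (D x)) \<and>
      a = (\<Sum>i=1..m. A i * r i) + (\<Sum>x\<in>UNIV. C x * fa_var x) \<and>
      b = (\<Sum>i=1..m. A i * p i) + (\<Sum>x\<in>UNIV. D x * fa_var x)"
    using assms
  proof (induction rule: rel.induct)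
    case (rel_zero n)
    show ?case
      by (intro exI[of _ "\<lambda>_. 0"]) (simp add: vhom_zero rel.rel_zero)
  next
    case (rel_add n a b a' b')
    then obtain A C D A' C' D' where
      1: "vhom n A" "\<forall>x. rel (n - 1) (C x) (D x)"
        "a = (\<Sum>i=1..m. A i * r i) + (\<Sum>x\<in>UNIV. C x * fa_var x)"
        "b = (\<Sum>i=1..m. A i * p i) + (\<Sum>x\<in>UNIV. D x * fa_var x)" and
      2: "vhom n A'" "\<forall>x. rel (n - 1) (C' x) (D' x)"
        "a' = (\<Sum>i=1..m. A' i * r i) + (\<Sum>x\<in>UNIV. C' x * fa_var x)"
        "b' = (\<Sum>i=1..m. A' i * p i) + (\<Sum>x\<in>UNIV. D' x * fa_var x)"
      by blast
    show ?case
      using 1 2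
      by (intro exI[of _ "\<lambda>i. A i + A' i"] exI[of _ "\<lambda>x. C x + C' x"]
            exI[of _ "\<lambda>x. D x + D' x"])
        (auto simp: distrib_right sum.distrib add_ac intro: vhom_add rel.rel_add)
  next
    case (rel_gen i u j v k n)
    have sum1: "(\<Sum>i'=1..m. (if i' = i then f else 0) * g i') = f * g i"
      for f :: "('x, 'k) free_alg" and g
    proof -
      have "(\<Sum>i'=1..m. (if i' = i then f else 0) * g i') = (\<Sum>i'=1..m. if i' = i then f * g i' else 0)"
        by (rule sum.cong) auto
      then show ?thesis using rel_gen(1) by (simp add: sum.delta)
    qed
    show ?case
    proof (cases k)
      case 0
      then obtain c where c: "v = fa_const c" using comp_zero_const rel_gen(3) by blast
      have u: "fa_scale c u \<in> fa_comp (n - d i)"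
        using rel_gen 0 by (auto intro!: fa.subspace_scale[OF subspace_comp])
      have v: "f * v = fa_scale c f" for f
        by (simp add: c fa_scale_def const_commute)
      have "vhom n (\<lambda>i'. if i' = i then fa_scale c u else 0)"
        using u rel_gen(4) by (simp add: vhom_def fa.subspace_0[OF subspace_comp])
      then show ?thesis
        by (intro exI[of _ "\<lambda>i'. if i' = i then fa_scale c u else 0"] exI[of _ "\<lambda>_. 0"])
          (simp add: sum1 v fa_scale_mult_left rel.rel_zero)
    next
      case (Suc k')
      have v: "v = (\<Sum>x\<in>UNIV. fa_rdiv x v * fa_var x)"
        using rel_gen(3) Suc by (intro rdiv_expansion_comp) auto
      have split: "f * v = (\<Sum>x\<in>UNIV. f * fa_rdiv x v * fa_var x)" for f
        by (subst v) (simp add: sum_distrib_left mult.assoc)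
      have "rel (n - 1) (u * r i * fa_rdiv x v) (u * p i * fa_rdiv x v)" for x
        using rel_gen Suc rdiv_comp[of v k' x] by (intro rel.rel_gen[where k = k']) auto
      then show ?thesis
        by (intro exI[of _ "\<lambda>_. 0"] exI[of _ "\<lambda>x. u * r i * fa_rdiv x v"]
              exI[of _ "\<lambda>x. u * p i * fa_rdiv x v"])
          (simp add: vhom_zero flip: split)
    qed
  qed
  then show ?thesis using that by blast
qed

text \<open>Two relations overlapping trivially: rewriting \<open>a r\<^sub>i\<close>, with \<open>a\<close> itself a relation, through
  \<open>p\<^sub>i\<close> or through the deformation \<open>a'\<close> of \<open>a\<close> makes no difference modulo lower order.\<close>

lemma rel_mult_commute:
  assumes i: "i \<in> {1..m}" and ab: "rel j a a'" and n: "j + d i = Suc k"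
  shows "a * p i - a' * r i \<in> P_space P k"
proof -
  have eq: "a * p i - a' * r i = (a - a') * p i + a' * l i"
    by (simp add: p_def algebra_simps)
  have 1: "(a - a') * p i \<in> P_space P k"
  proof (cases j)
    case 0
    then show ?thesis using rel_minus[OF ab] fa.subspace_0[OF subspace_P]
      by (simp add: below_zero)
  next
    case (Suc j')
    then show ?thesis
      using P_mult_left[of "a - a'" j' "p i" "d i"] rel_minus[OF ab] P_gen[OF i order.refl] n
      by (simp add: below_Suc)
  qed
  have "l i \<in> fa_filt (d i - 1)"
    using l_below[OF i] d_ge[OF i] below_Suc[of "d i - 1"] by auto
  then have "a' * l i \<in> P_space P (j + (d i - 1))"
    by (rule P_mult_right[OF _ rel_snd_P[OF ab]])
  moreover have "j + (d i - 1) = k" using n d_ge[OF i] by simp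
  ultimately show ?thesis
    unfolding eq using 1 by (auto intro: fa.subspace_add[OF subspace_P])
qed

text \<open>A syzygy of the two-sided ideal is an element of \<open>T \<otimes> R \<otimes> T\<close> mapped to \<open>0\<close> in \<open>T\<close>, where \<open>R\<close> is the
  span of the \<open>r\<^sub>i\<close>.  Products of letters with syzygies of lower degree satisfy the Jacobi condition
  by induction, and the trivial syzygies do by \<open>rel_mult_commute\<close>.  Discarding the part in
  \<open>T \<otimes> R \<otimes> TV\<close>, a syzygy leaves a tuple in \<open>syz\<close>; if this tuple is in \<open>dec\<close>, subtracting products and
  trivial syzygies moves the whole syzygy into \<open>T \<otimes> R \<otimes> TV\<close>, and there the last letter can be
  cancelled because \<open>T\<close> is free.\<close>

lemma jacobi_step:
  assumes new: "no_new_syz (Suc k)" and k: "0 < k" and J: "jacobi (k - 1)"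
  shows "jacobi k"
  unfolding jacobi_rel
proof (intro allI impI)
  fix b assume "rel (Suc k) 0 b"
  then obtain A C D where A: "vhom (Suc k) A" and CD': "\<And>x. rel (Suc k - 1) (C x) (D x)"
    and zero: "0 = (\<Sum>i=1..m. A i * r i) + (\<Sum>x\<in>UNIV. C x * fa_var x)"
    and b: "b = (\<Sum>i=1..m. A i * p i) + (\<Sum>x\<in>UNIV. D x * fa_var x)"
    by (rule rel_split) blast
  from CD' have CD: "rel k (C x) (D x)" for x by simp
  have lower: "e \<in> P_space P (k - 1)" if "rel k 0 e" for e
    using J k that by (simp add: jacobi_rel)
  have rdiv_sum_var: "fa_rdiv z (\<Sum>x\<in>UNIV. E x * fa_var x) = E z"
    for z and E :: "'x \<Rightarrow> ('x, 'k) free_alg"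
    by (simp add: rdiv_sum rdiv_mult_var)
  have "A \<in> syz"
    unfolding syz_def
  proof (intro CollectI allI)
    fix x
    have "fa_rdiv x 0 = (\<Sum>i=1..m. A i * fa_rdiv x (r i)) + C x"
      by (subst zero) (simp add: rdiv_add rdiv_sum_var, simp add: rdiv_sum rdiv_mult_r)
    then have "(\<Sum>i=1..m. A i * fa_rdiv x (r i)) = - C x"
      by (simp add: eq_neg_iff_add_eq_0)
    then show "(\<Sum>i=1..m. A i * fa_rdiv x (r i)) \<in> I"
      using rel_fst_ideal[OF CD] by (simp add: fa_ideal_uminus)
  qed
  then have "A \<in> dec"
    using new vpart_vhom[OF A] unfolding no_new_syz_def by metis
  then obtain B where B: "\<And>x. B x \<in> syz" "\<And>x. vhom k (B x)"
    "\<And>i. i \<in> {1..m} \<Longrightarrow> A i - (\<Sum>x\<in>UNIV. fa_var x * B x i) \<in> I"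
    using dec_vpart[of A "Suc k"] vpart_vhom[OF A] by auto
  define y where "y i = A i - (\<Sum>x\<in>UNIV. fa_var x * B x i)" for i
  have y_hom: "if d i \<le> Suc k then y i \<in> fa_comp (Suc k - d i) else y i = 0" for i
  proof (cases "d i \<le> k")
    case True
    have "fa_var x * B x i \<in> fa_comp (Suc k - d i)" for x
    proof -
      have "1 + (k - d i) = Suc k - d i" using True by simp
      then show ?thesis
        using comp_mult[OF fa_var_comp, of "B x i" "k - d i" x] B(2)[of x] True
        by (auto simp: vhom_def)
    qed
    then show ?thesis
      using A True by (auto simp: y_def vhom_def intro!: fa.subspace_diff[OF subspace_comp]
          fa.subspace_sum[OF subspace_comp])
  next
    case False
    then have "B x i = 0" for x using B(2)[of x] by (simp add: vhom_def)
    then show ?thesis using A by (simp add: y_def vhom_def)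
  qed
  have "\<exists>y'. if d i \<le> Suc k then rel (Suc k - d i) (y i) y' else y i = 0 \<and> y' = 0"
    if "i \<in> {1..m}" for i
    using ideal_rel[of "y i" "Suc k - d i"] B(3)[OF that] y_hom[of i]
    by (auto simp: part_comp simp flip: y_def split: if_splits)
  then obtain y' where y': "\<And>i. i \<in> {1..m} \<Longrightarrow>
      if d i \<le> Suc k then rel (Suc k - d i) (y i) (y' i) else y i = 0 \<and> y' i = 0"
    by metis
  define c where "c x z = (\<Sum>i=1..m. B x i * fa_rdiv z (r i))" for x z
  have c_hom: "c x z \<in> fa_comp (k - 1)" for x z
  proof -
    have "B x i * fa_rdiv z (r i) \<in> fa_comp (k - 1)" if i: "i \<in> {1..m}" for i
    proof (cases "d i \<le> k")
      case True
      then have "B x i * fa_rdiv z (r i) \<in> fa_comp ((k - d i) + (d i - 1))"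
        using B(2)[of x] by (intro comp_mult rdiv_r_comp i) (simp add: vhom_def)
      then show ?thesis using True d_ge[OF i] by simp
    next
      case False
      then show ?thesis
        using B(2)[of x] by (simp add: vhom_def fa.subspace_0[OF subspace_comp])
    qed
    then show ?thesis unfolding c_def by (intro fa.subspace_sum[OF subspace_comp])
  qed
  have "\<exists>c'. rel (k - 1) (c x z) c'" for x z
    using ideal_rel[of "c x z" "k - 1"] B(1)[of x] part_comp[OF c_hom[of x z], of "k - 1"]
    by (auto simp: syz_def c_def)
  then obtain c' where c': "\<And>x z. rel (k - 1) (c x z) (c' x z)" by metis
  have B_r: "(\<Sum>i=1..m. B x i * r i) = (\<Sum>z\<in>UNIV. c x z * fa_var z)" for x
  proof -
    have "(\<Sum>i=1..m. B x i * r i) = (\<Sum>i=1..m. \<Sum>z\<in>UNIV. B x i * fa_rdiv z (r i) * fa_var z)"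
      by (rule sum.cong[OF refl], subst r_expansion) (simp_all add: sum_distrib_left mult.assoc)
    also have "\<dots> = (\<Sum>z\<in>UNIV. \<Sum>i=1..m. B x i * fa_rdiv z (r i) * fa_var z)"
      by (rule sum.swap)
    finally show ?thesis by (simp add: c_def sum_distrib_right)
  qed
  \<comment> \<open>the syzygies of degree \<open>k\<close> whose left multiples by letters are subtracted\<close>
  define e where "e x = (\<Sum>i=1..m. B x i * p i) - (\<Sum>z\<in>UNIV. c' x z * fa_var z)" for x
  have rel_B: "rel k (B x i * r i) (B x i * p i)" if "i \<in> {1..m}" for x i
    using B(2)[of x] that by (cases "d i \<le> k") (auto simp: vhom_def intro: rel_r rel_zero)
  have "rel k ((\<Sum>i=1..m. B x i * r i) - (\<Sum>z\<in>UNIV. c x z * fa_var z)) (e x)" for x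
    unfolding e_def using k
    by (intro rel_diff rel_sum rel_B rel_mult_right[OF c' fa_var_comp]) auto
  then have "rel k 0 (e x)" for x
    by (simp add: B_r)
  then have e: "fa_var x * e x \<in> P_space P k" for x
    using P_mult_left[OF set_mp[OF comp_subset_filt fa_var_comp] lower] k by simp
  have yp: "y i * p i - y' i * r i \<in> P_space P k" if "i \<in> {1..m}" for i
  proof (cases "d i \<le> Suc k")
    case True
    then show ?thesis using y'[OF that] by (intro rel_mult_commute[OF that]) auto
  next
    case False
    then show ?thesis using y'[OF that] by (simp add: fa.subspace_0[OF subspace_P])
  qed
  \<comment> \<open>what remains ends in a letter; \<open>g z\<close> and \<open>f z\<close> are the two coefficients of \<open>z\<close>\<close>
  define g where "g z = (\<Sum>x\<in>UNIV. fa_var x * c x z) + (\<Sum>i=1..m. y i * fa_rdiv z (r i)) + C z" for z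
  define f where "f z = (\<Sum>x\<in>UNIV. fa_var x * c' x z) + (\<Sum>i=1..m. y' i * fa_rdiv z (r i)) + D z" for z
  have A_eq: "A i = (\<Sum>x\<in>UNIV. fa_var x * B x i) + y i" for i
    by (simp add: y_def)
  have A_sum: "(\<Sum>i=1..m. A i * q i)
      = (\<Sum>x\<in>UNIV. fa_var x * (\<Sum>i=1..m. B x i * q i)) + (\<Sum>i=1..m. y i * q i)"
    for q :: "nat \<Rightarrow> ('x, 'k) free_alg"
  proof -
    have "(\<Sum>i=1..m. A i * q i)
        = (\<Sum>i=1..m. \<Sum>x\<in>UNIV. fa_var x * (B x i * q i)) + (\<Sum>i=1..m. y i * q i)"
      by (simp add: A_eq distrib_right sum.distrib sum_distrib_right mult.assoc)
    also have "(\<Sum>i=1..m. \<Sum>x\<in>UNIV. fa_var x * (B x i * q i))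
        = (\<Sum>x\<in>UNIV. \<Sum>i=1..m. fa_var x * (B x i * q i))"
      by (rule sum.swap)
    finally show ?thesis by (simp add: sum_distrib_left)
  qed
  have collect: "(\<Sum>z\<in>UNIV. ((\<Sum>x\<in>UNIV. fa_var x * s x z) + (\<Sum>i=1..m. t i * fa_rdiv z (r i)) + w z) * fa_var z)
      = (\<Sum>x\<in>UNIV. fa_var x * (\<Sum>z\<in>UNIV. s x z * fa_var z)) + (\<Sum>i=1..m. t i * r i)
        + (\<Sum>z\<in>UNIV. w z * fa_var z)"
    for s :: "'x \<Rightarrow> 'x \<Rightarrow> ('x, 'k) free_alg" and t and w :: "'x \<Rightarrow> ('x, 'k) free_alg"
  proof -
    have "(\<Sum>z\<in>UNIV. (\<Sum>x\<in>UNIV. fa_var x * s x z) * fa_var z)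
        = (\<Sum>z\<in>UNIV. \<Sum>x\<in>UNIV. fa_var x * (s x z * fa_var z))"
      by (simp add: sum_distrib_right mult.assoc)
    also have "\<dots> = (\<Sum>x\<in>UNIV. \<Sum>z\<in>UNIV. fa_var x * (s x z * fa_var z))"
      by (rule sum.swap)
    finally have 1: "(\<Sum>z\<in>UNIV. (\<Sum>x\<in>UNIV. fa_var x * s x z) * fa_var z)
        = (\<Sum>x\<in>UNIV. fa_var x * (\<Sum>z\<in>UNIV. s x z * fa_var z))"
      by (simp add: sum_distrib_left)
    have "(\<Sum>z\<in>UNIV. (\<Sum>i=1..m. t i * fa_rdiv z (r i)) * fa_var z)
        = (\<Sum>z\<in>UNIV. \<Sum>i=1..m. t i * (fa_rdiv z (r i) * fa_var z))"
      by (simp add: sum_distrib_right mult.assoc)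
    also have "\<dots> = (\<Sum>i=1..m. \<Sum>z\<in>UNIV. t i * (fa_rdiv z (r i) * fa_var z))"
      by (rule sum.swap)
    also have "\<dots> = (\<Sum>i=1..m. t i * r i)"
      by (rule sum.cong[OF refl]) (simp add: r_expansion[symmetric] flip: sum_distrib_left)
    finally show ?thesis
      using 1 by (simp add: distrib_right sum.distrib)
  qed
  have g_var: "(\<Sum>z\<in>UNIV. g z * fa_var z) = 0"
    unfolding g_def collect using zero by (simp add: A_sum B_r)
  have "g z = 0" for z
    using arg_cong[OF g_var, of "fa_rdiv z"] by (simp add: rdiv_sum_var)
  moreover have "rel k (g z) (f z)" for z
    unfolding g_def f_def
  proof (intro rel_add rel_sum CD)
    show "rel k (fa_var x * c x z) (fa_var x * c' x z)" for x
      using k by (intro rel_mult_left[OF c' fa_var_comp]) simp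
    fix i assume i: "i \<in> {1..m}"
    show "rel k (y i * fa_rdiv z (r i)) (y' i * fa_rdiv z (r i))"
    proof (cases "d i \<le> Suc k")
      case True
      then show ?thesis
        using y'[OF i] d_ge[OF i] by (intro rel_mult_right[OF _ rdiv_r_comp[OF i]]) auto
    next
      case False
      then show ?thesis using y'[OF i] by (simp add: rel_zero)
    qed
  qed
  ultimately have f: "f z * fa_var z \<in> P_space P k" for z
    using P_mult_right[OF set_mp[OF comp_subset_filt fa_var_comp] lower, of "f z" z] k by simp
  have "b = (\<Sum>x\<in>UNIV. fa_var x * (\<Sum>i=1..m. B x i * p i)) + (\<Sum>i=1..m. y i * p i)
      + (\<Sum>x\<in>UNIV. D x * fa_var x)"
    by (simp add: b A_sum)
  also have "\<dots> = (\<Sum>x\<in>UNIV. fa_var x * e x) + (\<Sum>i=1..m. y i * p i - y' i * r i)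
      + (\<Sum>z\<in>UNIV. f z * fa_var z)"
    unfolding f_def collect by (simp add: e_def right_diff_distrib sum_subtractf)
  also have "\<dots> \<in> P_space P k"
    by (intro fa.subspace_add[OF subspace_P] fa.subspace_sum[OF subspace_P] e yp f)
  finally show "b \<in> P_space P k" .
qed

end

section \<open>Quotients of the free algebra\<close>

lemma fa_proj_image: "fa_proj P f = (\<lambda>h. h + f) ` fa_ideal P"
  by (auto simp: fa_proj_def a_r_coset_def r_coset_def)

lemma fa_proj_eq_iff: "fa_proj P f = fa_proj P g \<longleftrightarrow> f - g \<in> fa_ideal P"
proof
  assume "fa_proj P f = fa_proj P g"
  moreover have "f \<in> fa_proj P f" unfolding fa_proj_image by force
  ultimately show "f - g \<in> fa_ideal P" unfolding fa_proj_image by auto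
next
  assume fg: "f - g \<in> fa_ideal P"
  have "h + f \<in> (\<lambda>h. h + g) ` fa_ideal P" if "h \<in> fa_ideal P" for h
    by (rule image_eqI[of _ _ "h + (f - g)"]) (use that fg in \<open>auto intro: fa_ideal_add\<close>)
  moreover have "h + g \<in> (\<lambda>h. h + f) ` fa_ideal P" if "h \<in> fa_ideal P" for h
    by (rule image_eqI[of _ _ "h - (f - g)"]) (use that fg in \<open>auto intro: fa_ideal_diff\<close>)
  ultimately show "fa_proj P f = fa_proj P g"
    unfolding fa_proj_image by blast
qed

lemma fa_quot_ring: "ring (fa_quot P)"
  unfolding fa_quot_def by (rule ideal.quotient_is_ring[OF fa_ideal_ideal])

lemma fa_proj_hom: "fa_proj P \<in> ring_hom fa_ring (fa_quot P)"
proof -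
  have "fa_proj P = (\<lambda>f. fa_ideal P +>\<^bsub>fa_ring\<^esub> f)" by (simp add: fa_proj_def fun_eq_iff)
  then show ?thesis
    unfolding fa_quot_def using ideal.rcos_ring_hom[OF fa_ideal_ideal, of P] by simp
qed

lemma fa_proj_add: "fa_proj P f \<oplus>\<^bsub>fa_quot P\<^esub> fa_proj P g = fa_proj P (f + g)"
  using ring_hom_add[OF fa_proj_hom[of P], of f g] by simp

lemma fa_proj_mult: "fa_proj P f \<otimes>\<^bsub>fa_quot P\<^esub> fa_proj P g = fa_proj P (f * g)"
  using ring_hom_mult[OF fa_proj_hom[of P], of f g] by simp

lemma fa_proj_one: "\<one>\<^bsub>fa_quot P\<^esub> = fa_proj P 1"
  using ring_hom_one[OF fa_proj_hom[of P]] by simp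

lemma fa_quot_carrier: "carrier (fa_quot P) = range (fa_proj P)"
  by (auto simp: fa_quot_def FactRing_def A_RCOSETS_def' fa_proj_def)

lemma fa_proj_zero: "\<zero>\<^bsub>fa_quot P\<^esub> = fa_proj P 0"
proof -
  interpret Q: ring "fa_quot P" by (rule fa_quot_ring)
  have "fa_proj P 0 \<oplus>\<^bsub>fa_quot P\<^esub> fa_proj P 0 = fa_proj P 0" by (simp add: fa_proj_add)
  then show ?thesis by (simp add: Q.add.r_cancel_one' fa_quot_carrier)
qed

lemma gr_class_image: "gr_class P k (fa_proj P f) = fa_proj P ` (\<lambda>h. h + f) ` fa_filt_below k"
  by (auto simp: gr_class_def quot_filt_below_def a_r_coset_def r_coset_def fa_proj_add image_iff)

lemma gr_class_eq_iff:
  "gr_class P k (fa_proj P f) = gr_class P k (fa_proj P g) \<longleftrightarrow>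
    (\<exists>h\<in>fa_filt_below k. f - g - h \<in> fa_ideal P)"
proof
  assume "gr_class P k (fa_proj P f) = gr_class P k (fa_proj P g)"
  moreover have "fa_proj P f \<in> gr_class P k (fa_proj P f)"
    unfolding gr_class_image image_image
    by (rule image_eqI[of _ _ 0]) (simp_all add: fa.subspace_0[OF subspace_below])
  ultimately have "fa_proj P f \<in> gr_class P k (fa_proj P g)" by simp
  then obtain h where "h \<in> fa_filt_below k" "fa_proj P f = fa_proj P (h + g)"
    unfolding gr_class_image by blast
  moreover have "f - (h + g) = f - g - h" by simp
  ultimately show "\<exists>h\<in>fa_filt_below k. f - g - h \<in> fa_ideal P"
    unfolding fa_proj_eq_iff by metis
next
  have sub: "gr_class P k (fa_proj P f) \<subseteq> gr_class P k (fa_proj P g)"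
    if h: "h \<in> fa_filt_below k" "f - g - h \<in> fa_ideal P" for f g h
  proof
    fix x assume "x \<in> gr_class P k (fa_proj P f)"
    then obtain h' where h': "h' \<in> fa_filt_below k" "x = fa_proj P (h' + f)"
      unfolding gr_class_image by blast
    moreover have "(h' + f) - ((h' + h) + g) = f - g - h" by simp
    ultimately have "x = fa_proj P ((h' + h) + g)"
      using h(2) by (simp only: fa_proj_eq_iff)
    then show "x \<in> gr_class P k (fa_proj P g)"
      unfolding gr_class_image using fa.subspace_add[OF subspace_below h'(1) h(1)] by blast
  qed
  assume "\<exists>h\<in>fa_filt_below k. f - g - h \<in> fa_ideal P"
  then obtain h where h: "h \<in> fa_filt_below k" "f - g - h \<in> fa_ideal P" by blast
  have "g - f - - h \<in> fa_ideal P" using fa_ideal_uminus[OF h(2)] by (simp add: algebra_simps)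
  then show "gr_class P k (fa_proj P f) = gr_class P k (fa_proj P g)"
    using sub[OF h] sub[of "- h" g f] fa.subspace_neg[OF subspace_below h(1)] by blast
qed

lemma gr_class_below:
  "f - g \<in> fa_filt_below k \<Longrightarrow> gr_class P k (fa_proj P f) = gr_class P k (fa_proj P g)"
  unfolding gr_class_eq_iff by (rule bexI[of _ "f - g"]) auto

lemma gr_add:
  "gadd (assoc_graded P) k (gr_class P k (fa_proj P f)) (gr_class P k (fa_proj P g))
    = gr_class P k (fa_proj P (f + g))"
proof -
  have "gr_class P k (fa_proj P ((h + f) + (h' + g))) = gr_class P k (fa_proj P (f + g))"
    if "h \<in> fa_filt_below k" "h' \<in> fa_filt_below k" for h h'
    using fa.subspace_add[OF subspace_below that] by (intro gr_class_below) (simp add: algebra_simps)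
  then show ?thesis
    using fa.subspace_0[OF subspace_below, of k]
    by (auto simp: assoc_graded_def gr_class_image[of P k f] gr_class_image[of P k g] fa_proj_add)
qed

lemma gr_scale:
  "gscale (assoc_graded P) k c (gr_class P k (fa_proj P f)) = gr_class P k (fa_proj P (fa_scale c f))"
proof -
  have "gr_class P k (fa_proj P (fa_const c * (h + f))) = gr_class P k (fa_proj P (fa_scale c f))"
    if "h \<in> fa_filt_below k" for h
    using fa.subspace_scale[OF subspace_below that, of c]
    by (intro gr_class_below) (simp add: algebra_simps fa_scale_def)
  then show ?thesis
    using fa.subspace_0[OF subspace_below, of k]
    by (auto simp: assoc_graded_def gr_class_image[of P k f] fa_proj_mult)
qed

lemma gr_mult:
  assumes "f \<in> fa_filt i" "g \<in> fa_filt j"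
  shows "gmult (assoc_graded P) i j (gr_class P i (fa_proj P f)) (gr_class P j (fa_proj P g))
    = gr_class P (i + j) (fa_proj P (f * g))"
proof -
  have "gr_class P (i + j) (fa_proj P ((h + f) * (h' + g))) = gr_class P (i + j) (fa_proj P (f * g))"
    if h: "h \<in> fa_filt_below i" "h' \<in> fa_filt_below j" for h h'
  proof (rule gr_class_below)
    have "(h + f) * (h' + g) - f * g = h * (h' + g) + f * h'"
      by (simp add: algebra_simps)
    also have "\<dots> \<in> fa_filt_below (i + j)"
      using h assms below_subset_filt
      by (intro fa.subspace_add[OF subspace_below] below_mult_filt filt_mult_below
          fa.subspace_add[OF subspace_filt]) auto
    finally show "(h + f) * (h' + g) - f * g \<in> fa_filt_below (i + j)" .
  qed
  then show ?thesis
    using fa.subspace_0[OF subspace_below, of i] fa.subspace_0[OF subspace_below, of j]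
    by (auto simp: assoc_graded_def gr_class_image[of P i f] gr_class_image[of P j g] fa_proj_mult)
qed

lemma gr_unit: "gunit (assoc_graded P) = gr_class P 0 (fa_proj P 1)"
  by (simp add: assoc_graded_def fa_proj_one)

lemma gr_comp: "gcomp (assoc_graded P) k = (\<lambda>f. gr_class P k (fa_proj P f)) ` fa_filt k"
  by (simp add: assoc_graded_def quot_filt_def image_image)

lemma quot_graded_simps:
  "gcomp (quot_graded P) k = fa_proj P ` fa_comp k"
  "gadd (quot_graded P) k (fa_proj P f) (fa_proj P g) = fa_proj P (f + g)"
  "gscale (quot_graded P) k c (fa_proj P f) = fa_proj P (fa_scale c f)"
  "gmult (quot_graded P) i j (fa_proj P f) (fa_proj P g) = fa_proj P (f * g)"
  "gunit (quot_graded P) = fa_proj P 1"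
  by (simp_all add: quot_graded_def quot_comp_def fa_proj_add fa_proj_mult fa_proj_one fa_scale_def)

section \<open>PBW-deformations and leading forms\<close>

lemma finite_words: "finite (fa_word ` {w :: 'x::finite list. length w = k} :: ('x, 'k::field) free_alg set)"
  using finite_lists_length_eq[of "UNIV :: 'x set" k] by simp

lemma comp_span_words: "fa_comp k \<subseteq> fa.span (fa_word ` {w. length w = k})"
proof
  fix f :: "('x, 'k::field) free_alg" assume "f \<in> fa_comp k"
  then show "f \<in> fa.span (fa_word ` {w. length w = k})"
    unfolding fa_comp_def mem_Collect_eq
  proof (induction f rule: monomials_induct)
    case (monomial w c)
    then show ?case
      unfolding single_eq_scale_word[of w c] by (intro fa.span_scale fa.span_base) auto
  qed (auto intro: fa.span_zero fa.span_add)
qed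

context deformation_data
begin

text \<open>An element of degree at most \<open>k\<close> is sent to its component of degree \<open>k\<close>; the condition on
  leading forms makes this well defined, and every relation of \<open>A\<close> being a leading form makes it
  injective.\<close>

lemma leading_imp_PBW:
  assumes lead: "\<And>k f. f \<in> fa_ideal P \<Longrightarrow> f \<in> fa_filt k \<Longrightarrow> fa_part k f \<in> I"
  shows "is_PBW (r ` {1..m}) P"
proof -
  let ?R = "r ` {1..m}"
  define gr where "gr k f = gr_class P k (fa_proj P f)" for k f
  define \<phi> where "\<phi> k X = fa_proj ?R (fa_part k (SOME f. f \<in> fa_filt k \<and> X = gr k f))" for k X
  have gr_eq: "gr k f = gr k g \<longleftrightarrow> fa_part k (f - g) \<in> I"
    if "f \<in> fa_filt k" "g \<in> fa_filt k" for k f g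
  proof
    assume "gr k f = gr k g"
    then obtain h where h: "h \<in> fa_filt_below k" "f - g - h \<in> fa_ideal P"
      unfolding gr_def gr_class_eq_iff by blast
    have "f - g - h \<in> fa_filt k"
      using that h(1) below_subset_filt by (intro fa.subspace_diff[OF subspace_filt]) auto
    from lead[OF h(2) this] show "fa_part k (f - g) \<in> I"
      by (simp add: part_diff part_below[OF h(1)])
  next
    assume "fa_part k (f - g) \<in> I"
    then obtain b where b: "rel k (fa_part k (f - g)) b"
      using ideal_rel[of "fa_part k (f - g)" k] by (auto simp: part_comp[OF part_in_comp])
    have "f - g - b = (f - g - fa_part k (f - g)) + (fa_part k (f - g) - b)" by simp
    also have "\<dots> \<in> fa_filt_below k"
      using that rel_minus[OF b]
      by (intro fa.subspace_add[OF subspace_below] minus_part_below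
          fa.subspace_diff[OF subspace_filt])
    finally have "f - g - b \<in> fa_filt_below k" .
    moreover have "b \<in> fa_ideal P" using rel_snd_P[OF b] P_subset_ideal by blast
    ultimately show "gr k f = gr k g"
      unfolding gr_def gr_class_eq_iff by (intro bexI[of _ "f - g - b"]) auto
  qed
  have \<phi>: "\<phi> k (gr k f) = fa_proj ?R (fa_part k f)" if "f \<in> fa_filt k" for k f
  proof -
    define g where "g = (SOME g. g \<in> fa_filt k \<and> gr k f = gr k g)"
    have "g \<in> fa_filt k \<and> gr k f = gr k g"
      unfolding g_def by (rule someI[of _ f]) (use that in auto)
    then have "fa_part k f - fa_part k g \<in> I" using gr_eq[of f k g] that by (simp add: part_diff)
    then have "fa_proj ?R (fa_part k f) = fa_proj ?R (fa_part k g)" by (simp add: fa_proj_eq_iff)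
    then show ?thesis by (simp add: \<phi>_def flip: g_def)
  qed
  have comp: "gcomp (assoc_graded P) k = gr k ` fa_filt k" for k
    by (simp add: gr_comp gr_def)
  have "graded_alg_iso (assoc_graded P) (quot_graded ?R) \<phi>"
    unfolding graded_alg_iso_def comp
  proof (intro conjI allI ballI)
    fix k
    show "bij_betw (\<phi> k) (gr k ` fa_filt k) (gcomp (quot_graded ?R) k)"
      unfolding bij_betw_def quot_graded_simps
    proof
      show "inj_on (\<phi> k) (gr k ` fa_filt k)"
      proof (rule inj_onI)
        fix X Y assume "X \<in> gr k ` fa_filt k" "Y \<in> gr k ` fa_filt k" "\<phi> k X = \<phi> k Y"
        moreover from this obtain f g
          where "f \<in> fa_filt k" "g \<in> fa_filt k" "X = gr k f" "Y = gr k g" by blast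
        ultimately show "X = Y" by (simp add: \<phi> gr_eq fa_proj_eq_iff part_diff)
      qed
      show "\<phi> k ` gr k ` fa_filt k = fa_proj ?R ` fa_comp k"
      proof
        show "\<phi> k ` gr k ` fa_filt k \<subseteq> fa_proj ?R ` fa_comp k"
          by (auto simp: \<phi>)
        show "fa_proj ?R ` fa_comp k \<subseteq> \<phi> k ` gr k ` fa_filt k"
        proof (rule image_subsetI)
          fix f :: "('x, 'k) free_alg" assume f: "f \<in> fa_comp k"
          then have "f \<in> fa_filt k" using comp_subset_filt by blast
          moreover from this have "\<phi> k (gr k f) = fa_proj ?R f" using f by (simp add: \<phi> part_comp)
          ultimately show "fa_proj ?R f \<in> \<phi> k ` gr k ` fa_filt k" by force
        qed
      qed
    qed
  next
    fix k X Y assume "X \<in> gr k ` fa_filt k" "Y \<in> gr k ` fa_filt k"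
    then obtain f g where fg: "f \<in> fa_filt k" "g \<in> fa_filt k" "X = gr k f" "Y = gr k g" by blast
    moreover from this have "f + g \<in> fa_filt k" by (simp add: fa.subspace_add[OF subspace_filt])
    ultimately show "\<phi> k (gadd (assoc_graded P) k X Y) = gadd (quot_graded ?R) k (\<phi> k X) (\<phi> k Y)"
      by (simp add: \<phi> quot_graded_simps part_add gr_add[of P k f g, folded gr_def])
  next
    fix k c X assume "X \<in> gr k ` fa_filt k"
    then obtain f where f: "f \<in> fa_filt k" "X = gr k f" by blast
    moreover from this have "fa_scale c f \<in> fa_filt k" by (simp add: fa.subspace_scale[OF subspace_filt])
    ultimately show "\<phi> k (gscale (assoc_graded P) k c X) = gscale (quot_graded ?R) k c (\<phi> k X)"
      by (simp add: \<phi> quot_graded_simps part_scale gr_scale[of P k c f, folded gr_def])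
  next
    fix i j X Y assume "X \<in> gr i ` fa_filt i" "Y \<in> gr j ` fa_filt j"
    then obtain f g where fg: "f \<in> fa_filt i" "g \<in> fa_filt j" "X = gr i f" "Y = gr j g" by blast
    moreover from this have "f * g \<in> fa_filt (i + j)" by (simp add: filt_mult)
    ultimately show "\<phi> (i + j) (gmult (assoc_graded P) i j X Y)
        = gmult (quot_graded ?R) i j (\<phi> i X) (\<phi> j Y)"
      by (simp add: \<phi> quot_graded_simps part_mult_top gr_mult[of f i g j P, folded gr_def])
  next
    have "(1 :: ('x, 'k) free_alg) \<in> fa_comp 0" using fa_const_comp[of 1] by (simp add: fa_const_one)
    moreover from this have "(1 :: ('x, 'k) free_alg) \<in> fa_filt 0"
      using comp_subset_filt by blast
    ultimately show "\<phi> 0 (gunit (assoc_graded P)) = gunit (quot_graded ?R)"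
      using \<phi>[of 1 0] part_comp[of "1 :: ('x, 'k) free_alg" 0 0] by (simp add: gr_unit quot_graded_simps gr_def)
  qed
  then show ?thesis unfolding is_PBW_def by blast
qed

text \<open>The isomorphism need not be the canonical one, but the components are finite-dimensional: an
  isomorphism forces the leading forms of degree \<open>k\<close> to have the same dimension as \<open>I\<^sub>k\<close>, which
  they contain.\<close>

lemma PBW_imp_leading:
  assumes PBW: "is_PBW (r ` {1..m}) P"
    and f: "f \<in> fa_ideal P" "f \<in> fa_filt k"
  shows "fa_part k f \<in> I"
proof -
  let ?R = "r ` {1..m}"
  define gr where "gr f = gr_class P k (fa_proj P f)" for f
  obtain \<Phi> where iso: "graded_alg_iso (assoc_graded P) (quot_graded ?R) \<Phi>"
    using PBW unfolding is_PBW_def by blast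
  define \<phi> where "\<phi> f = \<Phi> k (gr f)" for f
  have bij: "bij_betw (\<Phi> k) (gr ` fa_filt k) (fa_proj ?R ` fa_comp k)"
    using iso by (simp add: graded_alg_iso_def gr_comp quot_graded_simps gr_def)
  have \<phi>_comp: "\<exists>g\<in>fa_comp k. \<phi> f = fa_proj ?R g" if "f \<in> fa_filt k" for f
    using bij_betwE[OF bij] that by (auto simp: \<phi>_def)
  have \<phi>_add: "\<phi> (f + g) = fa_proj ?R (f' + g')"
    if "f \<in> fa_filt k" "g \<in> fa_filt k" "\<phi> f = fa_proj ?R f'" "\<phi> g = fa_proj ?R g'" for f g f' g'
  proof -
    have "\<Phi> k (gadd (assoc_graded P) k (gr f) (gr g)) = gadd (quot_graded ?R) k (\<phi> f) (\<phi> g)"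
      using iso that(1,2) unfolding graded_alg_iso_def \<phi>_def gr_comp by (auto simp: gr_def)
    then show ?thesis
      using that by (simp add: \<phi>_def gr_def gr_add quot_graded_simps)
  qed
  have \<phi>_scale: "\<phi> (fa_scale c f) = fa_proj ?R (fa_scale c f')"
    if "f \<in> fa_filt k" "\<phi> f = fa_proj ?R f'" for c f f'
  proof -
    have "\<Phi> k (gscale (assoc_graded P) k c (gr f)) = gscale (quot_graded ?R) k c (\<phi> f)"
      using iso that(1) unfolding graded_alg_iso_def \<phi>_def gr_comp by (auto simp: gr_def)
    then show ?thesis
      using that by (simp add: \<phi>_def gr_def gr_scale quot_graded_simps)
  qed
  define L where "L = {fa_part k f |f. f \<in> fa_ideal P \<and> f \<in> fa_filt k}"
  have gr_L: "\<phi> g = fa_proj ?R 0" if "g \<in> L" for g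
  proof -
    from that obtain f where f: "g = fa_part k f" "f \<in> fa_ideal P" "f \<in> fa_filt k"
      unfolding L_def by blast
    have "gr g = gr 0"
      unfolding gr_def gr_class_eq_iff f(1)
      by (rule bexI[of _ "- (f - fa_part k f)"])
        (use f fa.subspace_neg[OF subspace_below minus_part_below[OF f(3)]] fa_ideal_uminus
          in simp_all)
    moreover obtain h where h: "\<phi> 0 = fa_proj ?R h"
      using \<phi>_comp[of 0] fa.subspace_0[OF subspace_filt] by blast
    have "h - fa_scale 0 h \<in> I"
      using \<phi>_scale[OF fa.subspace_0[OF subspace_filt] h, of 0] h by (simp add: fa_proj_eq_iff)
    then have "\<phi> 0 = fa_proj ?R 0" by (simp add: h fa_proj_eq_iff)
    ultimately show ?thesis by (simp add: \<phi>_def)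
  qed
  have IL: "I \<inter> fa_comp k \<subseteq> L"
  proof
    fix g assume g: "g \<in> I \<inter> fa_comp k"
    then obtain b where b: "rel k g b" using ideal_rel[of g k] by (auto simp: part_comp)
    have "fa_part k b = g"
      using part_below[OF rel_minus[OF b]] g part_comp[of g k k] by (simp add: part_diff)
    then show "g \<in> L"
      unfolding L_def using rel_snd_P[OF b] P_subset_ideal P_subset_filt by blast
  qed
  have L_comp: "L \<subseteq> fa_comp k" by (auto simp: L_def)
  obtain B\<^sub>I where B\<^sub>I: "B\<^sub>I \<subseteq> I \<inter> fa_comp k" "fa.independent B\<^sub>I" "I \<inter> fa_comp k \<subseteq> fa.span B\<^sub>I"
    using fa.maximal_independent_subset by blast
  obtain B\<^sub>L where B\<^sub>L: "B\<^sub>I \<subseteq> B\<^sub>L" "B\<^sub>L \<subseteq> L" "fa.independent B\<^sub>L" "L \<subseteq> fa.span B\<^sub>L"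
    using fa.maximal_independent_subset_extend[of B\<^sub>I L] B\<^sub>I IL by blast
  obtain B where B: "B\<^sub>L \<subseteq> B" "B \<subseteq> fa_comp k" "fa.independent B" "fa_comp k \<subseteq> fa.span B"
    using fa.maximal_independent_subset_extend[of B\<^sub>L "fa_comp k"] B\<^sub>L L_comp by blast
  have fin: "finite B"
    using fa.independent_span_bound[OF finite_words B(3)] B(2) comp_span_words by blast
  have "\<forall>f\<in>fa_comp k. \<exists>g\<in>fa_comp k. \<phi> f = fa_proj ?R g"
    using \<phi>_comp comp_subset_filt by blast
  then obtain \<psi> where \<psi>: "\<And>f. f \<in> fa_comp k \<Longrightarrow> \<psi> f \<in> fa_comp k \<and> \<phi> f = fa_proj ?R (\<psi> f)"
    by metis
  \<comment> \<open>\<open>C\<close> is a basis of the component modulo \<open>L\<close>, and its lifts \<open>\<psi> ` C\<close> turn out to span it modulo \<open>I\<close>\<close>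
  define C where "C = B - B\<^sub>L"
  have lift: "f \<in> fa_comp k \<and> (\<exists>g\<in>fa.span (\<psi> ` C). \<phi> f = fa_proj ?R g)" if "f \<in> fa.span B" for f
    using that
  proof (induction f rule: fa.span_induct_alt)
    case base
    have "0 \<in> L" using f fa.subspace_0[OF subspace_filt] unfolding L_def
      by (auto intro!: exI[of _ 0])
    then show ?case
      using gr_L fa.span_zero fa.subspace_0[OF subspace_comp] by blast
  next
    case (step c x y)
    then obtain g where g: "g \<in> fa.span (\<psi> ` C)" "\<phi> y = fa_proj ?R g" by blast
    have xk: "x \<in> fa_comp k" using step(1) B(2) by blast
    obtain g' where g': "g' \<in> fa.span (\<psi> ` C)" "\<phi> x = fa_proj ?R g'"
    proof (cases "x \<in> B\<^sub>L")
      case True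
      then show ?thesis using that[of 0] gr_L B\<^sub>L(2) fa.span_zero by blast
    next
      case False
      then show ?thesis using that[of "\<psi> x"] \<psi>[OF xk] step(1) by (auto simp: C_def fa.span_base)
    qed
    have sk: "fa_scale c x \<in> fa_comp k" by (rule fa.subspace_scale[OF subspace_comp xk])
    have "\<phi> (fa_scale c x + y) = fa_proj ?R (fa_scale c g' + g)"
      using xk sk step(2) comp_subset_filt g g' by (intro \<phi>_add \<phi>_scale) auto
    moreover have "fa_scale c g' + g \<in> fa.span (\<psi> ` C)"
      using g g' by (simp add: fa.span_add fa.span_scale)
    ultimately show ?case
      using step(2) sk fa.subspace_add[OF subspace_comp] by blast
  qed
  have "fa_comp k \<subseteq> fa.span (B\<^sub>I \<union> \<psi> ` C)"
  proof
    fix t :: "('x, 'k) free_alg" assume t: "t \<in> fa_comp k"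
    then have "fa_proj ?R t \<in> \<Phi> k ` gr ` fa_filt k"
      unfolding bij_betw_imp_surj_on[OF bij] by (rule imageI)
    then obtain u where u: "u \<in> fa_filt k" "fa_proj ?R t = \<phi> u"
      unfolding \<phi>_def by (elim imageE) simp
    have "gr u = gr (fa_part k u)"
      unfolding gr_def using minus_part_below[OF u(1)] by (rule gr_class_below)
    then have "fa_proj ?R t = \<phi> (fa_part k u)" using u by (simp add: \<phi>_def)
    then obtain g where g: "g \<in> fa.span (\<psi> ` C)" "fa_proj ?R t = fa_proj ?R g"
      using lift[of "fa_part k u"] B(4) part_in_comp by (metis subsetD)
    have "fa.span (\<psi> ` C) \<subseteq> fa_comp k"
      by (rule fa.span_minimal[OF _ subspace_comp]) (use \<psi> B(2) in \<open>auto simp: C_def\<close>)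
    then have "t - g \<in> I \<inter> fa_comp k"
      using g t fa.subspace_diff[OF subspace_comp] by (auto simp: fa_proj_eq_iff)
    then have "t - g \<in> fa.span (B\<^sub>I \<union> \<psi> ` C)"
      using B\<^sub>I(3) fa.span_mono[of B\<^sub>I "B\<^sub>I \<union> \<psi> ` C"] by blast
    moreover have "g \<in> fa.span (B\<^sub>I \<union> \<psi> ` C)"
      using g(1) fa.span_mono[of "\<psi> ` C" "B\<^sub>I \<union> \<psi> ` C"] by blast
    ultimately have "(t - g) + g \<in> fa.span (B\<^sub>I \<union> \<psi> ` C)" by (rule fa.span_add)
    then show "t \<in> fa.span (B\<^sub>I \<union> \<psi> ` C)" by simp
  qed
  moreover have fin': "finite (B\<^sub>I \<union> \<psi> ` C)"
    using fin B\<^sub>L(1) B(1) by (auto simp: C_def intro: finite_subset)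
  ultimately have "card B \<le> card (B\<^sub>I \<union> \<psi> ` C)"
    using fa.independent_span_bound[OF fin' B(3)] B(2) by blast
  also have "\<dots> \<le> card B\<^sub>I + card C"
    using card_Un_le[of B\<^sub>I "\<psi> ` C"] card_image_le[of C \<psi>] fin by (simp add: C_def)
  also have "card C = card B - card B\<^sub>L"
    unfolding C_def using B(1) fin finite_subset by (intro card_Diff_subset) auto
  finally have "card B\<^sub>L \<le> card B\<^sub>I"
    using card_mono[OF fin B(1)] by simp
  then have "B\<^sub>I = B\<^sub>L"
    using B\<^sub>L(1) B(1) fin by (intro card_seteq) (auto intro: finite_subset)
  moreover have "fa.span B\<^sub>I \<subseteq> I"
    by (rule fa.span_minimal[OF _ subspace_ideal]) (use B\<^sub>I in blast)
  moreover have "fa_part k f \<in> L" using f by (auto simp: L_def)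
  ultimately show ?thesis using B\<^sub>L(4) by blast
qed

lemma PBW_iff_jacobi: "is_PBW (r ` {1..m}) P \<longleftrightarrow> (\<forall>k. jacobi k)"
  unfolding leading_iff_jacobi[symmetric] using leading_imp_PBW PBW_imp_leading by blast

end

section \<open>Left modules and linear maps\<close>

context left_module
begin

lemma smult_r_null: "a \<in> carrier R \<Longrightarrow> a \<odot>\<^bsub>M\<^esub> \<zero>\<^bsub>M\<^esub> = \<zero>\<^bsub>M\<^esub>"
  using smult_r_distr[of a "\<zero>\<^bsub>M\<^esub>" "\<zero>\<^bsub>M\<^esub>"] smult_closed[of a "\<zero>\<^bsub>M\<^esub>"]
  by (simp add: M.add.r_cancel_one')

lemma smult_l_null: "x \<in> carrier M \<Longrightarrow> \<zero>\<^bsub>R\<^esub> \<odot>\<^bsub>M\<^esub> x = \<zero>\<^bsub>M\<^esub>"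
  using smult_l_distr[of "\<zero>\<^bsub>R\<^esub>" "\<zero>\<^bsub>R\<^esub>" x] smult_closed[of "\<zero>\<^bsub>R\<^esub>" x]
  by (simp add: M.add.r_cancel_one')

lemma smult_r_minus:
  assumes "a \<in> carrier R" "x \<in> carrier M"
  shows "a \<odot>\<^bsub>M\<^esub> (\<ominus>\<^bsub>M\<^esub> x) = \<ominus>\<^bsub>M\<^esub> (a \<odot>\<^bsub>M\<^esub> x)"
proof (rule sym, rule M.minus_equality)
  show "a \<odot>\<^bsub>M\<^esub> (\<ominus>\<^bsub>M\<^esub> x) \<oplus>\<^bsub>M\<^esub> a \<odot>\<^bsub>M\<^esub> x = \<zero>\<^bsub>M\<^esub>"
    using assms by (simp add: smult_r_null M.l_neg flip: smult_r_distr)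
qed (use assms in \<open>auto intro: smult_closed\<close>)

lemma smult_l_minus:
  assumes "a \<in> carrier R" "x \<in> carrier M"
  shows "(\<ominus>\<^bsub>R\<^esub> a) \<odot>\<^bsub>M\<^esub> x = \<ominus>\<^bsub>M\<^esub> (a \<odot>\<^bsub>M\<^esub> x)"
proof (rule sym, rule M.minus_equality)
  show "(\<ominus>\<^bsub>R\<^esub> a) \<odot>\<^bsub>M\<^esub> x \<oplus>\<^bsub>M\<^esub> a \<odot>\<^bsub>M\<^esub> x = \<zero>\<^bsub>M\<^esub>"
    using assms by (simp add: smult_l_null R.l_neg flip: smult_l_distr)
qed (use assms in \<open>auto intro: smult_closed\<close>)

lemma smult_finsum:
  assumes "finite A" "a \<in> carrier R" "f \<in> A \<rightarrow> carrier M"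
  shows "a \<odot>\<^bsub>M\<^esub> finsum M f A = finsum M (\<lambda>s. a \<odot>\<^bsub>M\<^esub> f s) A"
  using assms
proof (induction A rule: finite_induct)
  case (insert s A)
  then have "f \<in> A \<rightarrow> carrier M" "f s \<in> carrier M" "(\<lambda>s. a \<odot>\<^bsub>M\<^esub> f s) \<in> A \<rightarrow> carrier M"
    "a \<odot>\<^bsub>M\<^esub> f s \<in> carrier M"
    by (auto intro: smult_closed)
  then show ?case
    using insert by (simp add: M.finsum_insert smult_r_distr M.finsum_closed)
qed (simp add: smult_r_null)

end

text \<open>Linearity without the extensionality convention of \<^const>\<open>lmod_hom\<close>, so that maps can be
  composed and subtracted freely.\<close>

definition lmod_lin :: "'a ring \<Rightarrow> ('a, 'm) module \<Rightarrow> ('a, 'n) module \<Rightarrow> ('m \<Rightarrow> 'n) \<Rightarrow> bool"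
  where "lmod_lin R M N f \<longleftrightarrow> (\<forall>x\<in>carrier M. f x \<in> carrier N) \<and>
    (\<forall>x\<in>carrier M. \<forall>y\<in>carrier M. f (x \<oplus>\<^bsub>M\<^esub> y) = f x \<oplus>\<^bsub>N\<^esub> f y) \<and>
    (\<forall>a\<in>carrier R. \<forall>x\<in>carrier M. f (a \<odot>\<^bsub>M\<^esub> x) = a \<odot>\<^bsub>N\<^esub> f x)"

lemma lin_closed: "lmod_lin R M N f \<Longrightarrow> x \<in> carrier M \<Longrightarrow> f x \<in> carrier N"
  by (simp add: lmod_lin_def)

lemma lin_add: "lmod_lin R M N f \<Longrightarrow> x \<in> carrier M \<Longrightarrow> y \<in> carrier M \<Longrightarrow>
    f (x \<oplus>\<^bsub>M\<^esub> y) = f x \<oplus>\<^bsub>N\<^esub> f y"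
  by (simp add: lmod_lin_def)

lemma lin_smult: "lmod_lin R M N f \<Longrightarrow> a \<in> carrier R \<Longrightarrow> x \<in> carrier M \<Longrightarrow>
    f (a \<odot>\<^bsub>M\<^esub> x) = a \<odot>\<^bsub>N\<^esub> f x"
  by (simp add: lmod_lin_def)

lemma hom_lin: "f \<in> lmod_hom R M N \<Longrightarrow> lmod_lin R M N f"
  by (auto simp: lmod_hom_def lmod_lin_def)

lemma lin_restrict_hom:
  assumes "left_module R M" "lmod_lin R M N f"
  shows "restrict f (carrier M) \<in> lmod_hom R M N"
proof -
  interpret M: left_module R M by fact
  show ?thesis
    using assms(2) by (auto simp: lmod_hom_def lmod_lin_def M.smult_closed)
qed

lemma lin_comp: "lmod_lin R M N f \<Longrightarrow> lmod_lin R N L g \<Longrightarrow> lmod_lin R M L (\<lambda>x. g (f x))"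
  by (simp add: lmod_lin_def)

lemma lin_id: "lmod_lin R M M (\<lambda>x. x)"
  by (simp add: lmod_lin_def)

context
  fixes R :: "'a ring" and M :: "('a, 'm) module" and N :: "('a, 'n) module"
  assumes M: "left_module R M" and N: "left_module R N"
begin

interpretation M: left_module R M by (rule M)
interpretation N: left_module R N by (rule N)

lemma lin_zero: "lmod_lin R M N f \<Longrightarrow> f \<zero>\<^bsub>M\<^esub> = \<zero>\<^bsub>N\<^esub>"
  using lin_add[of R M N f "\<zero>\<^bsub>M\<^esub>" "\<zero>\<^bsub>M\<^esub>"] lin_closed[of R M N f "\<zero>\<^bsub>M\<^esub>"]
  by (simp add: N.M.add.r_cancel_one')

lemma lin_minus:
  assumes "lmod_lin R M N f" "x \<in> carrier M"
  shows "f (\<ominus>\<^bsub>M\<^esub> x) = \<ominus>\<^bsub>N\<^esub> f x"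
  using assms lin_add[OF assms(1), of "\<ominus>\<^bsub>M\<^esub> x" x]
  by (intro sym[OF N.M.minus_equality]) (auto simp: M.M.l_neg lin_zero intro: lin_closed)

lemma lin_diff:
  assumes "lmod_lin R M N f" "x \<in> carrier M" "y \<in> carrier M"
  shows "f (x \<ominus>\<^bsub>M\<^esub> y) = f x \<ominus>\<^bsub>N\<^esub> f y"
  using assms by (simp add: a_minus_def lin_add[OF assms(1)] lin_minus)

lemma lin_fun_diff:
  assumes f: "lmod_lin R M N f" and g: "lmod_lin R M N g"
  shows "lmod_lin R M N (\<lambda>x. f x \<ominus>\<^bsub>N\<^esub> g x)"
  unfolding lmod_lin_def
proof (intro conjI ballI)
  fix x y assume x: "x \<in> carrier M" "y \<in> carrier M"
  note c = lin_closed[OF f x(1)] lin_closed[OF f x(2)] lin_closed[OF g x(1)] lin_closed[OF g x(2)]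
  show "f (x \<oplus>\<^bsub>M\<^esub> y) \<ominus>\<^bsub>N\<^esub> g (x \<oplus>\<^bsub>M\<^esub> y) = f x \<ominus>\<^bsub>N\<^esub> g x \<oplus>\<^bsub>N\<^esub> (f y \<ominus>\<^bsub>N\<^esub> g y)"
    using c by (simp add: lin_add[OF f x] lin_add[OF g x] a_minus_def N.M.minus_add N.M.a_ac)
next
  fix a x assume a: "a \<in> carrier R" and x: "x \<in> carrier M"
  show "f (a \<odot>\<^bsub>M\<^esub> x) \<ominus>\<^bsub>N\<^esub> g (a \<odot>\<^bsub>M\<^esub> x) = a \<odot>\<^bsub>N\<^esub> (f x \<ominus>\<^bsub>N\<^esub> g x)"
    using a x lin_closed[OF f x] lin_closed[OF g x]
    by (simp add: lin_smult[OF f] lin_smult[OF g] a_minus_def N.smult_r_distr N.smult_r_minus)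
qed (use f g in \<open>auto intro: lin_closed\<close>)

end

section \<open>Free modules\<close>

lemma free_lmod_simps:
  "zero (free_lmod R S) = (\<lambda>s. \<zero>\<^bsub>R\<^esub>)"
  "add (free_lmod R S) = (\<lambda>f g s. f s \<oplus>\<^bsub>R\<^esub> g s)"
  "smult (free_lmod R S) = (\<lambda>a f s. a \<otimes>\<^bsub>R\<^esub> f s)"
  by (simp_all add: free_lmod_def)

lemma free_lmod_carrier: "f \<in> carrier (free_lmod R S) \<longleftrightarrow>
    (\<forall>s. f s \<in> carrier R) \<and> (\<forall>s. s \<notin> S \<longrightarrow> f s = \<zero>\<^bsub>R\<^esub>) \<and> finite {s. f s \<noteq> \<zero>\<^bsub>R\<^esub>}"
  by (simp add: free_lmod_def)

definition free_basis :: "'a ring \<Rightarrow> 's \<Rightarrow> 's \<Rightarrow> 'a"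
  where "free_basis R s = (\<lambda>t. if t = s then \<one>\<^bsub>R\<^esub> else \<zero>\<^bsub>R\<^esub>)"

text \<open>The linear map sending the basis element \<open>s\<close> to \<open>y s\<close>.\<close>

definition free_ext :: "'a ring \<Rightarrow> ('a, 'n) module \<Rightarrow> ('s \<Rightarrow> 'n) \<Rightarrow> ('s \<Rightarrow> 'a) \<Rightarrow> 'n"
  where "free_ext R N y f = finsum N (\<lambda>s. f s \<odot>\<^bsub>N\<^esub> y s) {s. f s \<noteq> \<zero>\<^bsub>R\<^esub>}"

locale plain_ring = ring R for R :: "'a ring" (structure)
begin

lemma free_left_module: "left_module R (free_lmod R S)"
proof -
  have fin: "finite {s. f s \<oplus> g s \<noteq> \<zero>}" if "finite {s. f s \<noteq> \<zero>}" "finite {s. g s \<noteq> \<zero>}"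
    for f g :: "'b \<Rightarrow> 'a"
    by (rule finite_subset[OF _ finite_UnI[OF that]]) auto
  have fin': "finite {s. a \<otimes> f s \<noteq> \<zero>}" if "finite {s. f s \<noteq> \<zero>}" "a \<in> carrier R"
    for f :: "'b \<Rightarrow> 'a" and a
    by (rule finite_subset[OF _ that(1)]) (use that in auto)
  have "abelian_group (free_lmod R S)"
  proof (rule abelian_groupI)
    fix f assume f: "f \<in> carrier (free_lmod R S)"
    have "finite {s. \<ominus> f s \<noteq> \<zero>}"
      by (rule finite_subset[of _ "{s. f s \<noteq> \<zero>}"]) (use f in \<open>auto simp: free_lmod_carrier\<close>)
    then have "(\<lambda>s. \<ominus> f s) \<in> carrier (free_lmod R S)"
      using f by (simp add: free_lmod_carrier)
    then show "\<exists>g\<in>carrier (free_lmod R S). g \<oplus>\<^bsub>free_lmod R S\<^esub> f = \<zero>\<^bsub>free_lmod R S\<^esub>"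
      using f by (intro bexI[of _ "\<lambda>s. \<ominus> f s"])
        (auto simp: free_lmod_simps free_lmod_carrier l_neg)
  qed (auto simp: free_lmod_simps free_lmod_carrier a_ac fin)
  then show ?thesis
    unfolding left_module_def left_module_axioms_def
    using fin' by (auto simp: free_lmod_simps free_lmod_carrier ring_axioms l_distr r_distr m_assoc)
qed

lemma free_basis_carrier: "s \<in> S \<Longrightarrow> free_basis R s \<in> carrier (free_lmod R S)"
  by (auto simp: free_lmod_carrier free_basis_def intro: finite_subset[of _ "{s}"])

lemma free_induct [consumes 1, case_names zero step]:
  assumes f: "f \<in> carrier (free_lmod R S)"
    and zero: "Q (\<lambda>s. \<zero>)"
    and step: "\<And>f a s. f \<in> carrier (free_lmod R S) \<Longrightarrow> s \<in> S \<Longrightarrow> a \<in> carrier R \<Longrightarrow> Q f \<Longrightarrow>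
      Q (f \<oplus>\<^bsub>free_lmod R S\<^esub> a \<odot>\<^bsub>free_lmod R S\<^esub> free_basis R s)"
  shows "Q f"
proof -
  have "finite A \<Longrightarrow> f \<in> carrier (free_lmod R S) \<Longrightarrow> {s. f s \<noteq> \<zero>} \<subseteq> A \<Longrightarrow> Q f" for A f
  proof (induction A arbitrary: f rule: finite_induct)
    case empty
    then have "f = (\<lambda>s. \<zero>)" by auto
    then show ?case using zero by simp
  next
    case (insert s A)
    show ?case
    proof (cases "s \<in> S")
      case True
      define g where "g = f(s := \<zero>)"
      have g: "g \<in> carrier (free_lmod R S)"
        using insert.prems(1) unfolding g_def
        by (auto simp: free_lmod_carrier elim!: rev_finite_subset)
      have "f = g \<oplus>\<^bsub>free_lmod R S\<^esub> f s \<odot>\<^bsub>free_lmod R S\<^esub> free_basis R s"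
        using insert.prems(1)
        by (auto simp: g_def free_lmod_simps free_basis_def free_lmod_carrier fun_eq_iff)
      moreover have "Q g"
        by (rule insert.IH[OF g]) (use insert.prems in \<open>auto simp: g_def\<close>)
      moreover have "f s \<in> carrier R" using insert.prems(1) by (simp add: free_lmod_carrier)
      ultimately show ?thesis using step[OF g True] by metis
    next
      case False
      then show ?thesis
        using insert.prems by (intro insert.IH) (auto simp: free_lmod_carrier)
    qed
  qed
  then show ?thesis using f by (auto simp: free_lmod_carrier)
qed

end

locale plain_module = left_module R M for R :: "'a ring" (structure) and M :: "('a, 'm) module" (structure)

sublocale plain_module \<subseteq> F: plain_ring R
  by unfold_locales

context plain_module
begin

text \<open>In this context \<open>M\<close> is the target of the linear maps.\<close>

lemma free_ext_eq:
  assumes "f \<in> carrier (free_lmod R S)" "finite A" "{s. f s \<noteq> \<zero>\<^bsub>R\<^esub>} \<subseteq> A" "A \<subseteq> S"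
    and y: "\<And>s. s \<in> S \<Longrightarrow> y s \<in> carrier M"
  shows "free_ext R M y f = finsum M (\<lambda>s. f s \<odot>\<^bsub>M\<^esub> y s) A"
  unfolding free_ext_def
  by (rule M.add.finprod_mono_neutral_cong_left)
    (use assms in \<open>auto simp: free_lmod_carrier smult_l_null intro!: smult_closed\<close>)

lemma free_ext_basis:
  assumes "s \<in> S" and y: "\<And>s. s \<in> S \<Longrightarrow> y s \<in> carrier M"
  shows "free_ext R M y (free_basis R s) = y s"
proof -
  have "free_ext R M y (free_basis R s) = finsum M (\<lambda>t. free_basis R s t \<odot>\<^bsub>M\<^esub> y t) {s}"
    by (rule free_ext_eq[where S = S])
      (use assms F.free_basis_carrier[of s S] in \<open>auto simp: free_basis_def\<close>)
  then show ?thesis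
    using assms by (simp add: M.finsum_insert free_basis_def smult_one)
qed

lemma free_ext_lin:
  assumes y: "\<And>s. s \<in> S \<Longrightarrow> y s \<in> carrier M"
  shows "lmod_lin R (free_lmod R S) M (free_ext R M y)"
  unfolding lmod_lin_def
proof (intro conjI ballI)
  interpret FR: left_module R "free_lmod R S" by (rule F.free_left_module)
  have trm: "f s \<odot>\<^bsub>M\<^esub> y s \<in> carrier M" if "f \<in> carrier (free_lmod R S)" "s \<in> S" for f s
    using that y by (auto simp: free_lmod_carrier intro: smult_closed)
  have supp: "finite {s. f s \<noteq> \<zero>\<^bsub>R\<^esub>}" "{s. f s \<noteq> \<zero>\<^bsub>R\<^esub>} \<subseteq> S"
    if "f \<in> carrier (free_lmod R S)" for f
    using that by (auto simp: free_lmod_carrier)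
  fix f assume f: "f \<in> carrier (free_lmod R S)"
  show "free_ext R M y f \<in> carrier M"
    unfolding free_ext_def by (rule M.finsum_closed) (use trm supp f in blast)
  {
    fix g assume g: "g \<in> carrier (free_lmod R S)"
    define A where "A = {s. f s \<noteq> \<zero>\<^bsub>R\<^esub>} \<union> {s. g s \<noteq> \<zero>\<^bsub>R\<^esub>}"
    have A: "finite A" "A \<subseteq> S" using supp f g by (auto simp: A_def)
    have "free_ext R M y (f \<oplus>\<^bsub>free_lmod R S\<^esub> g)
        = finsum M (\<lambda>s. (f \<oplus>\<^bsub>free_lmod R S\<^esub> g) s \<odot>\<^bsub>M\<^esub> y s) A"
      by (rule free_ext_eq[where S = S]) (use A y f g FR.M.a_closed[OF f g] in \<open>auto simp: A_def free_lmod_simps\<close>)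
    also have "\<dots> = finsum M (\<lambda>s. f s \<odot>\<^bsub>M\<^esub> y s \<oplus>\<^bsub>M\<^esub> g s \<odot>\<^bsub>M\<^esub> y s) A"
      by (rule M.finsum_cong')
        (use A y f g trm in \<open>auto simp: free_lmod_simps free_lmod_carrier smult_l_distr subset_iff\<close>)
    also have "\<dots> = finsum M (\<lambda>s. f s \<odot>\<^bsub>M\<^esub> y s) A \<oplus>\<^bsub>M\<^esub> finsum M (\<lambda>s. g s \<odot>\<^bsub>M\<^esub> y s) A"
      by (rule M.finsum_addf) (use A trm f g in blast)+
    also have "finsum M (\<lambda>s. f s \<odot>\<^bsub>M\<^esub> y s) A = free_ext R M y f"
      by (rule sym, rule free_ext_eq[where S = S]) (use A y f in \<open>auto simp: A_def\<close>)
    also have "finsum M (\<lambda>s. g s \<odot>\<^bsub>M\<^esub> y s) A = free_ext R M y g"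
      by (rule sym, rule free_ext_eq[where S = S]) (use A y g in \<open>auto simp: A_def\<close>)
    finally show "free_ext R M y (f \<oplus>\<^bsub>free_lmod R S\<^esub> g)
        = free_ext R M y f \<oplus>\<^bsub>M\<^esub> free_ext R M y g" .
  }
  fix a assume a: "a \<in> carrier R"
  have "free_ext R M y (a \<odot>\<^bsub>free_lmod R S\<^esub> f)
      = finsum M (\<lambda>s. (a \<odot>\<^bsub>free_lmod R S\<^esub> f) s \<odot>\<^bsub>M\<^esub> y s) {s. f s \<noteq> \<zero>\<^bsub>R\<^esub>}"
    by (rule free_ext_eq[where S = S])
      (use supp[OF f] y a FR.smult_closed[OF a f] in \<open>auto simp: free_lmod_simps\<close>)
  also have "\<dots> = finsum M (\<lambda>s. a \<odot>\<^bsub>M\<^esub> (f s \<odot>\<^bsub>M\<^esub> y s)) {s. f s \<noteq> \<zero>\<^bsub>R\<^esub>}"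
    by (rule M.finsum_cong')
      (use supp[OF f] y f a trm in \<open>auto simp: free_lmod_simps free_lmod_carrier smult_assoc subset_iff
        intro!: smult_closed\<close>)
  also have "\<dots> = a \<odot>\<^bsub>M\<^esub> free_ext R M y f"
    unfolding free_ext_def
    by (rule sym, rule smult_finsum) (use supp[OF f] trm[OF f] a in auto)
  finally show "free_ext R M y (a \<odot>\<^bsub>free_lmod R S\<^esub> f) = a \<odot>\<^bsub>M\<^esub> free_ext R M y f" .
qed

lemma free_lin_eqI:
  assumes f: "lmod_lin R (free_lmod R S) M f" and g: "lmod_lin R (free_lmod R S) M g"
    and eq: "\<And>s. s \<in> S \<Longrightarrow> f (free_basis R s) = g (free_basis R s)"
    and x: "x \<in> carrier (free_lmod R S)"
  shows "f x = g x"
  using x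
proof (induction x rule: F.free_induct)
  case zero
  have F: "left_module R (free_lmod R S)" by (rule F.free_left_module)
  show ?case
    using lin_zero[OF F left_module_axioms f] lin_zero[OF F left_module_axioms g]
    by (simp add: free_lmod_simps)
next
  case (step h a s)
  interpret FR: left_module R "free_lmod R S" by (rule F.free_left_module)
  note b = F.free_basis_carrier[OF step(2)]
  show ?case
    using step b FR.smult_closed[OF step(3) b] eq
    by (simp add: lin_add[OF f] lin_add[OF g] lin_smult[OF f] lin_smult[OF g])
qed

end

lemma free_lift:
  assumes N: "left_module R N" and L: "left_module R L"
    and \<alpha>: "lmod_lin R (free_lmod R S) L \<alpha>" and \<beta>: "lmod_lin R N L \<beta>"
    and im: "\<alpha> ` carrier (free_lmod R S) \<subseteq> \<beta> ` carrier N"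
  shows "\<exists>\<gamma>. lmod_lin R (free_lmod R S) N \<gamma> \<and> (\<forall>x\<in>carrier (free_lmod R S). \<beta> (\<gamma> x) = \<alpha> x)"
proof -
  interpret N: plain_module R N by (simp add: plain_module_def N)
  interpret L: plain_module R L by (simp add: plain_module_def L)
  have "\<exists>y. y \<in> carrier N \<and> \<beta> y = \<alpha> (free_basis R s)" if "s \<in> S" for s
  proof -
    have "\<alpha> (free_basis R s) \<in> \<beta> ` carrier N"
      by (rule set_mp[OF im imageI[OF N.F.free_basis_carrier[OF that]]])
    then show ?thesis by (elim imageE) auto
  qed
  then obtain y where y: "\<And>s. s \<in> S \<Longrightarrow> y s \<in> carrier N \<and> \<beta> (y s) = \<alpha> (free_basis R s)"
    by metis
  have lin: "lmod_lin R (free_lmod R S) N (free_ext R N y)"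
    by (rule N.free_ext_lin) (use y in blast)
  have "\<beta> (free_ext R N y x) = \<alpha> x" if "x \<in> carrier (free_lmod R S)" for x
    by (rule L.free_lin_eqI[OF lin_comp[OF lin \<beta>] \<alpha> _ that])
      (use y N.free_ext_basis[of _ S y] in auto)
  then show ?thesis using lin by blast
qed

lemma projective_lift:
  assumes Q: "projective_lmod R Q" and N: "left_module R N" and L: "left_module R L"
    and \<alpha>: "lmod_lin R Q L \<alpha>" and \<beta>: "lmod_lin R N L \<beta>"
    and im: "\<alpha> ` carrier Q \<subseteq> \<beta> ` carrier N"
  shows "\<exists>\<gamma>. lmod_lin R Q N \<gamma> \<and> (\<forall>x\<in>carrier Q. \<beta> (\<gamma> x) = \<alpha> x)"
proof -
  obtain S :: "'b set" and f g where f: "lmod_lin R Q (free_lmod R S) f"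
    and g: "lmod_lin R (free_lmod R S) Q g" and gf: "\<forall>x\<in>carrier Q. g (f x) = x"
    using Q unfolding projective_lmod_def by (blast intro: hom_lin)
  have "(\<lambda>x. \<alpha> (g x)) ` carrier (free_lmod R S) \<subseteq> \<beta> ` carrier N"
    using im lin_closed[OF g] by blast
  from free_lift[OF N L lin_comp[OF g \<alpha>] \<beta> this]
  obtain \<gamma> where "lmod_lin R (free_lmod R S) N \<gamma>"
    "\<forall>x\<in>carrier (free_lmod R S). \<beta> (\<gamma> x) = \<alpha> (g x)" by blast
  then show ?thesis
    using lin_comp[OF f] gf lin_closed[OF f] by (intro exI[of _ "\<lambda>x. \<gamma> (f x)"]) auto
qed

section \<open>Comparison with a projective resolution of length two\<close>

text \<open>Let \<open>Q\<^sub>2 \<rightarrow> Q\<^sub>1 \<rightarrow> Q\<^sub>0 \<rightarrow> M \<rightarrow> 0\<close> be exact with free \<open>Q\<^sub>i\<close>, and let \<open>0 \<rightarrow> Q'\<^sub>2 \<rightarrow> Q'\<^sub>1 \<rightarrow> Q'\<^sub>0 \<rightarrow> M \<rightarrow> 0\<close> be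
  exact with projective \<open>Q'\<^sub>i\<close>.  Lifting the identity of \<open>M\<close> both ways gives chain maps \<open>f, g\<close> and a
  homotopy \<open>h\<close> between \<open>g f\<close> and the identity.  On the kernel of \<open>d\<^sub>1\<close> both \<open>f\<^sub>2\<close> and \<open>h\<^sub>1 d\<^sub>1\<close> vanish,
  so \<open>1 - g\<^sub>2 f\<^sub>2 - h\<^sub>1 d\<^sub>1\<close> is a projection of \<open>Q\<^sub>2\<close> onto this kernel.\<close>

lemma second_syzygy_retract:
  fixes R :: "'a ring" and S\<^sub>0 S\<^sub>1 S\<^sub>2 :: "'s set" and M :: "('a, 'm) module"
    and Q\<^sub>0' Q\<^sub>1' Q\<^sub>2' :: "('a, 'q) module"
  defines "Q\<^sub>0 \<equiv> free_lmod R S\<^sub>0" and "Q\<^sub>1 \<equiv> free_lmod R S\<^sub>1" and "Q\<^sub>2 \<equiv> free_lmod R S\<^sub>2"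
  assumes M: "left_module R M"
    and lin: "lmod_lin R Q\<^sub>0 M e" "lmod_lin R Q\<^sub>1 Q\<^sub>0 d\<^sub>0" "lmod_lin R Q\<^sub>2 Q\<^sub>1 d\<^sub>1"
    and ex: "e ` carrier Q\<^sub>0 = carrier M" "d\<^sub>0 ` carrier Q\<^sub>1 = {x \<in> carrier Q\<^sub>0. e x = \<zero>\<^bsub>M\<^esub>}"
      "d\<^sub>1 ` carrier Q\<^sub>2 = {x \<in> carrier Q\<^sub>1. d\<^sub>0 x = \<zero>\<^bsub>Q\<^sub>0\<^esub>}"
    and proj: "projective_lmod R Q\<^sub>0'" "projective_lmod R Q\<^sub>1'" "projective_lmod R Q\<^sub>2'"
    and lin': "lmod_lin R Q\<^sub>0' M e'" "lmod_lin R Q\<^sub>1' Q\<^sub>0' d\<^sub>0'" "lmod_lin R Q\<^sub>2' Q\<^sub>1' d\<^sub>1'"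
    and ex': "e' ` carrier Q\<^sub>0' = carrier M" "d\<^sub>0' ` carrier Q\<^sub>1' = {x \<in> carrier Q\<^sub>0'. e' x = \<zero>\<^bsub>M\<^esub>}"
      "d\<^sub>1' ` carrier Q\<^sub>2' = {x \<in> carrier Q\<^sub>1'. d\<^sub>0' x = \<zero>\<^bsub>Q\<^sub>0'\<^esub>}"
      "{x \<in> carrier Q\<^sub>2'. d\<^sub>1' x = \<zero>\<^bsub>Q\<^sub>1'\<^esub>} = {\<zero>\<^bsub>Q\<^sub>2'\<^esub>}"
  shows "\<exists>\<pi>. lmod_lin R Q\<^sub>2 Q\<^sub>2 \<pi> \<and> (\<forall>x\<in>carrier Q\<^sub>2. d\<^sub>1 (\<pi> x) = \<zero>\<^bsub>Q\<^sub>1\<^esub>) \<and>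
    (\<forall>x\<in>carrier Q\<^sub>2. d\<^sub>1 x = \<zero>\<^bsub>Q\<^sub>1\<^esub> \<longrightarrow> \<pi> x = x)"
proof -
  interpret M: plain_module R M by (simp add: plain_module_def M)
  have Q: "left_module R Q\<^sub>0" "left_module R Q\<^sub>1" "left_module R Q\<^sub>2"
    unfolding Q\<^sub>0_def Q\<^sub>1_def Q\<^sub>2_def by (rule M.F.free_left_module)+
  have Q': "left_module R Q\<^sub>0'" "left_module R Q\<^sub>1'" "left_module R Q\<^sub>2'"
    using proj by (simp_all add: projective_lmod_def)
  interpret Q\<^sub>0: left_module R Q\<^sub>0 by (rule Q)
  interpret Q\<^sub>1: left_module R Q\<^sub>1 by (rule Q)
  interpret Q\<^sub>2: left_module R Q\<^sub>2 by (rule Q)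
  interpret Q\<^sub>0': left_module R Q\<^sub>0' by (rule Q')
  interpret Q\<^sub>1': left_module R Q\<^sub>1' by (rule Q')
  interpret Q\<^sub>2': left_module R Q\<^sub>2' by (rule Q')
  have dd: "e (d\<^sub>0 x) = \<zero>\<^bsub>M\<^esub>" if "x \<in> carrier Q\<^sub>1" for x using ex(2) that by blast
  have dd1: "d\<^sub>0 (d\<^sub>1 x) = \<zero>\<^bsub>Q\<^sub>0\<^esub>" if "x \<in> carrier Q\<^sub>2" for x using ex(3) that by blast
  have dd': "e' (d\<^sub>0' x) = \<zero>\<^bsub>M\<^esub>" if "x \<in> carrier Q\<^sub>1'" for x using ex'(2) that by blast
  have dd1': "d\<^sub>0' (d\<^sub>1' x) = \<zero>\<^bsub>Q\<^sub>0'\<^esub>" if "x \<in> carrier Q\<^sub>2'" for x using ex'(3) that by blast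
  note closed = lin_closed[OF lin(1)] lin_closed[OF lin(2)] lin_closed[OF lin(3)]
    lin_closed[OF lin'(1)] lin_closed[OF lin'(2)] lin_closed[OF lin'(3)]
  \<comment> \<open>the chain map to the projective resolution\<close>
  obtain f\<^sub>0 where f\<^sub>0: "lmod_lin R Q\<^sub>0 Q\<^sub>0' f\<^sub>0" "\<And>x. x \<in> carrier Q\<^sub>0 \<Longrightarrow> e' (f\<^sub>0 x) = e x"
    using free_lift[OF Q'(1) M lin(1)[unfolded Q\<^sub>0_def] lin'(1)] ex(1) ex'(1)
    unfolding Q\<^sub>0_def by blast
  have "(\<lambda>x. f\<^sub>0 (d\<^sub>0 x)) ` carrier Q\<^sub>1 \<subseteq> d\<^sub>0' ` carrier Q\<^sub>1'"
    unfolding ex'(2) using f\<^sub>0 dd closed(2) lin_closed[OF f\<^sub>0(1)] by auto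
  then obtain f\<^sub>1 where f\<^sub>1: "lmod_lin R Q\<^sub>1 Q\<^sub>1' f\<^sub>1"
    "\<And>x. x \<in> carrier Q\<^sub>1 \<Longrightarrow> d\<^sub>0' (f\<^sub>1 x) = f\<^sub>0 (d\<^sub>0 x)"
    using free_lift[OF Q'(2,1) lin_comp[OF lin(2) f\<^sub>0(1), unfolded Q\<^sub>1_def] lin'(2)]
    unfolding Q\<^sub>1_def by blast
  have "(\<lambda>x. f\<^sub>1 (d\<^sub>1 x)) ` carrier Q\<^sub>2 \<subseteq> d\<^sub>1' ` carrier Q\<^sub>2'"
    unfolding ex'(3)
    using f\<^sub>1 dd1 closed(3) lin_closed[OF f\<^sub>1(1)] lin_zero[OF Q(1) Q'(1) f\<^sub>0(1)] by auto
  then obtain f\<^sub>2 where f\<^sub>2: "lmod_lin R Q\<^sub>2 Q\<^sub>2' f\<^sub>2"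
    "\<And>x. x \<in> carrier Q\<^sub>2 \<Longrightarrow> d\<^sub>1' (f\<^sub>2 x) = f\<^sub>1 (d\<^sub>1 x)"
    using free_lift[OF Q'(3,2) lin_comp[OF lin(3) f\<^sub>1(1), unfolded Q\<^sub>2_def] lin'(3)]
    unfolding Q\<^sub>2_def by blast
  \<comment> \<open>the chain map back\<close>
  obtain g\<^sub>0 where g\<^sub>0: "lmod_lin R Q\<^sub>0' Q\<^sub>0 g\<^sub>0" "\<And>x. x \<in> carrier Q\<^sub>0' \<Longrightarrow> e (g\<^sub>0 x) = e' x"
    using projective_lift[OF proj(1) Q(1) M lin'(1) lin(1)] ex(1) ex'(1) by blast
  have "(\<lambda>x. g\<^sub>0 (d\<^sub>0' x)) ` carrier Q\<^sub>1' \<subseteq> d\<^sub>0 ` carrier Q\<^sub>1"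
    unfolding ex(2) using g\<^sub>0 dd' closed(5) lin_closed[OF g\<^sub>0(1)] by auto
  then obtain g\<^sub>1 where g\<^sub>1: "lmod_lin R Q\<^sub>1' Q\<^sub>1 g\<^sub>1"
    "\<And>x. x \<in> carrier Q\<^sub>1' \<Longrightarrow> d\<^sub>0 (g\<^sub>1 x) = g\<^sub>0 (d\<^sub>0' x)"
    using projective_lift[OF proj(2) Q(2,1) lin_comp[OF lin'(2) g\<^sub>0(1)] lin(2)] by blast
  have "(\<lambda>x. g\<^sub>1 (d\<^sub>1' x)) ` carrier Q\<^sub>2' \<subseteq> d\<^sub>1 ` carrier Q\<^sub>2"
    unfolding ex(3)
    using g\<^sub>1 dd1' closed(6) lin_closed[OF g\<^sub>1(1)] lin_zero[OF Q'(1) Q(1) g\<^sub>0(1)] by auto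
  then obtain g\<^sub>2 where g\<^sub>2: "lmod_lin R Q\<^sub>2' Q\<^sub>2 g\<^sub>2"
    "\<And>x. x \<in> carrier Q\<^sub>2' \<Longrightarrow> d\<^sub>1 (g\<^sub>2 x) = g\<^sub>1 (d\<^sub>1' x)"
    using projective_lift[OF proj(3) Q(3,2) lin_comp[OF lin'(3) g\<^sub>1(1)] lin(3)] by blast
  note cl = lin_closed[OF f\<^sub>0(1)] lin_closed[OF f\<^sub>1(1)] lin_closed[OF f\<^sub>2(1)]
    lin_closed[OF g\<^sub>0(1)] lin_closed[OF g\<^sub>1(1)] lin_closed[OF g\<^sub>2(1)]
  \<comment> \<open>the homotopy\<close>
  define k\<^sub>0 where "k\<^sub>0 x = x \<ominus>\<^bsub>Q\<^sub>0\<^esub> g\<^sub>0 (f\<^sub>0 x)" for x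
  have k\<^sub>0: "lmod_lin R Q\<^sub>0 Q\<^sub>0 k\<^sub>0"
    unfolding k\<^sub>0_def by (rule lin_fun_diff[OF Q(1,1) lin_id lin_comp[OF f\<^sub>0(1) g\<^sub>0(1)]])
  have "e (k\<^sub>0 x) = \<zero>\<^bsub>M\<^esub>" if "x \<in> carrier Q\<^sub>0" for x
    using that cl closed(1)
    by (simp add: k\<^sub>0_def lin_diff[OF Q(1) M lin(1)] f\<^sub>0 g\<^sub>0) (simp add: M.M.r_neg a_minus_def)
  then have "k\<^sub>0 ` carrier Q\<^sub>0 \<subseteq> d\<^sub>0 ` carrier Q\<^sub>1"
    unfolding ex(2) using lin_closed[OF k\<^sub>0] by blast
  then obtain h\<^sub>0 where h\<^sub>0: "lmod_lin R Q\<^sub>0 Q\<^sub>1 h\<^sub>0" "\<And>x. x \<in> carrier Q\<^sub>0 \<Longrightarrow> d\<^sub>0 (h\<^sub>0 x) = k\<^sub>0 x"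
    using free_lift[where R = R and S = S\<^sub>0, folded Q\<^sub>0_def, OF Q(2,1) k\<^sub>0 lin(2)] by blast
  define k\<^sub>1 where "k\<^sub>1 x = (x \<ominus>\<^bsub>Q\<^sub>1\<^esub> g\<^sub>1 (f\<^sub>1 x)) \<ominus>\<^bsub>Q\<^sub>1\<^esub> h\<^sub>0 (d\<^sub>0 x)" for x
  have k\<^sub>1: "lmod_lin R Q\<^sub>1 Q\<^sub>1 k\<^sub>1"
    unfolding k\<^sub>1_def
    by (intro lin_fun_diff[OF Q(2,2)] lin_id lin_comp[OF f\<^sub>1(1) g\<^sub>1(1)] lin_comp[OF lin(2) h\<^sub>0(1)])
  have "d\<^sub>0 (k\<^sub>1 x) = \<zero>\<^bsub>Q\<^sub>0\<^esub>" if "x \<in> carrier Q\<^sub>1" for x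
    using that cl closed(2) lin_closed[OF h\<^sub>0(1)]
    by (simp add: k\<^sub>1_def lin_diff[OF Q(2,1) lin(2)] f\<^sub>1 g\<^sub>1 h\<^sub>0 k\<^sub>0_def)
      (simp add: Q\<^sub>0.M.r_neg a_minus_def)
  then have "k\<^sub>1 ` carrier Q\<^sub>1 \<subseteq> d\<^sub>1 ` carrier Q\<^sub>2"
    unfolding ex(3) using lin_closed[OF k\<^sub>1] by blast
  then obtain h\<^sub>1 where h\<^sub>1: "lmod_lin R Q\<^sub>1 Q\<^sub>2 h\<^sub>1" "\<And>x. x \<in> carrier Q\<^sub>1 \<Longrightarrow> d\<^sub>1 (h\<^sub>1 x) = k\<^sub>1 x"
    using free_lift[where R = R and S = S\<^sub>1, folded Q\<^sub>1_def, OF Q(3,2) k\<^sub>1 lin(3)] by blast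
  define \<pi> where "\<pi> x = (x \<ominus>\<^bsub>Q\<^sub>2\<^esub> g\<^sub>2 (f\<^sub>2 x)) \<ominus>\<^bsub>Q\<^sub>2\<^esub> h\<^sub>1 (d\<^sub>1 x)" for x
  have \<pi>: "lmod_lin R Q\<^sub>2 Q\<^sub>2 \<pi>"
    unfolding \<pi>_def
    by (intro lin_fun_diff[OF Q(3,3)] lin_id lin_comp[OF f\<^sub>2(1) g\<^sub>2(1)] lin_comp[OF lin(3) h\<^sub>1(1)])
  have "d\<^sub>1 (\<pi> x) = \<zero>\<^bsub>Q\<^sub>1\<^esub>" if x: "x \<in> carrier Q\<^sub>2" for x
  proof -
    have "d\<^sub>1 (\<pi> x) = (d\<^sub>1 x \<ominus>\<^bsub>Q\<^sub>1\<^esub> g\<^sub>1 (f\<^sub>1 (d\<^sub>1 x))) \<ominus>\<^bsub>Q\<^sub>1\<^esub> k\<^sub>1 (d\<^sub>1 x)"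
      using x cl closed lin_closed[OF h\<^sub>1(1)]
      by (simp add: \<pi>_def lin_diff[OF Q(3,2) lin(3)] f\<^sub>2 g\<^sub>2 h\<^sub>1)
    also have "k\<^sub>1 (d\<^sub>1 x) = d\<^sub>1 x \<ominus>\<^bsub>Q\<^sub>1\<^esub> g\<^sub>1 (f\<^sub>1 (d\<^sub>1 x))"
      using x cl closed
      by (simp add: k\<^sub>1_def dd1 lin_zero[OF Q(1,2) h\<^sub>0(1)] a_minus_def)
    finally show ?thesis
      using x cl closed by (simp add: a_minus_def Q\<^sub>1.M.r_neg)
  qed
  moreover have "\<pi> x = x" if x: "x \<in> carrier Q\<^sub>2" and "d\<^sub>1 x = \<zero>\<^bsub>Q\<^sub>1\<^esub>" for x
  proof -
    have "d\<^sub>1' (f\<^sub>2 x) = \<zero>\<^bsub>Q\<^sub>1'\<^esub>"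
      using that by (simp add: f\<^sub>2 lin_zero[OF Q(2) Q'(2) f\<^sub>1(1)])
    then have "f\<^sub>2 x = \<zero>\<^bsub>Q\<^sub>2'\<^esub>" using ex'(4) cl(3)[OF x] by blast
    moreover have "\<ominus>\<^bsub>Q\<^sub>2\<^esub> \<zero>\<^bsub>Q\<^sub>2\<^esub> = \<zero>\<^bsub>Q\<^sub>2\<^esub>" by (rule Q\<^sub>2.M.minus_equality) simp_all
    ultimately have "\<pi> x = x \<oplus>\<^bsub>Q\<^sub>2\<^esub> \<zero>\<^bsub>Q\<^sub>2\<^esub> \<oplus>\<^bsub>Q\<^sub>2\<^esub> \<zero>\<^bsub>Q\<^sub>2\<^esub>"
      using that(2) unfolding \<pi>_def a_minus_def
      by (simp only: lin_zero[OF Q'(3) Q(3) g\<^sub>2(1)] lin_zero[OF Q(2,3) h\<^sub>1(1)])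
    then show ?thesis using x by simp
  qed
  ultimately show ?thesis using \<pi> by blast
qed

section \<open>Graded free resolutions\<close>

text \<open>A ring graded by \<open>G\<close> with component maps \<open>cmp\<close>, spanned over the
  scalars \<open>C\<close> of degree zero by the sequence of homogeneous elements \<open>b j\<close>.\<close>

locale graded_ring = plain_ring R for R :: "'a ring" (structure) +
  fixes G :: "nat \<Rightarrow> 'a set" and cmp :: "nat \<Rightarrow> 'a \<Rightarrow> 'a"
    and C :: "'a set" and b :: "nat \<Rightarrow> 'a" and \<beta> :: "nat \<Rightarrow> nat"
  assumes G_carrier: "G n \<subseteq> carrier R"
    and G_zero: "\<zero> \<in> G n"
    and G_add: "x \<in> G n \<Longrightarrow> y \<in> G n \<Longrightarrow> x \<oplus> y \<in> G n"
    and G_mult: "x \<in> G i \<Longrightarrow> y \<in> G j \<Longrightarrow> x \<otimes> y \<in> G (i + j)"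
    and cmp_closed: "x \<in> carrier R \<Longrightarrow> cmp n x \<in> G n"
    and cmp_add: "x \<in> carrier R \<Longrightarrow> y \<in> carrier R \<Longrightarrow> cmp n (x \<oplus> y) = cmp n x \<oplus> cmp n y"
    and cmp_hom: "x \<in> G j \<Longrightarrow> cmp n x = (if n = j then x else \<zero>)"
    and cmp_finite: "x \<in> carrier R \<Longrightarrow> finite {n. cmp n x \<noteq> \<zero>}"
    and cmp_sep: "x \<in> carrier R \<Longrightarrow> (\<And>n. cmp n x = \<zero>) \<Longrightarrow> x = \<zero>"
    and C_G: "C \<subseteq> G 0"
    and C_add: "c \<in> C \<Longrightarrow> c' \<in> C \<Longrightarrow> c \<oplus> c' \<in> C"
    and C_uminus: "c \<in> C \<Longrightarrow> \<ominus> c \<in> C"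
    and C_mult: "c \<in> C \<Longrightarrow> c' \<in> C \<Longrightarrow> c \<otimes> c' \<in> C"
    and C_inverse: "c \<in> C \<Longrightarrow> c \<noteq> \<zero> \<Longrightarrow> \<exists>c'\<in>C. c' \<otimes> c = \<one> \<and> c \<otimes> c' = \<one>"
    and b_G: "b j \<in> G (\<beta> j)"
    and G_induct: "\<And>Q. x \<in> G n \<Longrightarrow> Q \<zero> \<Longrightarrow>
      (\<And>x c j. x \<in> G n \<Longrightarrow> Q x \<Longrightarrow> c \<in> C \<Longrightarrow> \<beta> j = n \<Longrightarrow> Q (x \<oplus> c \<otimes> b j)) \<Longrightarrow> Q x"
begin

lemma G_carrierD: "x \<in> G n \<Longrightarrow> x \<in> carrier R"
  using G_carrier by blast

lemma C_carrier: "c \<in> C \<Longrightarrow> c \<in> carrier R"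
  using C_G G_carrier by blast

lemma b_carrier: "b j \<in> carrier R"
  using b_G G_carrier by blast

subsection \<open>Homogeneous elements of a graded free module\<close>

abbreviation F :: "'s set \<Rightarrow> ('a, 's \<Rightarrow> 'a) module"
  where "F S \<equiv> free_lmod R S"

abbreviation FG :: "'s set \<Rightarrow> ('s \<Rightarrow> nat) \<Rightarrow> nat \<Rightarrow> ('s \<Rightarrow> 'a) set"
  where "FG S \<delta> n \<equiv> free_comp R G S \<delta> n"

definition fcmp :: "'s set \<Rightarrow> ('s \<Rightarrow> nat) \<Rightarrow> nat \<Rightarrow> ('s \<Rightarrow> 'a) \<Rightarrow> ('s \<Rightarrow> 'a)"
  where "fcmp S \<delta> n f = (\<lambda>s. if s \<in> S \<and> \<delta> s \<le> n then cmp (n - \<delta> s) (f s) else \<zero>)"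

definition graded_sub :: "'s set \<Rightarrow> ('s \<Rightarrow> nat) \<Rightarrow> ('s \<Rightarrow> 'a) set \<Rightarrow> bool"
  where "graded_sub S \<delta> Z \<longleftrightarrow> Z \<subseteq> carrier (F S) \<and> \<zero>\<^bsub>F S\<^esub> \<in> Z \<and>
    (\<forall>x\<in>Z. \<forall>y\<in>Z. x \<oplus>\<^bsub>F S\<^esub> y \<in> Z) \<and>
    (\<forall>a\<in>carrier R. \<forall>x\<in>Z. a \<odot>\<^bsub>F S\<^esub> x \<in> Z) \<and>
    (\<forall>n. \<forall>x\<in>Z. fcmp S \<delta> n x \<in> Z)"

lemma FG_carrier: "FG S \<delta> n \<subseteq> carrier (F S)"
  by (auto simp: free_comp_def)

lemma FG_carrierD: "f \<in> FG S \<delta> n \<Longrightarrow> f \<in> carrier (F S)"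
  by (simp add: free_comp_def)

lemma cmp_zero: "cmp n \<zero> = \<zero>"
  using cmp_hom[OF G_zero, of n n] by simp

lemma FG_zero: "\<zero>\<^bsub>F S\<^esub> \<in> FG S \<delta> n"
proof -
  interpret F: left_module R "F S" by (rule free_left_module)
  show ?thesis using F.M.zero_closed by (auto simp: free_comp_def free_lmod_simps G_zero)
qed

lemma FG_add:
  assumes "x \<in> FG S \<delta> n" "y \<in> FG S \<delta> n"
  shows "x \<oplus>\<^bsub>F S\<^esub> y \<in> FG S \<delta> n"
proof -
  interpret F: left_module R "F S" by (rule free_left_module)
  have "x \<oplus>\<^bsub>F S\<^esub> y \<in> carrier (F S)"
    using assms FG_carrier by (intro F.M.a_closed) auto
  then show ?thesis
    using assms by (auto simp: free_comp_def free_lmod_simps intro: G_add)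
qed

lemma FG_smult:
  assumes "a \<in> G i" "x \<in> FG S \<delta> n"
  shows "a \<odot>\<^bsub>F S\<^esub> x \<in> FG S \<delta> (i + n)"
proof -
  interpret F: left_module R "F S" by (rule free_left_module)
  have a: "a \<in> carrier R" using assms(1) G_carrier by blast
  have "a \<odot>\<^bsub>F S\<^esub> x \<in> carrier (F S)"
    using assms FG_carrier a by (intro F.smult_closed) auto
  moreover have "a \<otimes> x s \<in> G (i + n - \<delta> s)" if "s \<in> S" "\<delta> s \<le> i + n" for s
  proof (cases "\<delta> s \<le> n")
    case True
    then show ?thesis
      using assms that G_mult[of a i "x s" "n - \<delta> s"] by (simp add: free_comp_def)
  next
    case False
    then show ?thesis using assms that a by (simp add: free_comp_def G_zero)
  qed
  moreover have "a \<otimes> x s = \<zero>" if "s \<in> S" "\<not> \<delta> s \<le> i + n" for s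
    using assms that a by (simp add: free_comp_def)
  ultimately show ?thesis
    by (simp add: free_comp_def free_lmod_simps)
qed

lemma fcmp_FG:
  assumes "f \<in> carrier (F S)"
  shows "fcmp S \<delta> n f \<in> FG S \<delta> n"
proof -
  have "finite {s. fcmp S \<delta> n f s \<noteq> \<zero>}"
    by (rule finite_subset[of _ "{s. f s \<noteq> \<zero>}"])
      (use assms in \<open>auto simp: fcmp_def free_lmod_carrier cmp_zero\<close>)
  then show ?thesis
    using assms cmp_closed G_carrierD[OF cmp_closed]
    by (auto simp: free_comp_def free_lmod_carrier fcmp_def)
qed

lemma fcmp_add:
  assumes "f \<in> carrier (F S)" "g \<in> carrier (F S)"
  shows "fcmp S \<delta> n (f \<oplus>\<^bsub>F S\<^esub> g) = fcmp S \<delta> n f \<oplus>\<^bsub>F S\<^esub> fcmp S \<delta> n g"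
  using assms by (auto simp: fcmp_def free_lmod_simps free_lmod_carrier cmp_add)

lemma fcmp_hom:
  assumes "f \<in> FG S \<delta> j"
  shows "fcmp S \<delta> n f = (if n = j then f else \<zero>\<^bsub>F S\<^esub>)"
proof (rule ext)
  fix s
  have f: "f \<in> carrier (F S)" and
    fs: "s \<in> S \<Longrightarrow> if \<delta> s \<le> j then f s \<in> G (j - \<delta> s) else f s = \<zero>"
    using assms by (auto simp: free_comp_def)
  show "fcmp S \<delta> n f s = (if n = j then f else \<zero>\<^bsub>F S\<^esub>) s"
  proof (cases "s \<in> S")
    case True
    then show ?thesis
      using fs by (cases "\<delta> s \<le> j") (auto simp: fcmp_def free_lmod_simps cmp_zero cmp_hom)
  next
    case False
    then show ?thesis using f by (simp add: fcmp_def free_lmod_simps free_lmod_carrier)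
  qed
qed

lemma fcmp_zero: "fcmp S \<delta> n \<zero>\<^bsub>F S\<^esub> = \<zero>\<^bsub>F S\<^esub>"
  by (simp add: fcmp_def free_lmod_simps cmp_zero fun_eq_iff)

lemma fcmp_finite:
  assumes "f \<in> carrier (F S)"
  shows "finite {n. fcmp S \<delta> n f \<noteq> \<zero>\<^bsub>F S\<^esub>}"
proof (rule finite_subset)
  show "{n. fcmp S \<delta> n f \<noteq> \<zero>\<^bsub>F S\<^esub>}
      \<subseteq> (\<Union>s\<in>{s. f s \<noteq> \<zero>}. (\<lambda>j. \<delta> s + j) ` {j. cmp j (f s) \<noteq> \<zero>})"
  proof
    fix n assume "n \<in> {n. fcmp S \<delta> n f \<noteq> \<zero>\<^bsub>F S\<^esub>}"
    then obtain s where "fcmp S \<delta> n f s \<noteq> \<zero>" by (auto simp: free_lmod_simps)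
    then have s: "\<delta> s \<le> n" "cmp (n - \<delta> s) (f s) \<noteq> \<zero>"
      by (auto simp: fcmp_def split: if_splits)
    then have "f s \<noteq> \<zero>" using cmp_zero by auto
    moreover have "n \<in> (\<lambda>j. \<delta> s + j) ` {j. cmp j (f s) \<noteq> \<zero>}"
      using s by (intro image_eqI[of _ _ "n - \<delta> s"]) auto
    ultimately show "n \<in> (\<Union>s\<in>{s. f s \<noteq> \<zero>}. (\<lambda>j. \<delta> s + j) ` {j. cmp j (f s) \<noteq> \<zero>})"
      by blast
  qed
  show "finite (\<Union>s\<in>{s. f s \<noteq> \<zero>}. (\<lambda>j. \<delta> s + j) ` {j. cmp j (f s) \<noteq> \<zero>})"
    using assms by (auto simp: free_lmod_carrier cmp_finite)
qed

lemma fcmp_sep: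
  assumes f: "f \<in> carrier (F S)" and zero: "\<And>n. fcmp S \<delta> n f = \<zero>\<^bsub>F S\<^esub>"
  shows "f = \<zero>\<^bsub>F S\<^esub>"
proof (rule ext)
  fix s
  show "f s = \<zero>\<^bsub>F S\<^esub> s"
  proof (cases "s \<in> S")
    case True
    have "cmp n (f s) = \<zero>" for n
      using fun_cong[OF zero[of "\<delta> s + n"], of s] True by (simp add: fcmp_def free_lmod_simps)
    then show ?thesis using f cmp_sep[of "f s"] by (simp add: free_lmod_simps free_lmod_carrier)
  next
    case False
    then show ?thesis using f by (simp add: free_lmod_simps free_lmod_carrier)
  qed
qed

text \<open>Every element of a graded submodule is a sum of homogeneous elements of that submodule.\<close>

lemma graded_sub_induct:
  assumes Z: "graded_sub S \<delta> Z" and x: "x \<in> Z"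
    and zero: "Q \<zero>\<^bsub>F S\<^esub>"
    and step: "\<And>x h n. x \<in> Z \<Longrightarrow> Q x \<Longrightarrow> h \<in> Z \<Longrightarrow> h \<in> FG S \<delta> n \<Longrightarrow> Q (x \<oplus>\<^bsub>F S\<^esub> h)"
  shows "Q x"
proof -
  interpret F: left_module R "F S" by (rule free_left_module)
  have ZF: "y \<in> carrier (F S)" if "y \<in> Z" for y
    using Z that by (auto simp: graded_sub_def)
  have neg: "\<ominus>\<^bsub>F S\<^esub> y \<in> Z" if "y \<in> Z" for y
  proof -
    have "(\<ominus> \<one>) \<odot>\<^bsub>F S\<^esub> y \<in> Z" using Z that by (simp add: graded_sub_def)
    then show ?thesis using ZF[OF that] by (simp add: F.smult_l_minus F.smult_one)
  qed
  have "finite A \<Longrightarrow> x \<in> Z \<Longrightarrow> {n. fcmp S \<delta> n x \<noteq> \<zero>\<^bsub>F S\<^esub>} \<subseteq> A \<Longrightarrow> Q x" for A x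
  proof (induction A arbitrary: x rule: finite_induct)
    case empty
    then have "fcmp S \<delta> n x = \<zero>\<^bsub>F S\<^esub>" for n by blast
    then have "x = \<zero>\<^bsub>F S\<^esub>" by (rule fcmp_sep[OF ZF[OF empty(1)]])
    then show ?case using zero by simp
  next
    case (insert n A)
    define h where "h = fcmp S \<delta> n x"
    have h: "h \<in> Z" "h \<in> FG S \<delta> n"
      using Z insert.prems(1) fcmp_FG[OF ZF[OF insert.prems(1)]] by (auto simp: graded_sub_def h_def)
    define y where "y = x \<oplus>\<^bsub>F S\<^esub> (\<ominus>\<^bsub>F S\<^esub> h)"
    have y: "y \<in> Z" using Z insert.prems(1) neg[OF h(1)] by (simp add: graded_sub_def y_def)
    have xy: "x = y \<oplus>\<^bsub>F S\<^esub> h"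
      using ZF insert.prems(1) h(1) by (simp add: y_def F.M.a_assoc F.M.l_neg)
    have cx: "fcmp S \<delta> j x = fcmp S \<delta> j y \<oplus>\<^bsub>F S\<^esub> (if j = n then h else \<zero>\<^bsub>F S\<^esub>)" for j
      unfolding xy using fcmp_add[OF ZF[OF y] ZF[OF h(1)]] fcmp_hom[OF h(2)] by simp
    have cy: "fcmp S \<delta> j y \<in> carrier (F S)" for j
      using fcmp_FG[OF ZF[OF y]] FG_carrier by blast
    have "fcmp S \<delta> n y = \<zero>\<^bsub>F S\<^esub>"
      using cx[of n] cy[of n] ZF[OF h(1)] by (simp add: h_def[symmetric] F.M.add.r_cancel_one')
    moreover have "fcmp S \<delta> j y = fcmp S \<delta> j x" if "j \<noteq> n" for j
      using cx[of j] cy[of j] that by simp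
    ultimately have "{j. fcmp S \<delta> j y \<noteq> \<zero>\<^bsub>F S\<^esub>} \<subseteq> A"
      using insert.prems(2) by force
    then have "Q y" by (rule insert.IH[OF y])
    then show ?case unfolding xy by (rule step[OF y _ h])
  qed
  then show ?thesis using fcmp_finite[OF ZF[OF x]] x by blast
qed

lemma free_graded_sub: "graded_sub S \<delta> (carrier (F S))"
proof -
  interpret F: left_module R "F S" by (rule free_left_module)
  show ?thesis
    using FG_carrierD[OF fcmp_FG] by (auto simp: graded_sub_def F.smult_closed)
qed

text \<open>Graded maps commute with the projections to the components.\<close>

lemma graded_hom_kernel:
  assumes d: "d \<in> graded_hom R 0 (F S') (FG S' \<delta>') (F S) (FG S \<delta>)"
  shows "graded_sub S' \<delta>' {x \<in> carrier (F S'). d x = \<zero>\<^bsub>F S\<^esub>}"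
proof -
  interpret F: left_module R "F S" by (rule free_left_module)
  interpret F': left_module R "F S'" by (rule free_left_module)
  have lin: "lmod_lin R (F S') (F S) d"
    using d by (auto simp: graded_hom_def intro: hom_lin)
  have hom: "d h \<in> FG S \<delta> n" if "h \<in> FG S' \<delta>' n" for h n
    using d that by (simp add: graded_hom_def)
  note d0 = lin_zero[OF F'.left_module_axioms F.left_module_axioms lin]
  have comm: "d (fcmp S' \<delta>' n x) = fcmp S \<delta> n (d x)" if "x \<in> carrier (F S')" for n x
    using free_graded_sub that
  proof (rule graded_sub_induct[where \<delta> = \<delta>'])
    show "d (fcmp S' \<delta>' n \<zero>\<^bsub>F S'\<^esub>) = fcmp S \<delta> n (d \<zero>\<^bsub>F S'\<^esub>)"
      by (simp add: d0 fcmp_zero)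
  next
    fix x h j
    assume x: "x \<in> carrier (F S')" "d (fcmp S' \<delta>' n x) = fcmp S \<delta> n (d x)"
      and h: "h \<in> carrier (F S')" "h \<in> FG S' \<delta>' j"
    have 1: "fcmp S' \<delta>' n x \<in> carrier (F S')" "fcmp S' \<delta>' n h \<in> carrier (F S')"
      using FG_carrierD[OF fcmp_FG] x h by blast+
    have 2: "d (fcmp S' \<delta>' n h) = fcmp S \<delta> n (d h)"
      using fcmp_hom[OF h(2)] fcmp_hom[OF hom[OF h(2)]] d0 by simp
    show "d (fcmp S' \<delta>' n (x \<oplus>\<^bsub>F S'\<^esub> h)) = fcmp S \<delta> n (d (x \<oplus>\<^bsub>F S'\<^esub> h))"
      by (simp add: fcmp_add x h lin_add[OF lin] 1 2 lin_closed[OF lin])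
  qed
  show ?thesis
    unfolding graded_sub_def
    using FG_carrierD[OF fcmp_FG] F.smult_r_null
    by (auto simp: comm lin_add[OF lin] lin_smult[OF lin] d0 F'.smult_closed fcmp_zero)
qed

lemma free_ext_graded:
  assumes y: "\<And>s. s \<in> S' \<Longrightarrow> y s \<in> FG S \<delta> (\<delta>' s)"
  shows "restrict (free_ext R (F S) y) (carrier (F S'))
    \<in> graded_hom R 0 (F S') (FG S' \<delta>') (F S) (FG S \<delta>)"
proof -
  interpret F: plain_module R "F S" by (simp add: plain_module_def free_left_module)
  have yF: "y s \<in> carrier (F S)" if "s \<in> S'" for s
    using y[OF that] FG_carrier by blast
  have "free_ext R (F S) y x \<in> FG S \<delta> n" if x: "x \<in> FG S' \<delta>' n" for x n
  proof -
    have xc: "x \<in> carrier (F S')" using x FG_carrier by blast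
    have trm: "x s \<odot>\<^bsub>F S\<^esub> y s \<in> FG S \<delta> n" if "s \<in> S'" for s
    proof (cases "\<delta>' s \<le> n")
      case True
      then have "x s \<in> G (n - \<delta>' s)" using x that by (simp add: free_comp_def)
      from FG_smult[OF this y[OF that]] show ?thesis using True by simp
    next
      case False
      then have "x s = \<zero>" using x that by (simp add: free_comp_def)
      then show ?thesis using F.smult_l_null[OF yF[OF that]] by (simp add: FG_zero)
    qed
    have "finite A \<Longrightarrow> A \<subseteq> S' \<Longrightarrow>
        finsum (F S) (\<lambda>s. x s \<odot>\<^bsub>F S\<^esub> y s) A \<in> FG S \<delta> n" for A
    proof (induction A rule: finite_induct)
      case empty
      show ?case using FG_zero by simp
    next
      case (insert s A)
      have "(\<lambda>s. x s \<odot>\<^bsub>F S\<^esub> y s) \<in> A \<rightarrow> carrier (F S)"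
        "x s \<odot>\<^bsub>F S\<^esub> y s \<in> carrier (F S)"
        using trm insert.prems FG_carrier by blast+
      then show ?case
        using insert trm by (simp add: F.M.finsum_insert FG_add)
    qed
    then show ?thesis
      unfolding free_ext_def using xc by (auto simp: free_lmod_carrier)
  qed
  moreover have "restrict (free_ext R (F S) y) (carrier (F S'))
      \<in> lmod_hom R (F S') (F S)"
    by (rule lin_restrict_hom[OF free_left_module F.free_ext_lin]) (rule yF)
  ultimately show ?thesis
    by (auto simp: graded_hom_def dest: FG_carrierD)
qed

subsection \<open>Covering a graded submodule\<close>

text \<open>The elements \<open>b j\<close> times a basis element, enumerated by pairing, span the free module on a set
  of natural numbers.  \<open>reach S \<delta> n N\<close> is the span of those of degree \<open>n\<close> with index below \<open>N\<close>.\<close>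

definition E :: "nat \<Rightarrow> nat \<Rightarrow> 'a"
  where "E N = (\<lambda>t. if t = fst (prod_decode N) then b (snd (prod_decode N)) else \<zero>)"

definition E_deg :: "(nat \<Rightarrow> nat) \<Rightarrow> nat \<Rightarrow> nat"
  where "E_deg \<delta> N = \<delta> (fst (prod_decode N)) + \<beta> (snd (prod_decode N))"

primrec reach :: "nat set \<Rightarrow> (nat \<Rightarrow> nat) \<Rightarrow> nat \<Rightarrow> nat \<Rightarrow> (nat \<Rightarrow> 'a) set" where
  "reach S \<delta> n 0 = {\<zero>\<^bsub>F S\<^esub>}"
| "reach S \<delta> n (Suc N) = reach S \<delta> n N \<union>
    (if fst (prod_decode N) \<in> S \<and> E_deg \<delta> N = n
     then {x \<oplus>\<^bsub>F S\<^esub> c \<odot>\<^bsub>F S\<^esub> E N |x c. x \<in> reach S \<delta> n N \<and> c \<in> C} else {})"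

lemma E_FG:
  assumes "fst (prod_decode N) \<in> S"
  shows "E N \<in> FG S \<delta> (E_deg \<delta> N)"
  using assms b_G b_carrier
  by (auto simp: free_comp_def free_lmod_carrier E_def E_deg_def G_zero
      intro: finite_subset[of _ "{fst (prod_decode N)}"])

lemma reach_FG: "reach S \<delta> n N \<subseteq> FG S \<delta> n"
proof (induction N)
  case (Suc N)
  have "x \<oplus>\<^bsub>F S\<^esub> c \<odot>\<^bsub>F S\<^esub> E N \<in> FG S \<delta> n"
    if "x \<in> reach S \<delta> n N" "c \<in> C" "fst (prod_decode N) \<in> S" "E_deg \<delta> N = n" for x c
    using that Suc FG_smult[of c 0 "E N" S \<delta> n] E_FG[of N S \<delta>] C_G by (intro FG_add) auto
  then show ?case using Suc by auto
qed (use FG_zero in auto)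

lemma reach_SucI: "fst (prod_decode N) \<in> S \<Longrightarrow> E_deg \<delta> N = n \<Longrightarrow> x \<in> reach S \<delta> n N \<Longrightarrow> c \<in> C \<Longrightarrow>
    x \<oplus>\<^bsub>F S\<^esub> c \<odot>\<^bsub>F S\<^esub> E N \<in> reach S \<delta> n (Suc N)"
  by auto

lemma reach_mono: "N \<le> N' \<Longrightarrow> reach S \<delta> n N \<subseteq> reach S \<delta> n N'"
  by (induction N' rule: nat_induct) (auto simp: le_Suc_eq)

lemma reach_carrier: "x \<in> reach S \<delta> n N \<Longrightarrow> x \<in> carrier (F S)"
  using reach_FG FG_carrier by blast

lemma E_carrier: "fst (prod_decode N) \<in> S \<Longrightarrow> E N \<in> carrier (F S)"
  using E_FG[of N S "\<lambda>_. 0"] FG_carrier by blast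

lemma reach_add: "x \<in> reach S \<delta> n N \<Longrightarrow> y \<in> reach S \<delta> n N \<Longrightarrow> x \<oplus>\<^bsub>F S\<^esub> y \<in> reach S \<delta> n N"
proof (induction N arbitrary: x y)
  case 0
  interpret F: left_module R "F S" by (rule free_left_module)
  show ?case using 0 by simp
next
  case (Suc N)
  interpret F: left_module R "F S" by (rule free_left_module)
  show ?case
  proof (cases "fst (prod_decode N) \<in> S \<and> E_deg \<delta> N = n")
    case False
    then have "reach S \<delta> n (Suc N) = reach S \<delta> n N" by auto
    then show ?thesis using Suc by blast
  next
    case True
    note EF = E_carrier[OF conjunct1[OF True]]
    have sc: "c \<odot>\<^bsub>F S\<^esub> E N \<in> carrier (F S)" if "c \<in> C" for c
      using EF C_carrier[OF that] by (rule F.smult_closed[rotated])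
    consider "x \<in> reach S \<delta> n N" "y \<in> reach S \<delta> n N"
      | y' c where "x \<in> reach S \<delta> n N" "y' \<in> reach S \<delta> n N" "c \<in> C"
          "y = y' \<oplus>\<^bsub>F S\<^esub> c \<odot>\<^bsub>F S\<^esub> E N"
      | x' c where "y \<in> reach S \<delta> n N" "x' \<in> reach S \<delta> n N" "c \<in> C"
          "x = x' \<oplus>\<^bsub>F S\<^esub> c \<odot>\<^bsub>F S\<^esub> E N"
      | x' c y' c' where "x' \<in> reach S \<delta> n N" "c \<in> C" "y' \<in> reach S \<delta> n N" "c' \<in> C"
          "x = x' \<oplus>\<^bsub>F S\<^esub> c \<odot>\<^bsub>F S\<^esub> E N"
          "y = y' \<oplus>\<^bsub>F S\<^esub> c' \<odot>\<^bsub>F S\<^esub> E N"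
      using Suc.prems True by auto
    then show ?thesis
    proof cases
      case 1
      then show ?thesis using Suc.IH by simp
    next
      case 2
      then have "x \<oplus>\<^bsub>F S\<^esub> y = (x \<oplus>\<^bsub>F S\<^esub> y') \<oplus>\<^bsub>F S\<^esub> c \<odot>\<^bsub>F S\<^esub> E N"
        using reach_carrier sc by (simp add: F.M.a_assoc)
      then show ?thesis using 2 True Suc.IH by auto
    next
      case 3
      then have "x \<oplus>\<^bsub>F S\<^esub> y = (x' \<oplus>\<^bsub>F S\<^esub> y) \<oplus>\<^bsub>F S\<^esub> c \<odot>\<^bsub>F S\<^esub> E N"
        using reach_carrier sc by (simp add: F.M.a_ac)
      then show ?thesis using 3 True Suc.IH by auto
    next
      case 4
      then have "x \<oplus>\<^bsub>F S\<^esub> y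
          = (x' \<oplus>\<^bsub>F S\<^esub> y') \<oplus>\<^bsub>F S\<^esub> (c \<oplus> c') \<odot>\<^bsub>F S\<^esub> E N"
        using reach_carrier sc EF C_carrier by (simp add: F.M.a_ac F.smult_l_distr)
      then show ?thesis
        using reach_SucI[of N S \<delta> n "x' \<oplus>\<^bsub>F S\<^esub> y'" "c \<oplus> c'"] 4 True Suc.IH C_add
        by simp
    qed
  qed
qed

lemma reach_smult: "x \<in> reach S \<delta> n N \<Longrightarrow> c \<in> C \<Longrightarrow> c \<odot>\<^bsub>F S\<^esub> x \<in> reach S \<delta> n N"
proof (induction N arbitrary: x)
  case 0
  interpret F: left_module R "F S" by (rule free_left_module)
  show ?case using 0 C_carrier by (simp add: F.smult_r_null)
next
  case (Suc N)
  interpret F: left_module R "F S" by (rule free_left_module)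
  show ?case
  proof (cases "x \<in> reach S \<delta> n N")
    case True
    then show ?thesis using Suc by simp
  next
    case False
    then obtain y c' where y: "fst (prod_decode N) \<in> S" "E_deg \<delta> N = n" "y \<in> reach S \<delta> n N" "c' \<in> C"
      "x = y \<oplus>\<^bsub>F S\<^esub> c' \<odot>\<^bsub>F S\<^esub> E N"
      using Suc.prems by (auto split: if_splits)
    note EF = E_carrier[OF y(1)]
    have "c \<odot>\<^bsub>F S\<^esub> x = c \<odot>\<^bsub>F S\<^esub> y \<oplus>\<^bsub>F S\<^esub> (c \<otimes> c') \<odot>\<^bsub>F S\<^esub> E N"
      using y EF Suc.prems(2) C_carrier reach_carrier[OF y(3)]
      by (simp add: F.smult_r_distr F.smult_closed F.smult_assoc)
    moreover have "c \<odot>\<^bsub>F S\<^esub> y \<in> reach S \<delta> n N" "c \<otimes> c' \<in> C"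
      using Suc.IH[OF y(3) Suc.prems(2)] C_mult[OF Suc.prems(2) y(4)] by auto
    ultimately show ?thesis
      using reach_SucI[OF y(1,2), of "c \<odot>\<^bsub>F S\<^esub> y" "c \<otimes> c'"] by simp
  qed
qed

lemma reach_single:
  assumes s: "s \<in> S" and x: "x \<in> G n"
  shows "\<exists>N. (\<lambda>t. if t = s then x else \<zero>) \<in> reach S \<delta> (\<delta> s + n) N"
  using x
proof (rule G_induct)
  show "\<exists>N. (\<lambda>t. if t = s then \<zero> else \<zero>) \<in> reach S \<delta> (\<delta> s + n) N"
    by (rule exI[of _ 0]) (simp add: free_lmod_simps)
next
  fix x c j
  assume x: "x \<in> G n" "\<exists>N. (\<lambda>t. if t = s then x else \<zero>) \<in> reach S \<delta> (\<delta> s + n) N"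
    and c: "c \<in> C" and j: "\<beta> j = n"
  interpret F: left_module R "F S" by (rule free_left_module)
  from x(2) obtain N where N: "(\<lambda>t. if t = s then x else \<zero>) \<in> reach S \<delta> (\<delta> s + n) N" by blast
  define M where "M = prod_encode (s, j)"
  have M: "fst (prod_decode M) \<in> S" "E_deg \<delta> M = \<delta> s + n"
    using s j by (simp_all add: M_def E_deg_def)
  have "\<zero>\<^bsub>F S\<^esub> \<in> reach S \<delta> (\<delta> s + n) M"
    using reach_mono[of 0 M S \<delta> "\<delta> s + n"] by auto
  then have "\<zero>\<^bsub>F S\<^esub> \<oplus>\<^bsub>F S\<^esub> c \<odot>\<^bsub>F S\<^esub> E M \<in> reach S \<delta> (\<delta> s + n) (Suc M)"
    using M c by auto
  then have cE: "c \<odot>\<^bsub>F S\<^esub> E M \<in> reach S \<delta> (\<delta> s + n) (Suc M)"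
    using F.smult_closed[OF C_carrier[OF c] E_carrier[OF M(1)]] by simp
  have "(\<lambda>t. if t = s then x else \<zero>) \<oplus>\<^bsub>F S\<^esub> c \<odot>\<^bsub>F S\<^esub> E M
      \<in> reach S \<delta> (\<delta> s + n) (max N (Suc M))"
    using N cE reach_mono[of N "max N (Suc M)" S \<delta> "\<delta> s + n"]
      reach_mono[of "Suc M" "max N (Suc M)" S \<delta> "\<delta> s + n"]
    by (intro reach_add) auto
  moreover have "(\<lambda>t. if t = s then x else \<zero>) \<oplus>\<^bsub>F S\<^esub> c \<odot>\<^bsub>F S\<^esub> E M
      = (\<lambda>t. if t = s then x \<oplus> c \<otimes> b j else \<zero>)"
    using C_carrier[OF c] by (auto simp: free_lmod_simps E_def M_def)
  ultimately show "\<exists>N. (\<lambda>t. if t = s then x \<oplus> c \<otimes> b j else \<zero>) \<in> reach S \<delta> (\<delta> s + n) N"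
    by auto
qed

lemma FG_reach:
  assumes "f \<in> FG S \<delta> n"
  shows "\<exists>N. f \<in> reach S \<delta> n N"
proof -
  have "finite A \<Longrightarrow> f \<in> FG S \<delta> n \<Longrightarrow> {s. f s \<noteq> \<zero>} \<subseteq> A \<Longrightarrow> \<exists>N. f \<in> reach S \<delta> n N" for A f
  proof (induction A arbitrary: f rule: finite_induct)
    case empty
    then have "f = \<zero>\<^bsub>F S\<^esub>" by (auto simp: free_lmod_simps)
    then show ?case by (intro exI[of _ 0]) simp
  next
    case (insert s A)
    have fc: "f \<in> carrier (F S)" using insert.prems(1) FG_carrier by blast
    show ?case
    proof (cases "f s = \<zero>")
      case True
      then show ?thesis using insert by (intro insert.IH) auto
    next
      case False
      then have s: "s \<in> S" using fc by (auto simp: free_lmod_carrier)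
      then have sn: "\<delta> s \<le> n" "f s \<in> G (n - \<delta> s)"
        using False insert.prems(1) by (auto simp: free_comp_def split: if_splits)
      define g where "g = f(s := \<zero>)"
      have "finite {t. g t \<noteq> \<zero>}"
        by (rule finite_subset[of _ "{t. f t \<noteq> \<zero>}"])
          (use fc in \<open>auto simp: free_lmod_carrier g_def\<close>)
      moreover have "g t \<in> carrier R" "t \<notin> S \<Longrightarrow> g t = \<zero>"
        "t \<in> S \<Longrightarrow> if \<delta> t \<le> n then g t \<in> G (n - \<delta> t) else g t = \<zero>" for t
        using insert.prems(1) by (auto simp: free_comp_def free_lmod_carrier G_zero g_def)
      ultimately have "g \<in> FG S \<delta> n"
        by (simp add: free_comp_def free_lmod_carrier)
      moreover have "{t. g t \<noteq> \<zero>} \<subseteq> A" using insert.prems(2) by (auto simp: g_def)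
      ultimately obtain N where N: "g \<in> reach S \<delta> n N"
        using insert.IH[of g] by blast
      obtain M where M: "(\<lambda>t. if t = s then f s else \<zero>) \<in> reach S \<delta> n M"
        using reach_single[OF s sn(2), of \<delta>] sn(1) by auto
      have "g \<oplus>\<^bsub>F S\<^esub> (\<lambda>t. if t = s then f s else \<zero>) \<in> reach S \<delta> n (max N M)"
        using N M reach_mono[of N "max N M" S \<delta> n] reach_mono[of M "max N M" S \<delta> n]
        by (intro reach_add) auto
      moreover have "g \<oplus>\<^bsub>F S\<^esub> (\<lambda>t. if t = s then f s else \<zero>) = f"
        using fc by (auto simp: g_def free_lmod_simps free_lmod_carrier)
      ultimately show ?thesis by auto
    qed
  qed
  moreover have "finite {s. f s \<noteq> \<zero>}" using assms by (auto simp: free_comp_def free_lmod_carrier)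
  ultimately show ?thesis using assms by blast
qed

text \<open>For each \<open>N\<close> one element of \<open>Z\<close> with leading term \<open>E N\<close> is chosen, if there is any.  Repeated
  subtraction of leading terms shows that these homogeneous elements generate \<open>Z\<close>.  They are
  indexed by natural numbers, as the bases in \<^const>\<open>graded_free_resolution\<close> have to be,
  whatever the size of \<open>C\<close>.\<close>

lemma graded_cover:
  fixes S :: "nat set"
  assumes Z: "graded_sub S \<delta> Z"
  shows "\<exists>(S' :: nat set) \<delta>' d. d \<in> graded_hom R 0 (F S') (FG S' \<delta>') (F S) (FG S \<delta>) \<and>
    d ` carrier (F S') = Z"
proof -
  let ?F = "F S"
  interpret F: plain_module R ?F by (simp add: plain_module_def free_left_module)
  have ZF: "y \<in> carrier ?F" if "y \<in> Z" for y using Z that by (auto simp: graded_sub_def)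
  have Zadd: "x \<oplus>\<^bsub>?F\<^esub> y \<in> Z" if "x \<in> Z" "y \<in> Z" for x y using Z that by (simp add: graded_sub_def)
  have Zsm: "a \<odot>\<^bsub>?F\<^esub> x \<in> Z" if "x \<in> Z" "a \<in> carrier R" for a x
    using Z that by (simp add: graded_sub_def)
  define S' where "S' = {N. fst (prod_decode N) \<in> S \<and>
    (\<exists>x\<in>reach S \<delta> (E_deg \<delta> N) N. x \<oplus>\<^bsub>?F\<^esub> E N \<in> Z)}"
  have "\<exists>x\<in>reach S \<delta> (E_deg \<delta> N) N. x \<oplus>\<^bsub>?F\<^esub> E N \<in> Z" if "N \<in> S'" for N
    using that by (simp add: S'_def)
  then obtain w where w: "\<And>N. N \<in> S' \<Longrightarrow> w N \<in> reach S \<delta> (E_deg \<delta> N) N"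
    "\<And>N. N \<in> S' \<Longrightarrow> w N \<oplus>\<^bsub>?F\<^esub> E N \<in> Z"
    by metis
  define y where "y N = w N \<oplus>\<^bsub>?F\<^esub> E N" for N
  have y: "y N \<in> FG S \<delta> (E_deg \<delta> N)" "y N \<in> Z" if "N \<in> S'" for N
    using w[OF that] reach_FG[THEN subsetD] E_FG that by (auto simp: y_def S'_def intro!: FG_add)
  have yF: "y N \<in> carrier ?F" if "N \<in> S'" for N using ZF y(2)[OF that] by blast
  define d where "d = restrict (free_ext R ?F y) (carrier (F S'))"
  have d: "d \<in> graded_hom R 0 (F S') (FG S' (E_deg \<delta>)) ?F (FG S \<delta>)"
    unfolding d_def by (rule free_ext_graded) (rule y(1))
  have lin: "lmod_lin R (F S') ?F d"
    using d by (auto simp: graded_hom_def intro: hom_lin)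
  interpret F': left_module R "F S'" by (rule free_left_module)
  have d_basis: "d (free_basis R N) = y N" if "N \<in> S'" for N
    using free_basis_carrier[OF that] F.free_ext_basis[OF that yF] by (simp add: d_def)
  have "d x \<in> Z" if "x \<in> carrier (F S')" for x
    using that
  proof (induction x rule: free_induct)
    case zero
    have "d \<zero>\<^bsub>F S'\<^esub> = \<zero>\<^bsub>?F\<^esub>"
      by (rule lin_zero[OF F'.left_module_axioms F.left_module_axioms lin])
    then show ?case using Z by (simp add: graded_sub_def free_lmod_simps)
  next
    case (step f a s)
    note bs = free_basis_carrier[OF step(2)]
    show ?case
      using step bs F'.smult_closed[OF step(3) bs]
      by (simp add: lin_add[OF lin] lin_smult[OF lin] d_basis Zadd Zsm y(2))
  qed
  moreover have "z \<in> d ` carrier (F S')" if "z \<in> Z" for z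
  proof -
    let ?D = "d ` carrier (F S')"
    have Dadd: "u \<oplus>\<^bsub>?F\<^esub> v \<in> ?D" if "u \<in> ?D" "v \<in> ?D" for u v
    proof -
      from that obtain u' v' where "u = d u'" "v = d v'" "u' \<in> carrier (F S')"
        "v' \<in> carrier (F S')" by blast
      then show ?thesis
        by (intro image_eqI[of _ _ "u' \<oplus>\<^bsub>F S'\<^esub> v'"]) (auto simp: lin_add[OF lin])
    qed
    have D0: "\<zero>\<^bsub>?F\<^esub> \<in> ?D"
      using lin_zero[OF F'.left_module_axioms F.left_module_axioms lin]
      by (metis F'.M.zero_closed image_eqI)
    have Dy: "c \<odot>\<^bsub>?F\<^esub> y N \<in> ?D" if "N \<in> S'" "c \<in> carrier R" for N c
      using that free_basis_carrier[OF that(1)] d_basis[OF that(1)]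
      by (intro image_eqI[of _ _ "c \<odot>\<^bsub>F S'\<^esub> free_basis R N"])
        (auto simp: lin_smult[OF lin] F'.smult_closed)
    have homog: "z \<in> Z \<Longrightarrow> z \<in> reach S \<delta> n N \<Longrightarrow> z \<in> ?D" for z n N
    proof (induction N arbitrary: z)
      case 0
      then show ?case using D0 by simp
    next
      case (Suc N)
      show ?case
      proof (cases "z \<in> reach S \<delta> n N")
        case True
        then show ?thesis using Suc by simp
      next
        case False
        then obtain x c where x: "fst (prod_decode N) \<in> S" "E_deg \<delta> N = n" "x \<in> reach S \<delta> n N"
          "c \<in> C" "z = x \<oplus>\<^bsub>?F\<^esub> c \<odot>\<^bsub>?F\<^esub> E N"
          using Suc.prems by (auto split: if_splits)
        note EF = E_carrier[OF x(1)] and xF = reach_carrier[OF x(3)] and cR = C_carrier[OF x(4)]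
        have "c \<noteq> \<zero>"
        proof
          assume "c = \<zero>"
          then have "z = x" using x EF xF by (simp add: F.smult_l_null)
          then show False using False x(3) by simp
        qed
        then obtain c' where c': "c' \<in> C" "c' \<otimes> c = \<one>" "c \<otimes> c' = \<one>" using C_inverse x(4) by blast
        have c'R: "c' \<in> carrier R" using C_carrier c' by blast
        have "c' \<odot>\<^bsub>?F\<^esub> z = c' \<odot>\<^bsub>?F\<^esub> x \<oplus>\<^bsub>?F\<^esub> E N"
          using x(5) EF xF cR c'R c'(2)
          by (simp add: F.smult_r_distr F.smult_closed F.smult_one flip: F.smult_assoc)
        then have "c' \<odot>\<^bsub>?F\<^esub> x \<oplus>\<^bsub>?F\<^esub> E N \<in> Z" using Zsm[OF Suc.prems(1) c'R] by simp
        then have N: "N \<in> S'"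
          using x reach_smult[OF x(3) c'(1)] by (auto simp: S'_def)
        have wF: "w N \<in> carrier ?F" using reach_carrier w(1)[OF N] by blast
        note nc = C_uminus[OF x(4)]
        \<comment> \<open>subtracting \<open>c y\<^sub>N\<close> cancels the leading term \<open>c E\<^sub>N\<close> of \<open>z\<close>\<close>
        define x' where "x' = x \<oplus>\<^bsub>?F\<^esub> (\<ominus> c) \<odot>\<^bsub>?F\<^esub> w N"
        have x': "x' \<in> reach S \<delta> n N"
          unfolding x'_def using reach_add[OF x(3) reach_smult[OF _ nc]] w(1)[OF N] x(2) by simp
        have zx: "z = x' \<oplus>\<^bsub>?F\<^esub> c \<odot>\<^bsub>?F\<^esub> y N"
        proof -
          have "x' \<oplus>\<^bsub>?F\<^esub> c \<odot>\<^bsub>?F\<^esub> y N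
              = x \<oplus>\<^bsub>?F\<^esub> ((\<ominus> c) \<odot>\<^bsub>?F\<^esub> w N \<oplus>\<^bsub>?F\<^esub> c \<odot>\<^bsub>?F\<^esub> w N) \<oplus>\<^bsub>?F\<^esub> c \<odot>\<^bsub>?F\<^esub> E N"
            using xF wF EF cR
            by (simp add: x'_def y_def F.smult_r_distr F.smult_closed F.M.a_assoc)
          also have "(\<ominus> c) \<odot>\<^bsub>?F\<^esub> w N \<oplus>\<^bsub>?F\<^esub> c \<odot>\<^bsub>?F\<^esub> w N = \<zero>\<^bsub>?F\<^esub>"
            using wF cR by (simp add: l_neg F.smult_l_null flip: F.smult_l_distr)
          finally show ?thesis using xF x(5) by simp
        qed
        have x'F: "x' \<in> carrier ?F" using reach_carrier x' by blast
        have "x' = z \<oplus>\<^bsub>?F\<^esub> (\<ominus> c) \<odot>\<^bsub>?F\<^esub> y N"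
        proof -
          have "z \<oplus>\<^bsub>?F\<^esub> (\<ominus> c) \<odot>\<^bsub>?F\<^esub> y N = x' \<oplus>\<^bsub>?F\<^esub> (c \<odot>\<^bsub>?F\<^esub> y N \<oplus>\<^bsub>?F\<^esub> (\<ominus> c) \<odot>\<^bsub>?F\<^esub> y N)"
            unfolding zx using x'F yF[OF N] cR by (simp add: F.M.a_assoc F.smult_closed)
          also have "c \<odot>\<^bsub>?F\<^esub> y N \<oplus>\<^bsub>?F\<^esub> (\<ominus> c) \<odot>\<^bsub>?F\<^esub> y N = \<zero>\<^bsub>?F\<^esub>"
            using yF[OF N] cR by (simp add: r_neg F.smult_l_null flip: F.smult_l_distr)
          finally show ?thesis using x'F by simp
        qed
        then have "x' \<in> Z" using Zadd[OF Suc.prems(1) Zsm[OF y(2)[OF N]]] cR by simp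
        then have "x' \<in> ?D" by (rule Suc.IH[OF _ x'])
        then show ?thesis unfolding zx using Dadd Dy[OF N cR] by blast
      qed
    qed
    show ?thesis
    proof (rule graded_sub_induct[where Q = "\<lambda>z. z \<in> ?D", OF Z that D0])
      fix x h n assume "x \<in> ?D" "h \<in> Z" "h \<in> FG S \<delta> n"
      then obtain N where "h \<in> reach S \<delta> n N" using FG_reach by blast
      then have "h \<in> ?D" by (rule homog[OF \<open>h \<in> Z\<close>])
      with \<open>x \<in> ?D\<close> show "x \<oplus>\<^bsub>?F\<^esub> h \<in> ?D" by (rule Dadd)
    qed
  qed
  ultimately have "d ` carrier (F S') = Z" by blast
  then show ?thesis using d by blast
qed

text \<open>Covering one kernel after the other.\<close>

lemma graded_resolution_extend:
  fixes S\<^sub>0 S\<^sub>1 :: "nat set"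
  assumes "d\<^sub>0 \<in> graded_hom R 0 (F S\<^sub>1) (FG S\<^sub>1 \<delta>\<^sub>1) (F S\<^sub>0) (FG S\<^sub>0 \<delta>\<^sub>0)"
  obtains S \<delta> d where "S 0 = S\<^sub>0" "S 1 = S\<^sub>1" "\<delta> 0 = \<delta>\<^sub>0" "\<delta> 1 = \<delta>\<^sub>1" "d 0 = d\<^sub>0"
    "\<And>i. d i \<in> graded_hom R 0 (F (S (Suc i))) (FG (S (Suc i)) (\<delta> (Suc i)))
        (F (S i)) (FG (S i) (\<delta> i))"
    "\<And>i. d (Suc i) ` carrier (F (S (Suc (Suc i))))
      = {x \<in> carrier (F (S (Suc i))). d i x = \<zero>\<^bsub>F (S i)\<^esub>}"
proof -
  define ok where "ok = (\<lambda>(S :: nat set, \<delta> :: nat \<Rightarrow> nat, S' :: nat set, \<delta>' :: nat \<Rightarrow> nat, d).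
    d \<in> graded_hom R 0 (F S') (FG S' \<delta>') (F S) (FG S \<delta>))"
  define nxt where "nxt = (\<lambda>(S :: nat set, \<delta> :: nat \<Rightarrow> nat, S' :: nat set, \<delta>' :: nat \<Rightarrow> nat, d)
      (S\<^sub>2, \<delta>\<^sub>2, S\<^sub>3 :: nat set, \<delta>\<^sub>3 :: nat \<Rightarrow> nat, d').
    S\<^sub>2 = S' \<and> \<delta>\<^sub>2 = \<delta>' \<and>
    d' ` carrier (F S\<^sub>3) = {x \<in> carrier (F S'). d x = \<zero>\<^bsub>F S\<^esub>})"
  define init where "init = (S\<^sub>0, \<delta>\<^sub>0, S\<^sub>1, \<delta>\<^sub>1, d\<^sub>0)"
  have "\<exists>f. \<forall>n. (ok (f n) \<and> (n = 0 \<longrightarrow> f n = init)) \<and> nxt (f n) (f (Suc n))"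
  proof (rule dependent_nat_choice)
    show "\<exists>x. ok x \<and> (0 = 0 \<longrightarrow> x = init)"
      using assms by (auto simp: ok_def init_def)
  next
    fix x and n :: nat
    assume "ok x \<and> (n = 0 \<longrightarrow> x = init)"
    moreover obtain S \<delta> S' \<delta>' d where x: "x = (S, \<delta>, S', \<delta>', d)" by (cases x)
    ultimately have "d \<in> graded_hom R 0 (F S') (FG S' \<delta>') (F S) (FG S \<delta>)"
      by (simp add: ok_def)
    from graded_cover[OF graded_hom_kernel[OF this]]
    obtain S'' :: "nat set" and \<delta>'' d' where
      "d' \<in> graded_hom R 0 (F S'') (FG S'' \<delta>'') (F S') (FG S' \<delta>')"
      "d' ` carrier (F S'') = {x \<in> carrier (F S'). d x = \<zero>\<^bsub>F S\<^esub>}"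
      by blast
    then show "\<exists>y. (ok y \<and> (Suc n = 0 \<longrightarrow> y = init)) \<and> nxt x y"
      unfolding x by (intro exI[of _ "(S', \<delta>', S'', \<delta>'', d')"]) (simp add: ok_def nxt_def)
  qed
  then obtain f where f: "\<And>n. ok (f n)" "f 0 = init" "\<And>n. nxt (f n) (f (Suc n))" by blast
  define S where "S i = fst (f i)" for i
  define \<delta> where "\<delta> i = fst (snd (f i))" for i
  define d where "d i = snd (snd (snd (snd (f i))))" for i
  have f_Suc: "f i = (S i, \<delta> i, S (Suc i), \<delta> (Suc i), d i)" for i
    using f(3)[of i] unfolding nxt_def S_def \<delta>_def d_def
    by (cases "f i"; cases "f (Suc i)") auto
  show ?thesis
  proof (rule that[of S \<delta> d])
    show "S 0 = S\<^sub>0" "S 1 = S\<^sub>1" "\<delta> 0 = \<delta>\<^sub>0" "\<delta> 1 = \<delta>\<^sub>1" "d 0 = d\<^sub>0"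
      using f(2) f_Suc[of 0] by (simp_all add: init_def One_nat_def)
  qed (use f(1,3) in \<open>simp_all add: f_Suc ok_def nxt_def\<close>)
qed

end

section \<open>The trivial module\<close>

lemma quot_left_module:
  fixes R :: "'a ring" and J :: "'a set"
  assumes J: "ideal J R"
  shows "left_module R (quot_lmod R J)"
proof -
  interpret J: ideal J R by fact
  interpret Q: ring "R Quot J" by (rule J.quotient_is_ring)
  have h: "(+>\<^bsub>R\<^esub>) J \<in> ring_hom R (R Quot J)" by (rule J.rcos_ring_hom)
  have hc: "J +>\<^bsub>R\<^esub> a \<in> carrier (R Quot J)" if "a \<in> carrier R" for a
    using ring_hom_closed[OF h that] .
  have "abelian_group (quot_lmod R J)"
  proof (rule abelian_groupI)
    fix x assume "x \<in> carrier (quot_lmod R J)"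
    then show "\<exists>y\<in>carrier (quot_lmod R J). y \<oplus>\<^bsub>quot_lmod R J\<^esub> x = \<zero>\<^bsub>quot_lmod R J\<^esub>"
      by (intro bexI[of _ "\<ominus>\<^bsub>R Quot J\<^esub> x"]) (auto simp: quot_lmod_def Q.l_neg)
  qed (auto simp: quot_lmod_def Q.a_ac)
  moreover have "ring R" by unfold_locales
  ultimately show ?thesis
    unfolding left_module_def left_module_axioms_def
    using hc ring_hom_add[OF h] ring_hom_mult[OF h] ring_hom_one[OF h]
    by (auto simp: quot_lmod_def Q.l_distr Q.r_distr Q.m_assoc)
qed

lemma lookup_Nil_mult: "Poly_Mapping.lookup (f * g) [] = Poly_Mapping.lookup f [] * Poly_Mapping.lookup g []"
  for f g :: "('x, 'k::field) free_alg"
proof (induction f rule: fa_induct)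
  case (monomial u a)
  show ?case
    by (induction g rule: fa_induct)
      (auto simp: distrib_left lookup_add algebra_simps single_mult_single lookup_single when_def)
qed (auto simp: distrib_right lookup_add)

lemma lookup_const: "Poly_Mapping.lookup (fa_const c) [] = c"
  by (simp add: fa_const_def)

lemma lookup_Nil_mult_var: "Poly_Mapping.lookup (f * fa_var x) [] = 0"
  by (simp add: lookup_Nil_mult fa_var_def lookup_single)

lemma fa_quot_carrierI [simp]: "fa_proj P f \<in> carrier (fa_quot P)"
  by (simp add: fa_quot_carrier)

lemma fa_proj_uminus: "\<ominus>\<^bsub>fa_quot P\<^esub> fa_proj P f = fa_proj P (- f)"
proof -
  interpret Q: ring "fa_quot P" by (rule fa_quot_ring)
  show ?thesis
    by (rule Q.minus_equality) (simp_all add: fa_proj_add fa_proj_zero)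
qed

lemma fa_proj_diff: "fa_proj P f \<ominus>\<^bsub>fa_quot P\<^esub> fa_proj P g = fa_proj P (f - g)"
  by (simp add: a_minus_def fa_proj_uminus fa_proj_add)

definition lft :: "('x, 'k::field) free_alg set \<Rightarrow> ('x, 'k) free_alg"
  where "lft X = (SOME t. t \<in> X)"

lemma fa_proj_lft_mem: "t \<in> fa_proj P f \<Longrightarrow> fa_proj P t = fa_proj P f"
  by (subst (asm) fa_proj_image) (auto simp: fa_proj_eq_iff)

lemma fa_proj_self: "f \<in> fa_proj P f"
  unfolding fa_proj_image by (rule image_eqI[of _ _ 0]) simp_all

lemma lft_mem: "X \<in> carrier (fa_quot P) \<Longrightarrow> lft X \<in> X"
  unfolding lft_def fa_quot_carrier by (auto intro: someI[where P = "\<lambda>t. t \<in> _", OF fa_proj_self])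

lemma proj_lft: "X \<in> carrier (fa_quot P) \<Longrightarrow> fa_proj P (lft X) = X"
  using lft_mem[of X P] fa_proj_lft_mem[of "lft X" P] by (auto simp: fa_quot_carrier)

lemma lft_proj: "lft (fa_proj P f) - f \<in> fa_ideal P"
  using proj_lft[of "fa_proj P f" P] by (simp add: fa_proj_eq_iff)

context graded_relations
begin

abbreviation A :: "('x, 'k) free_alg set ring"
  where "A \<equiv> fa_quot (r ` {1..m})"

abbreviation pr :: "('x, 'k) free_alg \<Rightarrow> ('x, 'k) free_alg set"
  where "pr \<equiv> fa_proj (r ` {1..m})"

abbreviation K :: "(('x, 'k) free_alg set, ('x, 'k) free_alg set set) module"
  where "K \<equiv> triv_mod (r ` {1..m})"

lemma pr_zero_iff: "pr f = \<zero>\<^bsub>A\<^esub> \<longleftrightarrow> f \<in> I"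
  by (simp add: fa_proj_zero fa_proj_eq_iff)

lemma pr_aug_iff: "pr f \<in> aug_ideal (r ` {1..m}) \<longleftrightarrow> Poly_Mapping.lookup f [] = 0"
proof -
  have mem: "g \<in> {f. \<forall>w\<in>Poly_Mapping.keys f. 1 \<le> length w} \<longleftrightarrow> Poly_Mapping.lookup g [] = 0"
    for g :: "('x, 'k) free_alg"
  proof
    assume "g \<in> {f. \<forall>w\<in>Poly_Mapping.keys f. 1 \<le> length w}"
    then have "[] \<notin> Poly_Mapping.keys g" by auto
    then show "Poly_Mapping.lookup g [] = 0" by (simp add: in_keys_iff)
  next
    assume "Poly_Mapping.lookup g [] = 0"
    then have "w \<noteq> []" if "w \<in> Poly_Mapping.keys g" for w using that by (auto simp: in_keys_iff)
    then show "g \<in> {f. \<forall>w\<in>Poly_Mapping.keys f. 1 \<le> length w}" by (simp add: Suc_le_eq One_nat_def)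
  qed
  show ?thesis
  proof
    assume "pr f \<in> aug_ideal (r ` {1..m})"
    then obtain g where "Poly_Mapping.lookup g [] = 0" "pr f = pr g"
      unfolding aug_ideal_def using mem by auto
    then show "Poly_Mapping.lookup f [] = 0"
      using I_lookup_Nil[of "f - g"] by (simp add: fa_proj_eq_iff lookup_minus)
  next
    assume "Poly_Mapping.lookup f [] = 0"
    then show "pr f \<in> aug_ideal (r ` {1..m})" unfolding aug_ideal_def using mem by blast
  qed
qed

lemma aug_elem:
  assumes "X \<in> aug_ideal (r ` {1..m})"
  obtains f where "X = pr f" "Poly_Mapping.lookup f [] = 0"
proof -
  obtain f where "X = pr f" using assms unfolding aug_ideal_def by blast
  then show ?thesis using that pr_aug_iff assms by blast
qed

lemma aug_ideal: "ideal (aug_ideal (r ` {1..m})) A"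
proof -
  interpret A: ring A by (rule fa_quot_ring)
  show ?thesis
  proof (rule idealI)
    show "ring A" by (rule fa_quot_ring)
    show "subgroup (aug_ideal (r ` {1..m})) (add_monoid A)"
    proof (rule A.add.subgroupI)
      show "aug_ideal (r ` {1..m}) \<subseteq> carrier A" by (auto elim: aug_elem)
      show "aug_ideal (r ` {1..m}) \<noteq> {}" using pr_aug_iff[of 0] by auto
    next
      fix X Y assume X: "X \<in> aug_ideal (r ` {1..m})" and Y: "Y \<in> aug_ideal (r ` {1..m})"
      show "\<ominus>\<^bsub>A\<^esub> X \<in> aug_ideal (r ` {1..m})"
        using X by (elim aug_elem) (simp add: fa_proj_uminus pr_aug_iff)
      show "X \<oplus>\<^bsub>A\<^esub> Y \<in> aug_ideal (r ` {1..m})"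
        using X Y by (elim aug_elem) (simp add: fa_proj_add pr_aug_iff lookup_add)
    qed
  next
    fix X Y assume X: "X \<in> aug_ideal (r ` {1..m})" and "Y \<in> carrier A"
    then obtain f g where "X = pr f" "Poly_Mapping.lookup f [] = 0" "Y = pr g"
      by (auto simp: fa_quot_carrier elim: aug_elem)
    then show "Y \<otimes>\<^bsub>A\<^esub> X \<in> aug_ideal (r ` {1..m})" "X \<otimes>\<^bsub>A\<^esub> Y \<in> aug_ideal (r ` {1..m})"
      by (simp_all add: fa_proj_mult pr_aug_iff lookup_Nil_mult)
  qed
qed

lemma K_left_module: "left_module A K"
  unfolding triv_mod_def by (rule quot_left_module[OF aug_ideal])

text \<open>The class of \<open>f\<close> in \<open>K = A/A\<^sub>+\<close>; it is determined by the constant coefficient of \<open>f\<close>.\<close>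

definition tr :: "('x, 'k) free_alg \<Rightarrow> ('x, 'k) free_alg set set"
  where "tr f = aug_ideal (r ` {1..m}) +>\<^bsub>A\<^esub> pr f"

lemma tr_eq_iff: "tr f = tr g \<longleftrightarrow> Poly_Mapping.lookup f [] = Poly_Mapping.lookup g []"
proof -
  interpret A: ring A by (rule fa_quot_ring)
  show ?thesis
    unfolding tr_def
    using A.quotient_eq_iff_same_a_r_cos[OF aug_ideal, of "pr f" "pr g"]
    by (simp add: fa_proj_diff pr_aug_iff lookup_minus)
qed

lemma tr_hom: "(+>\<^bsub>A\<^esub>) (aug_ideal (r ` {1..m})) \<in> ring_hom A (A Quot aug_ideal (r ` {1..m}))"
  by (rule ideal.rcos_ring_hom[OF aug_ideal])

lemma K_carrier: "carrier K = range tr"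
  by (auto simp: triv_mod_def quot_lmod_def FactRing_def A_RCOSETS_def' tr_def fa_quot_carrier)

lemma K_add: "tr f \<oplus>\<^bsub>K\<^esub> tr g = tr (f + g)"
  using ring_hom_add[OF tr_hom, of "pr f" "pr g"]
  by (simp add: triv_mod_def quot_lmod_def tr_def fa_proj_add)

lemma K_smult: "pr f \<odot>\<^bsub>K\<^esub> tr g = tr (f * g)"
  using ring_hom_mult[OF tr_hom, of "pr f" "pr g"]
  by (simp add: triv_mod_def quot_lmod_def tr_def fa_proj_mult)

lemma K_zero: "\<zero>\<^bsub>K\<^esub> = tr 0"
proof -
  interpret K: left_module A K by (rule K_left_module)
  have "tr 0 \<oplus>\<^bsub>K\<^esub> tr 0 = tr 0" by (simp add: K_add)
  then show ?thesis by (simp add: K.M.add.r_cancel_one' K_carrier)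
qed

lemma tr_zero_iff: "tr f = \<zero>\<^bsub>K\<^esub> \<longleftrightarrow> Poly_Mapping.lookup f [] = 0"
  by (simp add: K_zero tr_eq_iff)

section \<open>The algebra as a graded ring\<close>

text \<open>The words span \<open>A\<close> over \<open>K\<close>, and over a finite alphabet they can be enumerated.\<close>

sublocale A: graded_ring A "quot_comp (r ` {1..m})" "\<lambda>n X. pr (fa_part n (lft X))"
  "range (\<lambda>c. pr (fa_const c))" "\<lambda>j. pr (fa_word (from_nat j))" "\<lambda>j. length (from_nat j :: 'x list)"
proof -
  interpret A: ring A by (rule fa_quot_ring)
  have comp: "X \<in> quot_comp (r ` {1..m}) n \<longleftrightarrow> (\<exists>f\<in>fa_comp n. X = pr f)" for X n
    by (auto simp: quot_comp_def)
  have car: "X \<in> carrier A \<longleftrightarrow> (\<exists>f. X = pr f)" for X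
    by (auto simp: fa_quot_carrier)
  have cmp: "pr (fa_part n (lft (pr f))) = pr (fa_part n f)" for n f
    using I_part[OF lft_proj[of _ f]] by (simp add: fa_proj_eq_iff part_diff)
  show "graded_ring A (quot_comp (r ` {1..m})) (\<lambda>n X. pr (fa_part n (lft X)))
    (range (\<lambda>c. pr (fa_const c))) (\<lambda>j. pr (fa_word (from_nat j))) (\<lambda>j. length (from_nat j :: 'x list))"
  proof (unfold_locales, goal_cases)
    case (1 n) then show ?case by (auto simp: comp)
  next
    case (2 n)
    show ?case unfolding comp fa_proj_zero
      by (rule bexI[of _ 0]) (simp_all add: fa.subspace_0[OF subspace_comp])
  next
    case (3 x n y)
    then show ?case unfolding comp
      by (auto simp: fa_proj_add intro: fa.subspace_add[OF subspace_comp])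
  next
    case (4 x i y j)
    then show ?case unfolding comp by (auto simp: fa_proj_mult intro: comp_mult)
  next
    case (5 x n)
    then show ?case unfolding comp by (intro bexI[of _ "fa_part n (lft x)"]) auto
  next
    case (6 x y n)
    then obtain f g where xy: "x = pr f" "y = pr g" by (auto simp: car)
    have "pr (fa_part n (lft (x \<oplus>\<^bsub>A\<^esub> y))) = pr (fa_part n f) \<oplus>\<^bsub>A\<^esub> pr (fa_part n g)"
      by (simp only: xy fa_proj_add cmp part_add)
    then show ?case by (simp only: xy cmp)
  next
    case (7 x j n)
    then show ?case by (auto simp: comp cmp part_comp fa_proj_zero)
  next
    case (8 x)
    then obtain f where f: "x = pr f" by (auto simp: car)
    obtain k where "f \<in> fa_filt k" using exists_filt by blast
    then have "{n. pr (fa_part n (lft x)) \<noteq> \<zero>\<^bsub>A\<^esub>} \<subseteq> {..k}"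
      using part_filt_above[of f k] unfolding f cmp fa_proj_zero
      by (metis (mono_tags, lifting) atMost_iff mem_Collect_eq not_le subsetI)
    then show ?case by (rule finite_subset) simp
  next
    case (9 x)
    then obtain f where f: "x = pr f" by (auto simp: car)
    have "fa_part n f \<in> I" for n using 9(2)[of n] by (simp add: f cmp pr_zero_iff)
    moreover obtain k where "f \<in> fa_filt k" using exists_filt by blast
    ultimately have "f \<in> I" using sum_parts[of f k] fa_ideal_sum by metis
    then show ?case by (simp add: f pr_zero_iff)
  next
    case 10
    show ?case unfolding quot_comp_def using fa_const_comp by blast
  next
    case (11 c c')
    then show ?case by (auto simp: fa_proj_add simp flip: fa_const_add)
  next
    case (12 c)
    then obtain k where "c = pr (fa_const k)" by blast
    moreover have "- fa_const k = (fa_const (- k) :: ('x, 'k) free_alg)" by (simp add: fa_const_def single_uminus)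
    ultimately have "\<ominus>\<^bsub>A\<^esub> c = pr (fa_const (- k))" by (simp add: fa_proj_uminus)
    then show ?case by blast
  next
    case (13 c c')
    then show ?case by (auto simp: fa_proj_mult simp flip: fa_const_mult)
  next
    case (14 c)
    then obtain k where k: "c = pr (fa_const k)" by blast
    then have "k \<noteq> 0" using 14 by (auto simp: fa_const_zero fa_proj_zero)
    then show ?case
      by (intro bexI[of _ "pr (fa_const (inverse k))"])
        (auto simp: k fa_proj_mult fa_proj_one fa_const_one simp flip: fa_const_mult)
  next
    case (15 j)
    show ?case unfolding quot_comp_def by (rule imageI) (simp add: single_in_comp)
  next
    case (16 x n Q)
    then obtain f where f: "f \<in> fa_comp n" "x = pr f" by (auto simp: comp)
    have "finite W \<Longrightarrow> W \<subseteq> Poly_Mapping.keys f \<Longrightarrow>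
        Q (pr (\<Sum>w\<in>W. Poly_Mapping.single w (Poly_Mapping.lookup f w)))" for W
    proof (induction W rule: finite_induct)
      case empty
      show ?case using 16(2) by (simp add: fa_proj_zero)
    next
      case (insert w W)
      let ?g = "\<Sum>w\<in>W. Poly_Mapping.single w (Poly_Mapping.lookup f w)"
      let ?c = "Poly_Mapping.lookup f w"
      have len: "length v = n" if "v \<in> insert w W" for v
        using insert.prems f(1) that by (auto simp: fa_comp_def)
      have g: "pr ?g \<in> quot_comp (r ` {1..m}) n"
        unfolding quot_comp_def using len
        by (intro imageI fa.subspace_sum[OF subspace_comp] single_in_comp) auto
      have "Q (pr ?g \<oplus>\<^bsub>A\<^esub> pr (fa_const ?c) \<otimes>\<^bsub>A\<^esub> pr (fa_word (from_nat (to_nat w))))"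
        using insert len by (intro 16(3) g) auto
      then show ?case
        using insert by (simp add: fa_proj_add fa_proj_mult fa_const_def single_mult_single add.commute)
    qed
    from this[OF finite_keys order.refl] show ?case
      unfolding f(2) by (simp flip: sum_monomials)
  qed
qed

section \<open>Matrices over the free algebra\<close>

text \<open>Elements of free \<open>A\<close>-modules of finite rank are represented by tuples over \<open>T\<close>, and linear maps
  between them by matrices over \<open>T\<close> acting from the right; all equations in such modules become
  congruences modulo \<open>I\<close> in \<open>T\<close>.\<close>

definition vec :: "nat set \<Rightarrow> (nat \<Rightarrow> ('x, 'k) free_alg) \<Rightarrow> nat \<Rightarrow> ('x, 'k) free_alg set"
  where "vec S t = (\<lambda>s. if s \<in> S then pr (t s) else \<zero>\<^bsub>A\<^esub>)"

lemma vec_carrier: "finite S \<Longrightarrow> vec S t \<in> carrier (A.F S)"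
  by (auto simp: free_lmod_carrier vec_def fa_proj_zero intro: finite_subset[of _ S])

lemma carrier_vec: "f \<in> carrier (A.F S) \<Longrightarrow> f = vec S (\<lambda>s. lft (f s))"
  by (rule ext) (auto simp: vec_def free_lmod_carrier proj_lft)

lemma vec_eq_iff: "vec S t = vec S t' \<longleftrightarrow> (\<forall>s\<in>S. t s - t' s \<in> I)"
  by (auto simp: vec_def fun_eq_iff fa_proj_eq_iff)

lemma vec_zero: "\<zero>\<^bsub>A.F S\<^esub> = vec S (\<lambda>_. 0)"
  by (simp add: vec_def free_lmod_simps fa_proj_zero fun_eq_iff)

lemma vec_zero_iff: "vec S t = \<zero>\<^bsub>A.F S\<^esub> \<longleftrightarrow> (\<forall>s\<in>S. t s \<in> I)"
  by (simp add: vec_zero vec_eq_iff)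

lemma vec_add: "vec S t \<oplus>\<^bsub>A.F S\<^esub> vec S t' = vec S (\<lambda>s. t s + t' s)"
  by (simp add: vec_def free_lmod_simps fa_proj_zero fa_proj_add fun_eq_iff)

lemma vec_smult: "pr a \<odot>\<^bsub>A.F S\<^esub> vec S t = vec S (\<lambda>s. a * t s)"
  by (simp add: vec_def free_lmod_simps fa_proj_zero fa_proj_mult fun_eq_iff)

definition thom :: "nat set \<Rightarrow> (nat \<Rightarrow> nat) \<Rightarrow> nat \<Rightarrow> (nat \<Rightarrow> ('x, 'k) free_alg) \<Rightarrow> bool"
  where "thom S \<delta> n t \<longleftrightarrow> (\<forall>s. if s \<in> S \<and> \<delta> s \<le> n then t s \<in> fa_comp (n - \<delta> s) else t s = 0)"

lemma free_comp_vec: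
  assumes "f \<in> A.FG S \<delta> n"
  obtains t where "f = vec S t" "thom S \<delta> n t"
proof -
  have "\<exists>t. (if s \<in> S \<and> \<delta> s \<le> n then t \<in> fa_comp (n - \<delta> s) else t = 0) \<and> f s = pr t" for s
  proof (cases "s \<in> S \<and> \<delta> s \<le> n")
    case True
    then have "f s \<in> quot_comp (r ` {1..m}) (n - \<delta> s)" using assms by (auto simp: free_comp_def)
    then show ?thesis using True by (auto simp: quot_comp_def)
  next
    case False
    moreover have "s \<notin> S \<longrightarrow> f s = \<zero>\<^bsub>A\<^esub>" "s \<in> S \<longrightarrow> \<not> \<delta> s \<le> n \<longrightarrow> f s = \<zero>\<^bsub>A\<^esub>"
      using assms by (simp_all add: free_comp_def free_lmod_carrier)
    ultimately have "f s = \<zero>\<^bsub>A\<^esub>" by blast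
    then show ?thesis using False by (auto simp: fa_proj_zero)
  qed
  then obtain t where t: "\<And>s. (if s \<in> S \<and> \<delta> s \<le> n then t s \<in> fa_comp (n - \<delta> s) else t s = 0) \<and> f s = pr (t s)"
    by metis
  have "f s = vec S t s" for s
    using t[of s] by (auto simp: vec_def fa_proj_zero)
  then have "f = vec S t" by (rule ext)
  then show ?thesis by (rule that) (use t in \<open>simp add: thom_def\<close>)
qed

lemma vec_free_comp:
  assumes "finite S" and "\<And>s. s \<in> S \<Longrightarrow> if \<delta> s \<le> n then t s \<in> fa_comp (n - \<delta> s) else t s = 0"
  shows "vec S t \<in> A.FG S \<delta> n"
proof -
  have "if \<delta> s \<le> n then vec S t s \<in> quot_comp (r ` {1..m}) (n - \<delta> s) else vec S t s = \<zero>\<^bsub>A\<^esub>"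
    if "s \<in> S" for s
    using assms(2)[OF that] that by (auto simp: vec_def quot_comp_def fa_proj_zero split: if_splits)
  then show ?thesis
    using vec_carrier[OF assms(1)] by (simp add: free_comp_def)
qed

definition mat :: "nat set \<Rightarrow> nat set \<Rightarrow> (nat \<Rightarrow> nat \<Rightarrow> ('x, 'k) free_alg)
    \<Rightarrow> (nat \<Rightarrow> ('x, 'k) free_alg set) \<Rightarrow> nat \<Rightarrow> ('x, 'k) free_alg set"
  where "mat S S' M = (\<lambda>f\<in>carrier (A.F S). vec S' (\<lambda>s'. \<Sum>s\<in>S. lft (f s) * M s s'))"

lemma mat_vec:
  assumes "finite S"
  shows "mat S S' M (vec S t) = vec S' (\<lambda>s'. \<Sum>s\<in>S. t s * M s s')"
proof -
  have "(\<Sum>s\<in>S. lft (vec S t s) * M s s') - (\<Sum>s\<in>S. t s * M s s') \<in> I" for s'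
  proof -
    have "(\<Sum>s\<in>S. lft (vec S t s) * M s s') - (\<Sum>s\<in>S. t s * M s s')
        = (\<Sum>s\<in>S. (lft (vec S t s) - t s) * M s s')"
      by (simp add: sum_subtractf left_diff_distrib)
    also have "\<dots> \<in> I"
      by (rule fa_ideal_sum, rule fa_ideal_rmult) (simp add: vec_def lft_proj)
    finally show ?thesis .
  qed
  then show ?thesis
    using vec_carrier[OF assms] by (simp add: mat_def vec_eq_iff)
qed

lemma mat_graded_hom:
  assumes fin: "finite S" "finite S'"
    and M: "\<And>s s'. s \<in> S \<Longrightarrow> s' \<in> S' \<Longrightarrow> \<delta>' s' \<le> \<delta> s \<and> M s s' \<in> fa_comp (\<delta> s - \<delta>' s')"
  shows "mat S S' M \<in> graded_hom A 0 (A.F S) (A.FG S \<delta>) (A.F S') (A.FG S' \<delta>')"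
proof -
  have sm: "pr a \<odot>\<^bsub>A.F S\<^esub> vec S t \<in> carrier (A.F S)" for a t
    unfolding vec_smult by (rule vec_carrier[OF fin(1)])
  have "lmod_lin A (A.F S) (A.F S') (mat S S' M)"
    unfolding lmod_lin_def
  proof (intro conjI ballI)
    fix f g assume "f \<in> carrier (A.F S)" "g \<in> carrier (A.F S)"
    then obtain t u where "f = vec S t" "g = vec S u" using carrier_vec by blast
    then show "mat S S' M (f \<oplus>\<^bsub>A.F S\<^esub> g) = mat S S' M f \<oplus>\<^bsub>A.F S'\<^esub> mat S S' M g"
      by (simp add: vec_add mat_vec[OF fin(1)] distrib_right sum.distrib)
  next
    fix a f assume "a \<in> carrier A" "f \<in> carrier (A.F S)"
    then obtain b t where "a = pr b" "f = vec S t" using carrier_vec by (auto simp: fa_quot_carrier)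
    then show "mat S S' M (a \<odot>\<^bsub>A.F S\<^esub> f) = a \<odot>\<^bsub>A.F S'\<^esub> mat S S' M f"
      by (simp add: vec_smult mat_vec[OF fin(1)] sum_distrib_left mult.assoc)
  qed (simp add: mat_def vec_carrier[OF fin(2)])
  then have "restrict (mat S S' M) (carrier (A.F S)) \<in> lmod_hom A (A.F S) (A.F S')"
    by (rule lin_restrict_hom[OF A.free_left_module])
  moreover have "restrict (mat S S' M) (carrier (A.F S)) = mat S S' M"
    by (simp add: mat_def)
  ultimately have hom: "mat S S' M \<in> lmod_hom A (A.F S) (A.F S')" by simp
  have "mat S S' M f \<in> A.FG S' \<delta>' n" if fn: "f \<in> A.FG S \<delta> n" for f n
  proof -
    obtain t where f: "f = vec S t" and t: "thom S \<delta> n t" using fn by (rule free_comp_vec)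
    show ?thesis
      unfolding f mat_vec[OF fin(1)]
    proof (rule vec_free_comp[OF fin(2)])
      fix s' assume s': "s' \<in> S'"
      have "if \<delta>' s' \<le> n then t s * M s s' \<in> fa_comp (n - \<delta>' s') else t s * M s s' = 0"
        if "s \<in> S" for s
      proof (cases "\<delta> s \<le> n")
        case True
        then have "t s \<in> fa_comp (n - \<delta> s)" using t that by (simp add: thom_def)
        then have "t s * M s s' \<in> fa_comp ((n - \<delta> s) + (\<delta> s - \<delta>' s'))"
          using M[OF that s'] by (intro comp_mult) auto
        moreover have "(n - \<delta> s) + (\<delta> s - \<delta>' s') = n - \<delta>' s'" "\<delta>' s' \<le> n"
          using True M[OF that s'] by auto
        ultimately show ?thesis by simp
      next
        case False
        then show ?thesis
          using t that by (simp add: thom_def fa.subspace_0[OF subspace_comp])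
      qed
      then show "if \<delta>' s' \<le> n then (\<Sum>s\<in>S. t s * M s s') \<in> fa_comp (n - \<delta>' s')
          else (\<Sum>s\<in>S. t s * M s s') = 0"
        by (auto intro: fa.subspace_sum[OF subspace_comp] split: if_splits)
    qed
  qed
  then show ?thesis using hom by (simp add: graded_hom_def)
qed

end

context graded_relations
begin

section \<open>The start of the minimal resolution\<close>

lemma carrier_eq_vec: "finite S \<Longrightarrow> carrier (A.F S) = range (vec S)"
  using vec_carrier carrier_vec by blast

definition letters :: "nat set"
  where "letters = range (to_nat :: 'x \<Rightarrow> nat)"

lemma finite_letters: "finite letters"
  by (simp add: letters_def)

lemma sum_letters: "(\<Sum>s\<in>letters. g s (from_nat s)) = (\<Sum>x\<in>UNIV. g (to_nat x) (x :: 'x))"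
  by (simp add: letters_def sum.reindex)

text \<open>The complex \<open>A\<^sup>m \<rightarrow> A \<otimes> V \<rightarrow> A \<rightarrow> K\<close>: the letter \<open>x\<close> is sent to \<open>x \<in> A\<close>, and the \<open>i\<close>-th basis vector to
  the tuple of coefficients of \<open>r\<^sub>i\<close> with respect to its last letter.\<close>

definition \<epsilon> :: "(nat \<Rightarrow> ('x, 'k) free_alg set) \<Rightarrow> ('x, 'k) free_alg set set"
  where "\<epsilon> = (\<lambda>f\<in>carrier (A.F {0}). tr (lft (f 0)))"

definition D\<^sub>0 :: "(nat \<Rightarrow> ('x, 'k) free_alg set) \<Rightarrow> nat \<Rightarrow> ('x, 'k) free_alg set"
  where "D\<^sub>0 = mat letters {0} (\<lambda>s _. fa_var (from_nat s))"

definition D\<^sub>1 :: "(nat \<Rightarrow> ('x, 'k) free_alg set) \<Rightarrow> nat \<Rightarrow> ('x, 'k) free_alg set"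
  where "D\<^sub>1 = mat {1..m} letters (\<lambda>i s. fa_rdiv (from_nat s) (r i))"

lemma tr_cong_I: "f - g \<in> I \<Longrightarrow> tr f = tr g"
  using I_lookup_Nil[of "f - g"] by (simp add: tr_eq_iff lookup_minus)

lemma \<epsilon>_vec: "\<epsilon> (vec {0} t) = tr (t 0)"
proof -
  have "\<epsilon> (vec {0} t) = tr (lft (vec {0} t 0))"
    using vec_carrier[of "{0}" t] by (simp add: \<epsilon>_def)
  also have "\<dots> = tr (t 0)" by (rule tr_cong_I) (simp add: vec_def lft_proj)
  finally show ?thesis .
qed

lemma D\<^sub>0_vec: "D\<^sub>0 (vec letters t) = vec {0} (\<lambda>_. \<Sum>x\<in>UNIV. t (to_nat x) * fa_var x)"
  unfolding D\<^sub>0_def mat_vec[OF finite_letters] sum_letters[of "\<lambda>s x. t s * fa_var x"] ..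

lemma D\<^sub>1_vec: "D\<^sub>1 (vec {1..m} a) = vec letters (\<lambda>s. \<Sum>i=1..m. a i * fa_rdiv (from_nat s) (r i))"
  unfolding D\<^sub>1_def by (rule mat_vec) simp

lemma D\<^sub>1_zero_iff: "D\<^sub>1 (vec {1..m} a) = \<zero>\<^bsub>A.F letters\<^esub> \<longleftrightarrow> a \<in> syz"
  unfolding D\<^sub>1_vec vec_zero_iff by (simp add: syz_def letters_def)

lemma D\<^sub>0_graded: "D\<^sub>0 \<in> graded_hom A 0 (A.F letters) (A.FG letters (\<lambda>_. 1))
    (A.F {0}) (A.FG {0} (\<lambda>_. 0))"
  unfolding D\<^sub>0_def
  by (rule mat_graded_hom) (use fa_var_comp in \<open>auto simp: finite_letters\<close>)

lemma D\<^sub>1_graded: "D\<^sub>1 \<in> graded_hom A 0 (A.F {1..m}) (A.FG {1..m} d)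
    (A.F letters) (A.FG letters (\<lambda>_. 1))"
  unfolding D\<^sub>1_def
proof (rule mat_graded_hom)
  fix i s assume i: "i \<in> {1..m}"
  show "1 \<le> d i \<and> fa_rdiv (from_nat s) (r i) \<in> fa_comp (d i - 1)"
    using d_ge[OF i] rdiv_r_comp[OF i] by simp
qed (simp_all add: finite_letters)

lemma \<epsilon>_graded: "\<epsilon> \<in> graded_hom A 0 (A.F {0}) (A.FG {0} (\<lambda>_. 0)) K (triv_comp (r ` {1..m}))"
proof -
  have "lmod_lin A (A.F {0}) K \<epsilon>"
    unfolding lmod_lin_def
  proof (intro conjI ballI)
    fix f assume "f \<in> carrier (A.F {0 :: nat})"
    then obtain t where f: "f = vec {0} t" using carrier_vec by blast
    then show "\<epsilon> f \<in> carrier K" by (simp add: \<epsilon>_vec K_carrier)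
    {
      fix g assume "g \<in> carrier (A.F {0 :: nat})"
      then obtain u where "g = vec {0} u" using carrier_vec by blast
      then show "\<epsilon> (f \<oplus>\<^bsub>A.F {0}\<^esub> g) = \<epsilon> f \<oplus>\<^bsub>K\<^esub> \<epsilon> g"
        using f by (simp add: \<epsilon>_vec vec_add K_add)
    }
    fix a assume "a \<in> carrier A"
    then obtain b where "a = pr b" by (auto simp: fa_quot_carrier)
    then show "\<epsilon> (a \<odot>\<^bsub>A.F {0}\<^esub> f) = a \<odot>\<^bsub>K\<^esub> \<epsilon> f"
      using f by (simp add: \<epsilon>_vec vec_smult K_smult)
  qed
  then have "restrict \<epsilon> (carrier (A.F {0})) \<in> lmod_hom A (A.F {0}) K"
    by (rule lin_restrict_hom[OF A.free_left_module])
  then have hom: "\<epsilon> \<in> lmod_hom A (A.F {0}) K" by (simp add: \<epsilon>_def)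
  have "\<epsilon> f \<in> triv_comp (r ` {1..m}) n" if fn: "f \<in> A.FG {0} (\<lambda>_. 0) n" for f n
  proof -
    obtain t where f: "f = vec {0} t" and t: "thom {0} (\<lambda>_. 0) n t" using fn by (rule free_comp_vec)
    then have "t 0 \<in> fa_comp n" unfolding thom_def by (auto dest!: spec[of _ 0])
    then show ?thesis
      using lookup_Nil_comp[of "t 0" n]
      by (auto simp: f \<epsilon>_vec triv_comp_def tr_zero_iff) (auto simp: K_carrier)
  qed
  then show ?thesis using hom by (simp add: graded_hom_def)
qed

text \<open>\<open>T R T = T R + (T R T) V\<close>.\<close>

lemma I_expansion:
  assumes "f \<in> I"
  obtains a y where "f = (\<Sum>i=1..m. a i * r i) + (\<Sum>x\<in>UNIV. y x * fa_var x)" "\<And>x. y x \<in> I"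
proof -
  have "\<exists>a y. f = (\<Sum>i=1..m. a i * r i) + (\<Sum>x\<in>UNIV. y x * fa_var x) \<and> (\<forall>x. y x \<in> I)"
    using assms
  proof (induction f rule: fa_ideal_induct)
    case zero
    show ?case by (intro exI[of _ "\<lambda>_. 0"]) simp
  next
    case (add g h)
    then obtain a y a' y' where
      "g = (\<Sum>i=1..m. a i * r i) + (\<Sum>x\<in>UNIV. y x * fa_var x)" "\<forall>x. y x \<in> I"
      "h = (\<Sum>i=1..m. a' i * r i) + (\<Sum>x\<in>UNIV. y' x * fa_var x)" "\<forall>x. y' x \<in> I"
      by blast
    then show ?case
      by (intro exI[of _ "\<lambda>i. a i + a' i"] exI[of _ "\<lambda>x. y x + y' x"])
        (auto simp: distrib_right sum.distrib add_ac intro: fa_ideal_add)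
  next
    case (gen u q v c)
    then obtain i where i: "i \<in> {1..m}" "q = r i" by blast
    let ?u = "Poly_Mapping.single u c"
    show ?case
    proof (cases v rule: rev_cases)
      case Nil
      have "(\<Sum>j=1..m. (if j = i then ?u else 0) * r j) = (\<Sum>j=1..m. if j = i then ?u * r j else 0)"
        by (rule sum.cong) auto
      also have "\<dots> = ?u * q * fa_word v"
        using i Nil by (simp add: sum.delta flip: one_eq_word)
      finally show ?thesis
        by (intro exI[of _ "\<lambda>j. if j = i then ?u else 0"] exI[of _ "\<lambda>_. 0"]) simp
    next
      case (snoc v' y)
      have "(\<Sum>x\<in>UNIV. (if x = y then ?u * q * fa_word v' else 0) * fa_var x)
          = (\<Sum>x\<in>UNIV. if x = y then ?u * q * fa_word v' * fa_var x else 0)"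
        by (rule sum.cong) auto
      also have "\<dots> = ?u * q * fa_word v"
        by (simp add: sum.delta snoc fa_var_def single_mult_single mult.assoc)
      finally have "?u * q * fa_word v = (\<Sum>x\<in>UNIV. (if x = y then ?u * q * fa_word v' else 0) * fa_var x)"
        by simp
      moreover have "?u * q * fa_word v' \<in> I"
        using gen by (intro fa_ideal_rmult fa_ideal_lmult fa_ideal_gen)
      ultimately show ?thesis
        by (intro exI[of _ "\<lambda>_. 0"] exI[of _ "\<lambda>x. if x = y then ?u * q * fa_word v' else 0"]) auto
    qed
  qed
  then show ?thesis using that by blast
qed

lemma exact_K: "\<epsilon> ` carrier (A.F {0}) = carrier K"
proof
  show "\<epsilon> ` carrier (A.F {0}) \<subseteq> carrier K"
    by (auto simp: carrier_eq_vec \<epsilon>_vec K_carrier)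
  show "carrier K \<subseteq> \<epsilon> ` carrier (A.F {0})"
  proof
    fix X assume "X \<in> carrier K"
    then obtain f where "X = \<epsilon> (vec {0} (\<lambda>_. f))" by (auto simp: K_carrier \<epsilon>_vec)
    then show "X \<in> \<epsilon> ` carrier (A.F {0})" by (simp add: vec_carrier)
  qed
qed

lemma exact\<^sub>0: "D\<^sub>0 ` carrier (A.F letters) = {x \<in> carrier (A.F {0}). \<epsilon> x = \<zero>\<^bsub>K\<^esub>}"
proof
  have "\<epsilon> (D\<^sub>0 (vec letters t)) = \<zero>\<^bsub>K\<^esub>" for t
    by (simp add: D\<^sub>0_vec \<epsilon>_vec tr_zero_iff lookup_sum lookup_Nil_mult_var)
  then show "D\<^sub>0 ` carrier (A.F letters) \<subseteq> {x \<in> carrier (A.F {0}). \<epsilon> x = \<zero>\<^bsub>K\<^esub>}"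
    by (simp add: carrier_eq_vec finite_letters image_subset_iff) (simp add: D\<^sub>0_vec)
  show "{x \<in> carrier (A.F {0}). \<epsilon> x = \<zero>\<^bsub>K\<^esub>} \<subseteq> D\<^sub>0 ` carrier (A.F letters)"
  proof
    fix f assume "f \<in> {x \<in> carrier (A.F {0}). \<epsilon> x = \<zero>\<^bsub>K\<^esub>}"
    then obtain t where f: "f = vec {0} t" and t: "Poly_Mapping.lookup (t 0) [] = 0"
      by (auto simp: carrier_eq_vec \<epsilon>_vec tr_zero_iff)
    have "t 0 = (\<Sum>x\<in>UNIV. fa_rdiv x (t 0) * fa_var x)"
      using rdiv_expansion[of "t 0"] t by (simp add: fa_const_zero)
    then have "f = D\<^sub>0 (vec letters (\<lambda>s. fa_rdiv (from_nat s) (t 0)))"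
      unfolding f D\<^sub>0_vec vec_eq_iff by simp
    then show "f \<in> D\<^sub>0 ` carrier (A.F letters)"
      by (simp add: vec_carrier finite_letters)
  qed
qed

text \<open>If \<open>\<Sum> t\<^sub>x x\<close> is a relation, comparing the coefficients of the last letter in its expansion
  \<open>\<Sum> a\<^sub>i r\<^sub>i + \<Sum> y\<^sub>x x\<close> shows that \<open>t\<close> is the image of \<open>a\<close>.\<close>

lemma exact\<^sub>1: "D\<^sub>1 ` carrier (A.F {1..m})
    = {x \<in> carrier (A.F letters). D\<^sub>0 x = \<zero>\<^bsub>A.F {0}\<^esub>}"
proof
  have "(\<Sum>x\<in>UNIV. (\<Sum>i=1..m. a i * fa_rdiv x (r i)) * fa_var x) \<in> I" for a
  proof -
    have "(\<Sum>x\<in>UNIV. (\<Sum>i=1..m. a i * fa_rdiv x (r i)) * fa_var x)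
        = (\<Sum>x\<in>UNIV. \<Sum>i=1..m. a i * (fa_rdiv x (r i) * fa_var x))"
      by (simp add: sum_distrib_right mult.assoc)
    also have "\<dots> = (\<Sum>i=1..m. \<Sum>x\<in>UNIV. a i * (fa_rdiv x (r i) * fa_var x))"
      by (rule sum.swap)
    also have "\<dots> = (\<Sum>i=1..m. a i * r i)"
      by (rule sum.cong[OF refl]) (simp add: r_expansion[symmetric] flip: sum_distrib_left)
    also have "\<dots> \<in> I"
      by (intro fa_ideal_sum fa_ideal_lmult fa_ideal_gen imageI)
    finally show ?thesis .
  qed
  then show "D\<^sub>1 ` carrier (A.F {1..m})
      \<subseteq> {x \<in> carrier (A.F letters). D\<^sub>0 x = \<zero>\<^bsub>A.F {0}\<^esub>}"
    by (auto simp: carrier_eq_vec finite_letters D\<^sub>1_vec D\<^sub>0_vec vec_zero_iff)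
  show "{x \<in> carrier (A.F letters). D\<^sub>0 x = \<zero>\<^bsub>A.F {0}\<^esub>}
      \<subseteq> D\<^sub>1 ` carrier (A.F {1..m})"
  proof
    fix f assume "f \<in> {x \<in> carrier (A.F letters). D\<^sub>0 x = \<zero>\<^bsub>A.F {0}\<^esub>}"
    then obtain t where f: "f = vec letters t"
      and "(\<Sum>x\<in>UNIV. t (to_nat x) * fa_var x) \<in> I"
      by (auto simp: carrier_eq_vec finite_letters D\<^sub>0_vec vec_zero_iff)
    then obtain a y where eq: "(\<Sum>x\<in>UNIV. t (to_nat x) * fa_var x)
        = (\<Sum>i=1..m. a i * r i) + (\<Sum>x\<in>UNIV. y x * fa_var x)" and y: "\<And>x. y x \<in> I"
      by (elim I_expansion) blast
    have "t (to_nat x) = (\<Sum>i=1..m. a i * fa_rdiv x (r i)) + y x" for x :: 'x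
      using arg_cong[OF eq, of "fa_rdiv x"]
      by (simp add: rdiv_add rdiv_sum rdiv_mult_var rdiv_mult_r)
    then have "f = D\<^sub>1 (vec {1..m} a)"
      unfolding f D\<^sub>1_vec vec_eq_iff using y by (auto simp: letters_def)
    then show "f \<in> D\<^sub>1 ` carrier (A.F {1..m})"
      by (simp add: vec_carrier)
  qed
qed

section \<open>Minimality\<close>

text \<open>For degree reasons \<open>r\<^sub>j\<close> does not contribute to relations of degree below its own.\<close>

lemma I_low_part:
  assumes "f \<in> I" and j: "k < d j"
  shows "fa_part k f \<in> fa_ideal (r ` ({1..m} - {j}))"
  using assms(1)
proof (induction f rule: fa_ideal_induct)
  case (gen u q v c)
  then obtain i where i: "i \<in> {1..m}" "q = r i" by blast
  let ?f = "Poly_Mapping.single u c * q * fa_word v"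
  have "?f \<in> fa_comp (length u + d i + length v)"
    unfolding i(2) by (intro comp_mult r_comp i(1)) (simp_all add: single_in_comp)
  then have part: "fa_part k ?f = (if length u + d i + length v = k then ?f else 0)"
    by (rule part_comp)
  show ?case
  proof (cases "length u + d i + length v = k")
    case True
    then have "q \<in> r ` ({1..m} - {j})" using i j by auto
    then have "?f \<in> fa_ideal (r ` ({1..m} - {j}))"
      by (intro fa_ideal_rmult fa_ideal_lmult fa_ideal_gen)
    then show ?thesis by (simp add: part)
  qed (simp add: part)
qed (auto simp: part_add intro: fa_ideal_add)

text \<open>A syzygy with a nonzero constant entry would make one of the relations redundant.\<close>

lemma syz_no_const:
  assumes a: "a \<in> syz" and j: "j \<in> {1..m}"
  shows "Poly_Mapping.lookup (a j) [] = 0"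
proof (rule ccontr)
  let ?J = "fa_ideal (r ` ({1..m} - {j}))"
  assume nz: "Poly_Mapping.lookup (a j) [] \<noteq> 0"
  \<comment> \<open>in degree \<open>d j\<close> the \<open>j\<close>-th entry is a scalar\<close>
  obtain k where k: "d j = Suc k" using d_ge[OF j] by (cases "d j") auto
  define b where "b = vpart (d j) a"
  define h where "h x = (\<Sum>i=1..m. b i * fa_rdiv x (r i))" for x
  have "h x = fa_part k (\<Sum>i=1..m. a i * fa_rdiv x (r i))" for x
    unfolding h_def b_def k by (rule vpart_sum_rdiv)
  then have h: "h x \<in> ?J" for x
    using a I_low_part[of _ k j] k by (simp add: syz_def)
  have "(\<Sum>i=1..m. b i * r i) = (\<Sum>i=1..m. \<Sum>x\<in>UNIV. b i * fa_rdiv x (r i) * fa_var x)"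
    by (rule sum.cong[OF refl], subst r_expansion) (simp_all add: sum_distrib_left mult.assoc)
  also have "\<dots> = (\<Sum>x\<in>UNIV. \<Sum>i=1..m. b i * fa_rdiv x (r i) * fa_var x)"
    by (rule sum.swap)
  finally have sum_b: "(\<Sum>i=1..m. b i * r i) = (\<Sum>x\<in>UNIV. h x * fa_var x)"
    by (simp add: h_def sum_distrib_right)
  have "(\<Sum>i=1..m. b i * r i) = b j * r j + (\<Sum>i\<in>{1..m} - {j}. b i * r i)"
    using j by (simp add: sum.remove)
  then have "b j * r j = (\<Sum>x\<in>UNIV. h x * fa_var x) - (\<Sum>i\<in>{1..m} - {j}. b i * r i)"
    by (simp add: sum_b[symmetric])
  also have "\<dots> \<in> ?J"
    by (intro fa_ideal_diff fa_ideal_sum fa_ideal_rmult h fa_ideal_lmult fa_ideal_gen imageI)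
  finally have bj: "b j * r j \<in> ?J" .
  have "b j = fa_part 0 (a j)" by (simp add: b_def vpart_def)
  moreover have "Poly_Mapping.lookup (fa_part 0 (a j)) [] = Poly_Mapping.lookup (a j) []"
    by (simp add: fa_part.rep_eq)
  ultimately have "b j = fa_const (Poly_Mapping.lookup (a j) [])"
    using comp_zero_const[OF part_in_comp, of "a j"] by simp
  then have "fa_const (inverse (Poly_Mapping.lookup (a j) [])) * (b j * r j) = r j"
    using nz by (simp add: fa_const_one flip: mult.assoc fa_const_mult)
  then have "r j \<in> ?J" using fa_ideal_lmult[OF bj] by metis
  then show False using r_min[OF j] by simp
qed

text \<open>Hence a syzygy is a combination of tuples with letters as coefficients, and linear maps can be
  evaluated on it accordingly.\<close>

lemma syz_letters:
  assumes "a \<in> syz"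
  obtains t where "vec {1..m} a = vec {1..m} (\<lambda>i. \<Sum>x\<in>UNIV. fa_var x * t x i)"
proof -
  have "\<exists>s. a i = (\<Sum>x\<in>UNIV. fa_var x * s x)" if "i \<in> {1..m}" for i
    by (rule ldiv_exists) (use syz_no_const[OF assms that] in \<open>auto simp: in_keys_iff\<close>)
  then obtain s where "\<And>i. i \<in> {1..m} \<Longrightarrow> a i = (\<Sum>x\<in>UNIV. fa_var x * s i x)" by metis
  then have "vec {1..m} a = vec {1..m} (\<lambda>i. \<Sum>x\<in>UNIV. fa_var x * s i x)"
    by (simp add: vec_eq_iff)
  then show ?thesis by (rule that[of "\<lambda>x i. s i x"])
qed

lemma lin_letters_finite:
  assumes N: "left_module A N" and g: "lmod_lin A (A.F {1..m}) N g" and X: "finite X"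
  shows "g (vec {1..m} (\<lambda>i. \<Sum>x\<in>X. fa_var x * t x i))
    = finsum N (\<lambda>x. pr (fa_var x) \<odot>\<^bsub>N\<^esub> g (vec {1..m} (t x))) X"
proof -
  interpret N: left_module A N by fact
  have gc: "g (vec {1..m} u) \<in> carrier N" for u
    by (rule lin_closed[OF g vec_carrier]) simp
  show ?thesis
    using X
  proof (induction X rule: finite_induct)
    case empty
    have "g (vec {1..m} (\<lambda>_. 0)) = \<zero>\<^bsub>N\<^esub>"
      using lin_zero[OF A.free_left_module N g] by (simp add: vec_zero)
    then show ?case by simp
  next
    case (insert y X)
    have "vec {1..m} (\<lambda>i. \<Sum>x\<in>insert y X. fa_var x * t x i)
        = pr (fa_var y) \<odot>\<^bsub>A.F {1..m}\<^esub> vec {1..m} (t y)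
          \<oplus>\<^bsub>A.F {1..m}\<^esub> vec {1..m} (\<lambda>i. \<Sum>x\<in>X. fa_var x * t x i)"
      using insert by (simp add: vec_smult vec_add)
    then have "g (vec {1..m} (\<lambda>i. \<Sum>x\<in>insert y X. fa_var x * t x i))
        = pr (fa_var y) \<odot>\<^bsub>N\<^esub> g (vec {1..m} (t y))
          \<oplus>\<^bsub>N\<^esub> g (vec {1..m} (\<lambda>i. \<Sum>x\<in>X. fa_var x * t x i))"
      by (simp add: lin_add[OF g] lin_smult[OF g] vec_carrier vec_smult)
        (simp add: lin_smult[OF g, symmetric] vec_carrier vec_smult)
    moreover have "(\<lambda>x. pr (fa_var x) \<odot>\<^bsub>N\<^esub> g (vec {1..m} (t x))) \<in> X \<rightarrow> carrier N"
      "pr (fa_var y) \<odot>\<^bsub>N\<^esub> g (vec {1..m} (t y)) \<in> carrier N"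
      by (auto intro: N.smult_closed gc)
    ultimately show ?case
      using insert by (simp add: N.M.finsum_insert)
  qed
qed

section \<open>Global dimension at most two\<close>

text \<open>A syzygy \<open>\<Sum> x t\<^sub>x\<close> is fixed by a projection \<open>\<pi>\<close> onto the syzygies, hence equals \<open>\<Sum> x \<pi>(t\<^sub>x)\<close>.\<close>

lemma retract_dec:
  assumes \<pi>: "lmod_lin A (A.F {1..m}) (A.F {1..m}) \<pi>"
    and ker: "\<And>x. x \<in> carrier (A.F {1..m}) \<Longrightarrow> D\<^sub>1 (\<pi> x) = \<zero>\<^bsub>A.F letters\<^esub>"
    and id: "\<And>x. x \<in> carrier (A.F {1..m}) \<Longrightarrow> D\<^sub>1 x = \<zero>\<^bsub>A.F letters\<^esub> \<Longrightarrow> \<pi> x = x"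
    and a: "a \<in> syz"
  shows "a \<in> dec"
proof -
  interpret F: left_module A "A.F {1..m}" by (rule A.free_left_module)
  obtain t where t: "vec {1..m} a = vec {1..m} (\<lambda>i. \<Sum>x\<in>UNIV. fa_var x * t x i)"
    using a by (rule syz_letters)
  have "\<exists>b. \<pi> (vec {1..m} (t x)) = vec {1..m} b" for x
    using carrier_vec[OF lin_closed[OF \<pi> vec_carrier]] by blast
  then obtain b where b: "\<And>x. \<pi> (vec {1..m} (t x)) = vec {1..m} (b x)" by metis
  have syz: "b x \<in> syz" for x
    using ker[OF vec_carrier, of "t x"] by (simp add: b D\<^sub>1_zero_iff)
  have sum: "finite X \<Longrightarrow> finsum (A.F {1..m}) (\<lambda>x. pr (fa_var x) \<odot>\<^bsub>A.F {1..m}\<^esub> vec {1..m} (b x)) X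
      = vec {1..m} (\<lambda>i. \<Sum>x\<in>X. fa_var x * b x i)" for X
    using lin_letters_finite[OF A.free_left_module lin_id, of X b] by simp
  have "vec {1..m} a = \<pi> (vec {1..m} a)"
    using id[OF vec_carrier, of a] a by (simp add: D\<^sub>1_zero_iff)
  also have "\<dots> = vec {1..m} (\<lambda>i. \<Sum>x\<in>UNIV. fa_var x * b x i)"
    unfolding t lin_letters_finite[OF A.free_left_module \<pi> finite] b by (rule sum) simp
  finally show ?thesis
    unfolding vec_eq_iff dec_def using syz by blast
qed

text \<open>\<open>K\<close> has a projective resolution of length two, so the projection exists by
  \<open>second_syzygy_retract\<close>.\<close>

lemma gl_dim_no_new_syz:
  assumes "\<not> 3 \<le> gl_dim A"
  shows "no_new_syz n"
proof -
  have "proj_dim A K \<le> gl_dim A"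
    unfolding gl_dim_def by (rule Sup_upper) (use K_left_module in blast)
  then have "proj_dim A K < 3" using assms by simp
  then obtain k :: nat and Q :: "nat \<Rightarrow> (('x, 'k) free_alg set, ('x, 'k) free_alg set set) module"
    and d' e' where k: "enat k < 3" and res: "resolution A K Q d' e'"
    and proj: "\<And>i. projective_lmod A (Q i)" and triv: "\<And>i. k < i \<Longrightarrow> carrier (Q i) = {\<zero>\<^bsub>Q i\<^esub>}"
    unfolding proj_dim_def Inf_less_iff by blast
  have "k < 3" using k by (metis enat_ord_simps(2) numeral_eq_enat)
  then have Q3: "carrier (Q 3) = {\<zero>\<^bsub>Q 3\<^esub>}" by (rule triv)
  have Qi: "left_module A (Q i)" for i using res by (simp add: resolution_def)
  have lin: "lmod_lin A (Q (Suc i)) (Q i) (d' i)" for i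
    using res by (auto simp: resolution_def intro: hom_lin)
  have lin_e: "lmod_lin A (Q 0) K e'" using res by (auto simp: resolution_def intro: hom_lin)
  have ex: "e' ` carrier (Q 0) = carrier K" "d' 0 ` carrier (Q 1) = {x \<in> carrier (Q 0). e' x = \<zero>\<^bsub>K\<^esub>}"
    "d' (Suc i) ` carrier (Q (Suc (Suc i))) = {x \<in> carrier (Q (Suc i)). d' i x = \<zero>\<^bsub>Q i\<^esub>}" for i
    using res by (simp_all add: resolution_def)
  have inj: "{x \<in> carrier (Q 2). d' 1 x = \<zero>\<^bsub>Q 1\<^esub>} = {\<zero>\<^bsub>Q 2\<^esub>}"
    using ex(3)[of 1] lin_zero[OF Qi Qi lin[of 2]] Q3
    by (simp add: numeral_2_eq_2 numeral_3_eq_3 One_nat_def)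
  have "\<exists>\<pi>. lmod_lin A (A.F {1..m}) (A.F {1..m}) \<pi> \<and>
      (\<forall>x\<in>carrier (A.F {1..m}). D\<^sub>1 (\<pi> x) = \<zero>\<^bsub>A.F letters\<^esub>) \<and>
      (\<forall>x\<in>carrier (A.F {1..m}). D\<^sub>1 x = \<zero>\<^bsub>A.F letters\<^esub> \<longrightarrow> \<pi> x = x)"
  proof (rule second_syzygy_retract[OF K_left_module])
    show "lmod_lin A (A.F {0}) K \<epsilon>" using \<epsilon>_graded by (auto simp: graded_hom_def intro: hom_lin)
    show "lmod_lin A (A.F letters) (A.F {0}) D\<^sub>0"
      using D\<^sub>0_graded by (auto simp: graded_hom_def intro: hom_lin)
    show "lmod_lin A (A.F {1..m}) (A.F letters) D\<^sub>1"
      using D\<^sub>1_graded by (auto simp: graded_hom_def intro: hom_lin)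
    show "lmod_lin A (Q 1) (Q 0) (d' 0)" "lmod_lin A (Q 2) (Q 1) (d' 1)"
      using lin[of 0] lin[of 1] by (simp_all add: numeral_2_eq_2 One_nat_def)
    show "d' 1 ` carrier (Q 2) = {x \<in> carrier (Q 1). d' 0 x = \<zero>\<^bsub>Q 0\<^esub>}"
      using ex(3)[of 0] by (simp add: numeral_2_eq_2 One_nat_def)
  qed (fact exact_K exact\<^sub>0 exact\<^sub>1 proj lin_e ex inj)+
  then have "a \<in> dec" if "a \<in> syz" for a
    using retract_dec that by blast
  then show ?thesis
    using syz_vpart by (simp add: no_new_syz_def)
qed

end

section \<open>Vanishing of \<open>Ext\<close> in one internal degree\<close>

lemma (in vector_space) separating_functional:
  assumes W: "subspace W" and a: "a \<notin> W"
  shows "\<exists>f. (\<forall>x y. f (x + y) = f x + f y) \<and> (\<forall>c x. f (scale c x) = c * f x) \<and>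
    (\<forall>w\<in>W. f w = 0) \<and> f a = 1"
proof -
  interpret K: vector_space "(*) :: 'a \<Rightarrow> 'a \<Rightarrow> 'a"
    by unfold_locales (simp_all add: algebra_simps)
  interpret pair: vector_space_pair scale "(*) :: 'a \<Rightarrow> 'a \<Rightarrow> 'a"
    by unfold_locales
  obtain B where B: "B \<subseteq> W" "independent B" "W \<subseteq> span B"
    using maximal_independent_subset by blast
  have "span B \<subseteq> W" using B(1) W by (rule span_minimal)
  then have "independent (insert a B)"
    using a B(2) by (intro independent_insertI) auto
  from pair.linear_independent_extend[OF this, of "\<lambda>x. if x = a then 1 else 0"]
  obtain f where f: "Vector_Spaces.linear scale (*) f" "\<forall>x\<in>insert a B. f x = (if x = a then 1 else 0)"
    by blast
  interpret f: Vector_Spaces.linear scale "(*) :: 'a \<Rightarrow> 'a \<Rightarrow> 'a" f by (rule f)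
  have "f w = 0" if "w \<in> span B" for w
    using that
  proof (induction w rule: span_induct_alt)
    case (step c x y)
    then have "f x = 0" using f(2) a B(1) by auto
    then show ?case using step by (simp add: f.add f.scale)
  qed (simp add: f.zero)
  then show ?thesis
    using f(2) B(3) f.add f.scale by (intro exI[of _ f]) auto
qed

definition tup_scale :: "'k \<Rightarrow> (nat \<Rightarrow> ('x, 'k::field) free_alg) \<Rightarrow> nat \<Rightarrow> ('x, 'k) free_alg"
  where "tup_scale c a = (\<lambda>i. fa_scale c (a i))"

interpretation tup: vector_space tup_scale
  by unfold_locales
    (simp_all add: tup_scale_def fun_eq_iff fa.scale_right_distrib fa.scale_left_distrib)

context graded_relations
begin

lemma syz_zero: "(\<lambda>_. 0) \<in> syz"
  by (simp add: syz_def)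

lemma syz_add: "a \<in> syz \<Longrightarrow> b \<in> syz \<Longrightarrow> (\<lambda>i. a i + b i) \<in> syz"
  by (simp add: syz_def distrib_right sum.distrib fa_ideal_add)

lemma syz_mult:
  assumes "a \<in> syz" shows "(\<lambda>i. t * a i) \<in> syz"
proof -
  have "(\<Sum>i=1..m. t * a i * fa_rdiv x (r i)) = t * (\<Sum>i=1..m. a i * fa_rdiv x (r i))" for x
    by (simp add: sum_distrib_left mult.assoc)
  then show ?thesis using assms by (simp add: syz_def fa_ideal_lmult)
qed

lemma dec_I: "(\<And>i. i \<in> {1..m} \<Longrightarrow> a i \<in> I) \<Longrightarrow> a \<in> dec"
  unfolding dec_def using syz_zero by (intro CollectI exI[of _ "\<lambda>_ _. 0"]) auto

lemma dec_add:
  assumes "a \<in> dec" "a' \<in> dec"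
  shows "(\<lambda>i. a i + a' i) \<in> dec"
proof -
  obtain b b' where b: "\<forall>x. b x \<in> syz" "\<forall>i\<in>{1..m}. a i - (\<Sum>x\<in>UNIV. fa_var x * b x i) \<in> I"
    and b': "\<forall>x. b' x \<in> syz" "\<forall>i\<in>{1..m}. a' i - (\<Sum>x\<in>UNIV. fa_var x * b' x i) \<in> I"
    using assms unfolding dec_def by blast
  have "a i + a' i - (\<Sum>x\<in>UNIV. fa_var x * (b x i + b' x i)) \<in> I" if "i \<in> {1..m}" for i
  proof -
    have "a i + a' i - (\<Sum>x\<in>UNIV. fa_var x * (b x i + b' x i))
        = (a i - (\<Sum>x\<in>UNIV. fa_var x * b x i)) + (a' i - (\<Sum>x\<in>UNIV. fa_var x * b' x i))"
      by (simp add: distrib_left sum.distrib)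
    then show ?thesis using b(2) b'(2) that by (simp only: fa_ideal_add)
  qed
  then show ?thesis
    unfolding dec_def using syz_add b(1) b'(1)
    by (intro CollectI exI[of _ "\<lambda>x i. b x i + b' x i"]) auto
qed

lemma dec_mult:
  assumes a: "a \<in> syz" and t: "Poly_Mapping.lookup t [] = 0"
  shows "(\<lambda>i. t * a i) \<in> dec"
proof -
  have "\<forall>w\<in>Poly_Mapping.keys t. w \<noteq> []" using t by (auto simp: in_keys_iff)
  then obtain s where "t = (\<Sum>x\<in>UNIV. fa_var x * s x)" using ldiv_exists by blast
  then have "t * a i = (\<Sum>x\<in>UNIV. fa_var x * (s x * a i))" for i
    by (simp add: sum_distrib_right mult.assoc)
  then show ?thesis
    unfolding dec_def using syz_mult[OF a]
    by (intro CollectI exI[of _ "\<lambda>x i. s x * a i"]) auto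
qed

lemma dec_scale:
  assumes "a \<in> dec"
  shows "(\<lambda>i. fa_scale c (a i)) \<in> dec"
proof -
  obtain b where b: "\<forall>x. b x \<in> syz" "\<forall>i\<in>{1..m}. a i - (\<Sum>x\<in>UNIV. fa_var x * b x i) \<in> I"
    using assms unfolding dec_def by blast
  have "fa_scale c (a i) - (\<Sum>x\<in>UNIV. fa_var x * (fa_const c * b x i)) \<in> I" if "i \<in> {1..m}" for i
  proof -
    have "fa_scale c (a i) - (\<Sum>x\<in>UNIV. fa_var x * (fa_const c * b x i))
        = fa_scale c (a i - (\<Sum>x\<in>UNIV. fa_var x * b x i))"
      by (simp add: mult_scale_right fa.scale_right_diff_distrib fa.scale_sum_right flip: fa_scale_def)
    then show ?thesis using b(2) that by (simp only: fa_ideal_scale)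
  qed
  then show ?thesis
    unfolding dec_def using syz_mult b(1)
    by (intro CollectI exI[of _ "\<lambda>x i. fa_const c * b x i"]) auto
qed

lemma vpart_dec:
  assumes "a \<in> dec" shows "vpart n a \<in> dec"
proof (rule dec_vpart[OF assms, of n])
  fix b assume "\<And>x. b x \<in> syz"
    "\<And>i. i \<in> {1..m} \<Longrightarrow> vpart n a i - (\<Sum>x\<in>UNIV. fa_var x * b x i) \<in> I"
  then show ?thesis unfolding dec_def by (intro CollectI exI[of _ b]) simp
qed

lemma vpart_subspace: "tup.subspace {a. vpart n a \<in> dec}"
proof (rule tup.subspaceI)
  have "vpart n 0 = (\<lambda>_. 0)" by (simp add: vpart_def fun_eq_iff)
  then show "0 \<in> {a. vpart n a \<in> dec}" by (auto intro: dec_I)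
next
  fix a b assume "a \<in> {a. vpart n a \<in> dec}" "b \<in> {a. vpart n a \<in> dec}"
  moreover have "vpart n (a + b) = (\<lambda>i. vpart n a i + vpart n b i)"
    by (auto simp: vpart_def fun_eq_iff part_add)
  ultimately show "a + b \<in> {a. vpart n a \<in> dec}" by (simp add: dec_add)
next
  fix c a assume "a \<in> {a. vpart n a \<in> dec}"
  moreover have "vpart n (tup_scale c a) = (\<lambda>i. fa_scale c (vpart n a i))"
    by (auto simp: vpart_def tup_scale_def fun_eq_iff part_scale)
  ultimately show "tup_scale c a \<in> {a. vpart n a \<in> dec}" by (simp add: dec_scale)
qed

text \<open>The complex \<open>A\<^sup>m \<rightarrow> A \<otimes> V \<rightarrow> A \<rightarrow> K\<close> is exact and extends to a graded free resolution.\<close>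

lemma resolution_K:
  obtains S \<delta> dd where
    "graded_free_resolution A (quot_comp (r ` {1..m})) K (triv_comp (r ` {1..m})) S \<delta> dd \<epsilon>"
    "S (Suc (Suc 0)) = {1..m}" "\<delta> (Suc (Suc 0)) = d"
    "dd (Suc (Suc 0)) ` carrier (A.F (S (Suc (Suc (Suc 0)))))
      = {z \<in> carrier (A.F {1..m}). D\<^sub>1 z = \<zero>\<^bsub>A.F letters\<^esub>}"
proof -
  let ?G = "quot_comp (r ` {1..m})"
  obtain S' \<delta>' d' where
    start: "S' 0 = letters" "S' 1 = {1..m}" "\<delta>' 0 = (\<lambda>_. 1)" "\<delta>' 1 = d" "d' 0 = D\<^sub>1" and
    graded: "\<And>i. d' i \<in> graded_hom A 0 (A.F (S' (Suc i))) (A.FG (S' (Suc i)) (\<delta>' (Suc i)))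
        (A.F (S' i)) (A.FG (S' i) (\<delta>' i))" and
    exact: "\<And>i. d' (Suc i) ` carrier (A.F (S' (Suc (Suc i))))
      = {x \<in> carrier (A.F (S' (Suc i))). d' i x = \<zero>\<^bsub>A.F (S' i)\<^esub>}"
    using A.graded_resolution_extend[OF D\<^sub>1_graded] by blast
  have start': "S' 0 = letters" "S' (Suc 0) = {1..m}" "\<delta>' 0 = (\<lambda>_. 1)" "\<delta>' (Suc 0) = d" "d' 0 = D\<^sub>1"
    using start by (simp_all flip: One_nat_def)
  define S where "S i = (case i of 0 \<Rightarrow> {0} | Suc j \<Rightarrow> S' j)" for i
  define \<delta> where "\<delta> i = (case i of 0 \<Rightarrow> (\<lambda>_. 0) | Suc j \<Rightarrow> \<delta>' j)" for i
  define dd where "dd i = (case i of 0 \<Rightarrow> D\<^sub>0 | Suc j \<Rightarrow> d' j)" for i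
  have S: "S 0 = {0}" "S (Suc j) = S' j" "\<delta> 0 = (\<lambda>_. 0)" "\<delta> (Suc j) = \<delta>' j" "dd 0 = D\<^sub>0" "dd (Suc j) = d' j" for j
    by (simp_all add: S_def \<delta>_def dd_def)
  have dd: "dd i \<in> graded_hom A 0 (A.F (S (Suc i))) (A.FG (S (Suc i)) (\<delta> (Suc i)))
        (A.F (S i)) (A.FG (S i) (\<delta> i))" for i
  proof (cases i)
    case 0
    then show ?thesis using D\<^sub>0_graded start' by (simp add: S)
  next
    case (Suc j)
    then show ?thesis using graded[of j] by (simp add: S)
  qed
  have ex: "dd (Suc i) ` carrier (A.F (S (Suc (Suc i))))
      = {x \<in> carrier (A.F (S (Suc i))). dd i x = \<zero>\<^bsub>A.F (S i)\<^esub>}" for i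
  proof (cases i)
    case 0
    then show ?thesis using exact\<^sub>1 start' by (simp add: S)
  next
    case (Suc j)
    then show ?thesis using exact[of j] by (simp add: S)
  qed
  have ex0: "dd 0 ` carrier (A.F (S 1)) = {x \<in> carrier (A.F (S 0)). \<epsilon> x = \<zero>\<^bsub>K\<^esub>}"
    using exact\<^sub>0 start' S(2)[of 0] by (simp add: S(1,5) flip: One_nat_def)
  have eps: "\<epsilon> \<in> graded_hom A 0 (A.F (S 0)) (A.FG (S 0) (\<delta> 0)) K (triv_comp (r ` {1..m}))"
    using \<epsilon>_graded by (simp add: S)
  have "graded_free_resolution A ?G K (triv_comp (r ` {1..m})) S \<delta> dd \<epsilon>"
    unfolding graded_free_resolution_def resolution_def
  proof (intro conjI allI)
    show "left_module A K" by (rule K_left_module)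
    show "left_module A (A.F (S i))" for i by (rule A.free_left_module)
    show "\<epsilon> \<in> lmod_hom A (A.F (S 0)) K" using eps by (simp add: graded_hom_def)
    show "dd i \<in> lmod_hom A (A.F (S (Suc i))) (A.F (S i))" for i
      using dd[of i] by (simp add: graded_hom_def)
    show "\<epsilon> ` carrier (A.F (S 0)) = carrier K" using exact_K by (simp add: S)
  qed (rule ex0 ex eps dd)+
  then show ?thesis
  proof (rule that)
    show "S (Suc (Suc 0)) = {1..m}" "\<delta> (Suc (Suc 0)) = d" using start' by (simp_all add: S)
    show "dd (Suc (Suc 0)) ` carrier (A.F (S (Suc (Suc (Suc 0)))))
      = {z \<in> carrier (A.F {1..m}). D\<^sub>1 z = \<zero>\<^bsub>A.F letters\<^esub>}"
      using exact[of 0] start' by (simp add: S)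
  qed
qed

text \<open>A homogeneous syzygy outside \<open>dec\<close> is detected by a functional that vanishes on \<open>dec\<close> and in
  the other degrees.  It is linear over \<open>A\<close> as a map from the syzygies to \<open>K\<close>, so its composition
  with the third map of the resolution is a cocycle.  Coboundaries come from maps defined on all
  of \<open>A\<^sup>m\<close>; these kill the syzygies, which have coefficients in \<open>A\<^sub>+\<close> by minimality.\<close>

lemma ext_no_new_syz:
  assumes ext: "\<not> ext_nonzero A (quot_comp (r ` {1..m})) K (triv_comp (r ` {1..m}))
    K (triv_comp (r ` {1..m})) 3 n"
  shows "no_new_syz n"
  unfolding no_new_syz_def
proof (rule ballI, rule ccontr)
  let ?G = "quot_comp (r ` {1..m})" and ?KG = "triv_comp (r ` {1..m})"
  let ?F = "A.F {1..m}"
  interpret F: left_module A ?F by (rule A.free_left_module)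
  interpret K: left_module A K by (rule K_left_module)
  fix a\<^sub>0 assume a\<^sub>0: "a\<^sub>0 \<in> syz" "vpart n a\<^sub>0 \<notin> dec"
  obtain L :: "(nat \<Rightarrow> ('x, 'k) free_alg) \<Rightarrow> 'k" where
    L_add: "\<And>a b. L (a + b) = L a + L b" and L_scale: "\<And>c a. L (tup_scale c a) = c * L a" and
    L_dec: "\<And>a. vpart n a \<in> dec \<Longrightarrow> L a = 0" and L_a\<^sub>0: "L a\<^sub>0 = 1"
    using tup.separating_functional[OF vpart_subspace, of a\<^sub>0 n] a\<^sub>0(2) by auto
  define \<phi> where "\<phi> z = tr (fa_const (L (\<lambda>i. lft (z i))))" for z
  have \<phi>_vec: "\<phi> (vec {1..m} a) = tr (fa_const (L a))" for a
  proof -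
    define b where "b i = lft (vec {1..m} a i) - a i" for i
    have "b i \<in> I" if "i \<in> {1..m}" for i using that by (simp add: b_def vec_def lft_proj)
    then have "L b = 0" by (intro L_dec vpart_dec dec_I)
    moreover have "(\<lambda>i. lft (vec {1..m} a i)) = b + a" by (simp add: b_def fun_eq_iff)
    ultimately show ?thesis by (simp add: \<phi>_def L_add)
  qed
  have \<phi>_add: "\<phi> (x \<oplus>\<^bsub>?F\<^esub> y) = \<phi> x \<oplus>\<^bsub>K\<^esub> \<phi> y" if xy: "x \<in> carrier ?F" "y \<in> carrier ?F" for x y
  proof -
    obtain a b where ab: "x = vec {1..m} a" "y = vec {1..m} b" using carrier_vec xy by blast
    have "(\<lambda>i. a i + b i) = a + b" by (simp add: fun_eq_iff)
    then show ?thesis by (simp add: ab vec_add \<phi>_vec L_add K_add fa_const_add)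
  qed
  have \<phi>_smult: "\<phi> (c \<odot>\<^bsub>?F\<^esub> x) = c \<odot>\<^bsub>K\<^esub> \<phi> x"
    if c: "c \<in> carrier A" and x: "x \<in> carrier ?F" "D\<^sub>1 x = \<zero>\<^bsub>A.F letters\<^esub>" for c x
  proof -
    obtain t where t: "c = pr t" using c by (auto simp: fa_quot_carrier)
    obtain a where a: "x = vec {1..m} a" using carrier_vec x by blast
    have syz: "a \<in> syz" using x(2) by (simp add: a D\<^sub>1_zero_iff)
    define k where "k = Poly_Mapping.lookup t []"
    have "(\<lambda>i. (t - fa_const k) * a i) \<in> dec"
      by (rule dec_mult[OF syz]) (simp add: lookup_minus lookup_const k_def)
    then have "L (\<lambda>i. (t - fa_const k) * a i) = 0" by (intro L_dec vpart_dec)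
    moreover have "(\<lambda>i. t * a i) = (\<lambda>i. (t - fa_const k) * a i) + tup_scale k a"
      by (simp add: fun_eq_iff tup_scale_def fa_scale_def left_diff_distrib)
    ultimately have "L (\<lambda>i. t * a i) = k * L a" by (simp add: L_add L_scale)
    then show ?thesis
      by (simp add: t a vec_smult \<phi>_vec K_smult tr_eq_iff lookup_Nil_mult lookup_const k_def)
  qed
  obtain S \<delta> dd where res: "graded_free_resolution A ?G K ?KG S \<delta> dd \<epsilon>"
    and S2: "S (Suc (Suc 0)) = {1..m}" "\<delta> (Suc (Suc 0)) = d"
    and im: "dd (Suc (Suc 0)) ` carrier (A.F (S (Suc (Suc (Suc 0)))))
      = {z \<in> carrier ?F. D\<^sub>1 z = \<zero>\<^bsub>A.F letters\<^esub>}"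
    by (rule resolution_K)
  define Q where "Q = A.F (S (Suc (Suc (Suc 0))))"
  define D where "D = dd (Suc (Suc 0))"
  interpret Q: left_module A Q unfolding Q_def by (rule A.free_left_module)
  have D: "D \<in> graded_hom A 0 Q (A.FG (S (Suc (Suc (Suc 0)))) (\<delta> (Suc (Suc (Suc 0))))) ?F (A.FG {1..m} d)"
    using res S2 unfolding graded_free_resolution_def Q_def D_def by metis
  have D_lin: "lmod_lin A Q ?F D" using D by (auto simp: graded_hom_def intro: hom_lin)
  have D_im: "D ` carrier Q = {z \<in> carrier ?F. D\<^sub>1 z = \<zero>\<^bsub>A.F letters\<^esub>}"
    using im by (simp add: D_def Q_def)
  then have D_ker: "D\<^sub>1 (D x) = \<zero>\<^bsub>A.F letters\<^esub>" if "x \<in> carrier Q" for x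
    using that by blast
  have "\<forall>i. dd (Suc i) ` carrier (A.F (S (Suc (Suc i))))
      = {x \<in> carrier (A.F (S (Suc i))). dd i x = \<zero>\<^bsub>A.F (S i)\<^esub>}"
    using res by (simp add: graded_free_resolution_def resolution_def)
  from spec[OF this, of "Suc (Suc 0)"]
  have D_ker_im: "dd (Suc (Suc (Suc 0))) ` carrier (A.F (S (Suc (Suc (Suc (Suc 0))))))
      = {x \<in> carrier Q. D x = \<zero>\<^bsub>?F\<^esub>}"
    by (simp add: S2 Q_def D_def)
  define f where "f = (\<lambda>x\<in>carrier Q. \<phi> (D x))"
  have "lmod_lin A Q K (\<lambda>x. \<phi> (D x))"
    unfolding lmod_lin_def
    by (auto simp: lin_add[OF D_lin] lin_smult[OF D_lin] lin_closed[OF D_lin] \<phi>_add \<phi>_smult D_ker)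
      (simp add: \<phi>_def K_carrier)
  then have f_hom: "f \<in> lmod_hom A Q K"
    unfolding f_def by (rule lin_restrict_hom[OF Q.left_module_axioms])
  have f_graded: "if n \<le> j then f x \<in> ?KG (j - n) else f x = \<zero>\<^bsub>K\<^esub>"
    if x: "x \<in> A.FG (S (Suc (Suc (Suc 0)))) (\<delta> (Suc (Suc (Suc 0)))) j" for j x
  proof -
    have xQ: "x \<in> carrier Q" using x A.FG_carrierD unfolding Q_def by blast
    have "D x \<in> A.FG {1..m} d j" using D x by (simp add: graded_hom_def)
    then obtain t where t: "D x = vec {1..m} t" "thom {1..m} d j t" by (rule free_comp_vec)
    have "vhom j t"
      using t(2) fa.subspace_0[OF subspace_comp] unfolding thom_def vhom_def by metis
    then have "L t = 0" if "j \<noteq> n"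
      using vpart_other[OF _ that] dec_I by (intro L_dec) auto
    then have "f x = \<zero>\<^bsub>K\<^esub>" if "j \<noteq> n"
      using that xQ by (simp add: f_def t(1) \<phi>_vec fa_const_zero tr_zero_iff)
    moreover have "f x \<in> carrier K" using xQ by (simp add: f_def \<phi>_def K_carrier)
    ultimately show ?thesis by (auto simp: triv_comp_def)
  qed
  have "f \<in> ext_cocycles A ?G S \<delta> dd K ?KG (Suc (Suc (Suc 0))) n"
    unfolding ext_cocycles_def ext_cochains_def graded_hom_def
  proof (intro CollectI conjI allI ballI)
    fix y assume y: "y \<in> carrier (A.F (S (Suc (Suc (Suc (Suc 0))))))"
    then have "dd (Suc (Suc (Suc 0))) y \<in> {x \<in> carrier Q. D x = \<zero>\<^bsub>?F\<^esub>}"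
      unfolding D_ker_im[symmetric] by (rule imageI)
    moreover have "\<phi> \<zero>\<^bsub>?F\<^esub> = \<zero>\<^bsub>K\<^esub>"
      using L_dec[of "\<lambda>_. 0"] by (simp add: vec_zero \<phi>_vec dec_I vpart_dec tr_zero_iff lookup_const)
    ultimately show "f (dd (Suc (Suc (Suc 0))) y) = \<zero>\<^bsub>K\<^esub>" by (simp add: f_def)
  qed (use f_hom f_graded in \<open>simp_all add: Q_def\<close>)
  also have "\<dots> = ext_coboundaries A ?G S \<delta> dd K ?KG (Suc (Suc (Suc 0))) n"
    using ext res unfolding ext_nonzero_def numeral_3_eq_3 by blast
  finally obtain g where "g \<in> lmod_hom A ?F K" and fg: "f = compose (carrier Q) g D"
    by (auto simp: ext_coboundaries_def ext_cochains_def graded_hom_def S2 Q_def D_def)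
  then have g: "lmod_lin A ?F K g" by (auto intro: hom_lin)
  obtain t where t: "vec {1..m} a\<^sub>0 = vec {1..m} (\<lambda>i. \<Sum>x\<in>UNIV. fa_var x * t x i)"
    using a\<^sub>0(1) by (rule syz_letters)
  have "pr (fa_var x) \<odot>\<^bsub>K\<^esub> g (vec {1..m} (t x)) = \<zero>\<^bsub>K\<^esub>" for x
  proof -
    have "g (vec {1..m} (t x)) \<in> carrier K" by (rule lin_closed[OF g vec_carrier]) simp
    then obtain h where "g (vec {1..m} (t x)) = tr h" unfolding K_carrier by blast
    then show ?thesis
      by (simp add: K_smult tr_zero_iff lookup_Nil_mult fa_var_def lookup_single)
  qed
  then have g0: "g (vec {1..m} a\<^sub>0) = \<zero>\<^bsub>K\<^esub>"
    unfolding t lin_letters_finite[OF K_left_module g finite] by simp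
  have "vec {1..m} a\<^sub>0 \<in> D ` carrier Q"
    unfolding D_im using a\<^sub>0(1) by (simp add: vec_carrier D\<^sub>1_zero_iff)
  then obtain x where x: "x \<in> carrier Q" "D x = vec {1..m} a\<^sub>0" by force
  have "\<phi> (D x) = g (D x)"
    using fun_cong[OF fg, of x] x(1) by (simp add: f_def compose_def)
  then have "tr (fa_const 1) = \<zero>\<^bsub>K\<^esub>" using g0 by (simp add: x(2) \<phi>_vec L_a\<^sub>0)
  then show False by (simp add: tr_zero_iff lookup_const)
qed

text \<open>The subtraction of \<open>1\<close> in the complexity matches the shift between the Jacobi condition for \<open>k\<close>
  and the syzygies of degree \<open>k + 1\<close>.\<close>

lemma complexity_no_new_syz:
  assumes "complexity (r ` {1..m}) < enat k"
  shows "no_new_syz (Suc k)"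
proof (cases "3 \<le> gl_dim A")
  case True
  let ?E = "{enat n |n. ext_nonzero A (quot_comp (r ` {1..m})) K (triv_comp (r ` {1..m}))
    K (triv_comp (r ` {1..m})) 3 n}"
  have c: "complexity (r ` {1..m}) = Sup ?E - 1" using True by (simp add: complexity_def)
  have "enat (Suc k) \<notin> ?E"
  proof
    assume "enat (Suc k) \<in> ?E"
    then have le: "enat (Suc k) \<le> Sup ?E" by (rule Sup_upper)
    have "enat k \<le> Sup ?E - 1"
      using le by (cases "Sup ?E") (auto simp: one_enat_def)
    then show False using assms c by simp
  qed
  then show ?thesis by (intro ext_no_new_syz) auto
next
  case False
  then show ?thesis by (rule gl_dim_no_new_syz)
qed

end

section \<open>The Jacobi criterion\<close>

theorem theorem4p2:
  fixes m :: nat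
    and r l :: "nat \<Rightarrow> ('x::finite, 'k::field) free_alg"
    and P :: "('x, 'k) free_alg set"
  assumes "graded_presentation m r"
    and "complexity (r ` {1..m}) \<noteq> \<infinity>"
    and "deformation m r l"
    and P_def: "P = (\<lambda>i. r i + l i) ` {1..m}"
  shows "is_PBW (r ` {1..m}) P \<longleftrightarrow>
    P_space P 1 = {0} \<and>
    (\<forall>k\<ge>1. enat k \<le> complexity (r ` {1..m}) \<longrightarrow> P_space P (k + 1) \<inter> fa_filt k \<subseteq> P_space P k)"
proof -
  have "\<forall>i\<in>{1..m}. \<exists>d\<ge>2. r i \<in> fa_comp d"
    using assms(1) by (simp add: graded_presentation_def)
  then obtain d where d: "\<And>i. i \<in> {1..m} \<Longrightarrow> 2 \<le> d i \<and> r i \<in> fa_comp (d i)"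
    by metis
  have min: "r i \<notin> fa_ideal (r ` ({1..m} - {i}))" if "i \<in> {1..m}" for i
    using assms(1) that by (simp add: graded_presentation_def)
  have below: "l i \<in> fa_filt_below (d i)" if i: "i \<in> {1..m}" for i
  proof -
    have "r i \<noteq> 0" using min[OF i] by fastforce
    then have ne: "Poly_Mapping.keys (r i) \<noteq> {}" by (simp add: poly_mapping_eq_iff fun_eq_iff in_keys_iff set_eq_iff)
    have len: "length w = d i" if "w \<in> Poly_Mapping.keys (r i)" for w
      using d[OF i] that by (simp add: fa_comp_def)
    have "length ` Poly_Mapping.keys (r i) = (\<lambda>_. d i) ` Poly_Mapping.keys (r i)"
      by (rule image_cong) (simp_all add: len)
    then have "length ` Poly_Mapping.keys (r i) = {d i}"
      using ne by (simp add: image_constant_conv)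
    then have "fa_deg (r i) = d i"
      using \<open>r i \<noteq> 0\<close> by (simp add: fa_deg_def)
    then have "fa_deg (l i) < d i"
      using assms(3) i unfolding deformation_def by force
    moreover have "length w \<le> fa_deg (l i)" if "w \<in> Poly_Mapping.keys (l i)" for w
      using that by (auto simp: fa_deg_def intro!: Max_ge)
    ultimately show ?thesis by (force simp: fa_filt_below_def)
  qed
  interpret deformation_data m r d l
    by unfold_locales (use d min below in auto)
  have P: "P = p ` {1..m}" by (simp add: P_def p_def)
  have one: "P_space P 1 = {0}"
  proof -
    have "p ` {1..m} \<inter> fa_filt 1 = {}" using d_ge by (force simp: P_filt)
    then show ?thesis by (simp add: P One_nat_def)
  qed
  have "(\<forall>k. jacobi k) \<longleftrightarrow> (\<forall>k\<ge>1. enat k \<le> complexity (r ` {1..m}) \<longrightarrow> jacobi k)"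
  proof (intro iffI allI)
    fix k assume J: "\<forall>k\<ge>1. enat k \<le> complexity (r ` {1..m}) \<longrightarrow> jacobi k"
    show "jacobi k"
    proof (induction k)
      case 0
      show ?case by (rule jacobi_zero)
    next
      case (Suc k)
      show ?case
      proof (cases "enat (Suc k) \<le> complexity (r ` {1..m})")
        case True
        then show ?thesis using J by simp
      next
        case False
        then have "no_new_syz (Suc (Suc k))" by (intro complexity_no_new_syz) simp
        then show ?thesis by (rule jacobi_step) (use Suc in simp_all)
      qed
    qed
  qed simp
  then show ?thesis
    using PBW_iff_jacobi one by (simp add: jacobi_def P flip: Suc_eq_plus1)
qed

end
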